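(* Let $f\in\Pi$ and assume that $f'$ is polynomially bounded. Then for the $n$-period generalised binomial model, the price of a European option $f(S_T)$ satisfies $$\begin{aligned} V^f_{BT(n)}&=V^f_{BS}+\frac1{\sqrt n}\int_0^\infty f'(a)\frac{e^{-rT}e^{-d_2^2/2}}{\sqrt{2\pi}}\Delta_n\,\mathrm da\\ &\quad+\frac1n\int_0^\infty f'(a)\frac{e^{-rT}e^{-d_2^2/2}}{\sqrt{2\pi}}\left[B_n-\frac{d_2\Delta_n^2}{2}\right]\mathrm da\\ &\quad+\sum_{s_k\in N_1}\Delta_-f(s_k)J_n(s_k)+\sum_{s_k\in N_1}\Delta_+f(s_k)\widehat J_n(s_k)\\ &\quad+\sum_{s_k\in N_2}\left[\Delta_-f(s_k)+\Delta_+f(s_k)\right]J_n(s_k)+o\left(\frac1n\right), \end{aligned}$$ where $N_1$ is the set of jumps of $f$ on the lattice points and $N_2$ is the set of jumps of $f$ not on the lattice points. Moreover, the two integrals are bounded in $n$.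
   Context: Payoffs. $f:[0,\infty)\to\mathbb R$ belongs to $\Pi$ if $f$ is continuously differentiable except on a finite set of points $0<s_1<\dots<s_N$ (and possibly at $s_0=0$), at which $f$ and $f'$ have jump discontinuities. $\Delta_-f(s_k)=f(s_k)-f(s_k-)$ and $\Delta_+f(s_k)=f(s_k+)-f(s_k)$, with the convention $\Delta_-f(0)=f(0-)=f'(0-)=0$. "$f'$ polynomially bounded" means there are positive constants $c_1,c_2,p$ with $|f'(a)|\le c_1+c_2a^p$ for every $a\ge0$ (where $f'$ exists). Models. $S_0>0$ is the initial stock price, $\sigma>0$ the volatility, $r$ the continuously compounded interest rate, $T>0$ the maturity, and the bond is $B_t=e^{rt}$. Black–Scholes price: $V^f_{BS}=e^{-rT}\mathbb E[f(S_T)]$ with $S_T=S_0\exp((r-\sigma^2/2)T+\sigma\sqrt T Z)$, $Z$ standard normal. Generalised binomial model with $n$ periods: $\Delta t=T/n$, $(\lambda_n)$ is an arbitrary bounded sequence, $$u=e^{\sigma\sqrt{\Delta t}+\lambda_n\sigma^2\Delta t},\qquad d=e^{-\sigma\sqrt{\Delta t}+\lambda_n\sigma^2\Delta t};$$ in each period the stock is multiplied by $u$ or $d$, and $V^f_{BT(n)}$ is the price $e^{-rT}\sum_{j=0}^n\binom nj p_n^j(1-p_n)^{n-j}f(S_0u^jd^{n-j})$ under the risk-neutral probability $p_n=(e^{r\Delta t}-d)/(u-d)$ (which lies in $(0,1)$ for large $n$). Lattice points are the terminal stock prices $S_0u^jd^{n-j}$, $0\le j\le n$. Functions of $n$ and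 the strike $a>0$: $$d_1=\frac{\log\frac{S_0}{a}+(r+\frac{\sigma^2}2)T}{\sigma\sqrt T},\quad d_2=d_1-\sigma\sqrt T,\quad \Delta_n=1-2\,\mathrm{frac}\left[\frac{\log\frac{S_0}{a}+n\log d}{\log\frac ud}\right],$$ where $\mathrm{frac}(x)$ is the fractional part of $x$, $$B_n=\frac{d_1^3+d_1d_2^2+2d_2-4d_1}{24}+\frac{(2-d_1d_2-d_1^2)\sqrt T}{6\sigma}(r-\lambda_n\sigma^2)+\frac{Td_1}{2\sigma^2}(r-\lambda_n\sigma^2)^2,$$ $$J_n=\frac{e^{-rT}e^{-d_2^2/2}}{\sqrt{2\pi}}\left[\frac{\Delta_n}{\sqrt n}-\frac{d_2\Delta_n^2}{2n}+\frac{B_n}n\right],$$ $$\widehat J_n=\frac{e^{-rT}e^{-d_2^2/2}}{\sqrt{2\pi}}\left[\frac{\Delta_n-2}{\sqrt n}-\frac{d_2(\Delta_n-2)^2}{2n}+\frac{B_n}n\right].$$ At $a=0$ these functions $J_n,\widehat J_n$ are understood as their limit, $0$. *)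

theory Defs
  imports "HOL-Probability.Probability" "HOL-Library.Landau_Symbols"
begin

text \<open>A payoff on $[0,\infty)$ is represented by a function on the reals; its values at negative
  arguments play no role.\<close>

subsection \<open>Payoffs\<close>

text \<open>\<open>S\<close> is the set $\{s_1 < \dots < s_N\}$. The exceptional points have finite one-sided limits of
  \<open>f\<close> and \<open>f'\<close>, and the jump of either may be zero (e.g. call options: \<open>f\<close> is continuous, \<open>f'\<close> is not).
  Whether or not $0$ is exceptional, all that is required there is that the right limits of
  \<open>f\<close> and \<open>f'\<close> exist.\<close>

definition payoff_class :: "(real \<Rightarrow> real) set" where
  "payoff_class = {f. \<exists>S. finite S \<and> S \<subseteq> {0<..} \<and>
     f C1_differentiable_on ({0<..} - S) \<and>
     (\<forall>s\<in>insert 0 S. (\<exists>L. (f \<longlongrightarrow> L) (at_right s)) \<and> (\<exists>L. (deriv f \<longlongrightarrow> L) (at_right s))) \<and>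
     (\<forall>s\<in>S. (\<exists>L. (f \<longlongrightarrow> L) (at_left s)) \<and> (\<exists>L. (deriv f \<longlongrightarrow> L) (at_left s)))}"

definition deriv_poly_bounded :: "(real \<Rightarrow> real) \<Rightarrow> bool" where
  "deriv_poly_bounded f \<longleftrightarrow> (\<exists>c1>0. \<exists>c2>0. \<exists>p>0. \<forall>a\<ge>0. \<forall>D.
     (f has_real_derivative D) (at a within {0..}) \<longrightarrow> \<bar>D\<bar> \<le> c1 + c2 * a powr p)"

definition jump_points :: "(real \<Rightarrow> real) \<Rightarrow> real set" where
  "jump_points f = {s. 0 \<le> s \<and> \<not> continuous (at s within {0..}) f}"

definition left_jump :: "(real \<Rightarrow> real) \<Rightarrow> real \<Rightarrow> real" where
  "left_jump f s = (if s = 0 then 0 else f s - Lim (at_left s) f)"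

definition right_jump :: "(real \<Rightarrow> real) \<Rightarrow> real \<Rightarrow> real" where
  "right_jump f s = Lim (at_right s) f - f s"

subsection \<open>Black--Scholes model\<close>

definition BS_stock :: "real \<Rightarrow> real \<Rightarrow> real \<Rightarrow> real \<Rightarrow> real \<Rightarrow> real" where
  "BS_stock S0 \<sigma> r T z = S0 * exp ((r - \<sigma>\<^sup>2 / 2) * T + \<sigma> * sqrt T * z)"

definition V_BS :: "real \<Rightarrow> real \<Rightarrow> real \<Rightarrow> real \<Rightarrow> (real \<Rightarrow> real) \<Rightarrow> real" where
  "V_BS S0 \<sigma> r T f = exp (- r * T) * (LINT z|std_normal_distribution. f (BS_stock S0 \<sigma> r T z))"

subsection \<open>Generalised binomial model with \<open>n\<close> periods\<close>

definition up_factor :: "real \<Rightarrow> real \<Rightarrow> (nat \<Rightarrow> real) \<Rightarrow> nat \<Rightarrow> real" where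
  "up_factor \<sigma> T lam n = exp (\<sigma> * sqrt (T / real n) + lam n * \<sigma>\<^sup>2 * (T / real n))"

definition down_factor :: "real \<Rightarrow> real \<Rightarrow> (nat \<Rightarrow> real) \<Rightarrow> nat \<Rightarrow> real" where
  "down_factor \<sigma> T lam n = exp (- \<sigma> * sqrt (T / real n) + lam n * \<sigma>\<^sup>2 * (T / real n))"

definition risk_neutral_prob :: "real \<Rightarrow> real \<Rightarrow> real \<Rightarrow> (nat \<Rightarrow> real) \<Rightarrow> nat \<Rightarrow> real" where
  "risk_neutral_prob \<sigma> r T lam n =
     (exp (r * (T / real n)) - down_factor \<sigma> T lam n) / (up_factor \<sigma> T lam n - down_factor \<sigma> T lam n)"

definition lattice_point :: "real \<Rightarrow> real \<Rightarrow> real \<Rightarrow> (nat \<Rightarrow> real) \<Rightarrow> nat \<Rightarrow> nat \<Rightarrow> real" where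
  "lattice_point S0 \<sigma> T lam n j = S0 * up_factor \<sigma> T lam n ^ j * down_factor \<sigma> T lam n ^ (n - j)"

definition lattice_points :: "real \<Rightarrow> real \<Rightarrow> real \<Rightarrow> (nat \<Rightarrow> real) \<Rightarrow> nat \<Rightarrow> real set" where
  "lattice_points S0 \<sigma> T lam n = lattice_point S0 \<sigma> T lam n ` {0..n}"

definition V_BT :: "real \<Rightarrow> real \<Rightarrow> real \<Rightarrow> real \<Rightarrow> (nat \<Rightarrow> real) \<Rightarrow> nat \<Rightarrow> (real \<Rightarrow> real) \<Rightarrow> real" where
  "V_BT S0 \<sigma> r T lam n f = exp (- r * T) *
     (\<Sum>j=0..n. real (n choose j) * risk_neutral_prob \<sigma> r T lam n ^ j *
        (1 - risk_neutral_prob \<sigma> r T lam n) ^ (n - j) * f (lattice_point S0 \<sigma> T lam n j))"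

subsection \<open>Coefficient functions of the strike \<open>a\<close>\<close>

definition d1 :: "real \<Rightarrow> real \<Rightarrow> real \<Rightarrow> real \<Rightarrow> real \<Rightarrow> real" where
  "d1 S0 \<sigma> r T a = (ln (S0 / a) + (r + \<sigma>\<^sup>2 / 2) * T) / (\<sigma> * sqrt T)"

definition d2 :: "real \<Rightarrow> real \<Rightarrow> real \<Rightarrow> real \<Rightarrow> real \<Rightarrow> real" where
  "d2 S0 \<sigma> r T a = d1 S0 \<sigma> r T a - \<sigma> * sqrt T"

definition Delta_n :: "real \<Rightarrow> real \<Rightarrow> real \<Rightarrow> (nat \<Rightarrow> real) \<Rightarrow> nat \<Rightarrow> real \<Rightarrow> real" where
  "Delta_n S0 \<sigma> T lam n a =
     1 - 2 * frac ((ln (S0 / a) + real n * ln (down_factor \<sigma> T lam n)) /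
                   ln (up_factor \<sigma> T lam n / down_factor \<sigma> T lam n))"

definition B_n :: "real \<Rightarrow> real \<Rightarrow> real \<Rightarrow> real \<Rightarrow> (nat \<Rightarrow> real) \<Rightarrow> nat \<Rightarrow> real \<Rightarrow> real" where
  "B_n S0 \<sigma> r T lam n a =
     (let x = d1 S0 \<sigma> r T a; y = d2 S0 \<sigma> r T a in
       (x ^ 3 + x * y\<^sup>2 + 2 * y - 4 * x) / 24
       + (2 - x * y - x\<^sup>2) * sqrt T / (6 * \<sigma>) * (r - lam n * \<sigma>\<^sup>2)
       + T * x / (2 * \<sigma>\<^sup>2) * (r - lam n * \<sigma>\<^sup>2)\<^sup>2)"

definition weight :: "real \<Rightarrow> real \<Rightarrow> real \<Rightarrow> real \<Rightarrow> real \<Rightarrow> real" where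
  "weight S0 \<sigma> r T a = exp (- r * T) * exp (- (d2 S0 \<sigma> r T a)\<^sup>2 / 2) / sqrt (2 * pi)"

text \<open>The value $0$ at \<open>a = 0\<close> is the limit from the right.\<close>

definition J_n :: "real \<Rightarrow> real \<Rightarrow> real \<Rightarrow> real \<Rightarrow> (nat \<Rightarrow> real) \<Rightarrow> nat \<Rightarrow> real \<Rightarrow> real" where
  "J_n S0 \<sigma> r T lam n a = (if a = 0 then 0 else
     weight S0 \<sigma> r T a *
       (Delta_n S0 \<sigma> T lam n a / sqrt (real n)
        - d2 S0 \<sigma> r T a * (Delta_n S0 \<sigma> T lam n a)\<^sup>2 / (2 * real n)
        + B_n S0 \<sigma> r T lam n a / real n))"

definition J_hat_n :: "real \<Rightarrow> real \<Rightarrow> real \<Rightarrow> real \<Rightarrow> (nat \<Rightarrow> real) \<Rightarrow> nat \<Rightarrow> real \<Rightarrow> real" where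
  "J_hat_n S0 \<sigma> r T lam n a = (if a = 0 then 0 else
     weight S0 \<sigma> r T a *
       ((Delta_n S0 \<sigma> T lam n a - 2) / sqrt (real n)
        - d2 S0 \<sigma> r T a * (Delta_n S0 \<sigma> T lam n a - 2)\<^sup>2 / (2 * real n)
        + B_n S0 \<sigma> r T lam n a / real n))"

definition integrand1 ::
  "real \<Rightarrow> real \<Rightarrow> real \<Rightarrow> real \<Rightarrow> (nat \<Rightarrow> real) \<Rightarrow> (real \<Rightarrow> real) \<Rightarrow> nat \<Rightarrow> real \<Rightarrow> real" where
  "integrand1 S0 \<sigma> r T lam f n a = deriv f a * weight S0 \<sigma> r T a * Delta_n S0 \<sigma> T lam n a"

definition integrand2 ::
  "real \<Rightarrow> real \<Rightarrow> real \<Rightarrow> real \<Rightarrow> (nat \<Rightarrow> real) \<Rightarrow> (real \<Rightarrow> real) \<Rightarrow> nat \<Rightarrow> real \<Rightarrow> real" where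
  "integrand2 S0 \<sigma> r T lam f n a = deriv f a * weight S0 \<sigma> r T a *
     (B_n S0 \<sigma> r T lam n a - d2 S0 \<sigma> r T a * (Delta_n S0 \<sigma> T lam n a)\<^sup>2 / 2)"

definition N1 :: "real \<Rightarrow> real \<Rightarrow> real \<Rightarrow> (nat \<Rightarrow> real) \<Rightarrow> (real \<Rightarrow> real) \<Rightarrow> nat \<Rightarrow> real set" where
  "N1 S0 \<sigma> T lam f n = jump_points f \<inter> lattice_points S0 \<sigma> T lam n"

definition N2 :: "real \<Rightarrow> real \<Rightarrow> real \<Rightarrow> (nat \<Rightarrow> real) \<Rightarrow> (real \<Rightarrow> real) \<Rightarrow> nat \<Rightarrow> real set" where
  "N2 S0 \<sigma> T lam f n = jump_points f - lattice_points S0 \<sigma> T lam n"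

end

theory Submission
  imports Defs "HOL-Real_Asymp.Real_Asymp"
begin

text \<open>By summation over jumps and slopes, a price is determined by the probabilities
  \<open>P (S\<^sub>n \<ge> a)\<close>, so it suffices to expand these with an error \<open>O (n powr (-5/4) * exp (- K * \<bar>d2\<bar>))\<close>
  for every \<open>K\<close>; the weight makes the error integrable against a polynomially bounded \<open>f'\<close>.
  In standardised coordinates the successive ratios of binomial masses are explicit in terms of
  \<open>artanh\<close>, and they agree up to summable errors with those of the masses \<open>U (z - e) - U (z + e)\<close> of
  lattice cells, where \<open>U\<close> is the Gaussian tail corrected by \<open>B\<^sub>n / n\<close> and \<open>e = 1 / sqrt n\<close>. As both families
  have total mass close to \<open>1\<close>, they are close, with no need for Stirling's formula; telescoping
  gives the tail probabilities at midpoints of cells and a Taylor expansion of \<open>U\<close> moves the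
  argument from the midpoint to \<open>a\<close>, which produces the terms in \<open>\<Delta>\<^sub>n\<close>. The uniform bound and the
  exponential moment bound for the tails are combined by interpolation.\<close>

subsection \<open>Elementary estimates\<close>

text \<open>The obstacle is uniformity: the strike ranges over an unbounded interval,
  \<open>f'\<close> may grow like a power and \<open>lam\<close> is only bounded. Hence all
  constants depend on the model through a single bound \<open>M\<close>, and the local comparison is
  confined to a window |z| \<le> L with L = ln n. The window holds about L sqrt n nodes, and
  neighbouring log ratios differ by e^4 times a power of L, so the log errors add up to n^(-3/2)
  times a power of ln n, which is below n^(-11/8). Outside the window the error is of order n^(-2).
  The interpolation takes the power 10/11 of the uniform bound and the power 1/11 of an exponential
  bound of rate 11 K: then (11/8)(10/11) = 5/4, which exceeds 1, and the rate K survives. The nodes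
  are centred at \<open>shift n\<close>, the leading term of the scaled half log-odds
  \<open>tilt n\<close>, and not at \<open>tilt n\<close> itself, because only then is the
  coordinate of a strike exactly - d2. The remaining gap of order 1/n is absorbed by the free
  constant b of \<open>tail_poly\<close>, and this forces b = \<open>coef n\<close>.\<close>

lemma diff_zero_le_of_deriv_bound:
  fixes F :: "real \<Rightarrow> real"
  assumes D: "\<And>u. \<bar>u\<bar> \<le> \<bar>t\<bar> \<Longrightarrow> (F has_real_derivative F' u) (at u)"
    and E: "\<And>u. \<bar>u\<bar> \<le> \<bar>t\<bar> \<Longrightarrow> \<bar>F' u\<bar> \<le> E"
  shows "\<bar>F t - F 0\<bar> \<le> E * \<bar>t\<bar>"
proof -
  have "norm (F t - F 0) \<le> E * norm (t - 0)"
    by (rule field_differentiable_bound[of "{-\<bar>t\<bar>..\<bar>t\<bar>}" F F'])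
       (auto intro!: D[THEN has_field_derivative_at_within] E)
  then show ?thesis by simp
qed

text \<open>The function \<open>artanh\<close> enters as half the logarithm of (1+y)/(1-y), both in
  the ratios of binomial masses and in the odds of an up-move.\<close>

lemma artanh_cubic_bound:
  fixes x :: real
  assumes "\<bar>x\<bar> \<le> 1/2"
  shows "\<bar>artanh x - (x + x^3/3)\<bar> \<le> 2 * \<bar>x\<bar>^5"
proof -
  have "\<bar>(artanh x - (x + x^3/3)) - (artanh 0 - (0 + 0^3/3))\<bar> \<le> (2 * \<bar>x\<bar>^4) * \<bar>x\<bar>"
  proof (rule diff_zero_le_of_deriv_bound)
    fix u :: real assume u: "\<bar>u\<bar> \<le> \<bar>x\<bar>"
    then have u1: "\<bar>u\<bar> \<le> 1/2" using assms by simp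
    show "((\<lambda>u. artanh u - (u + u^3/3)) has_real_derivative (1/(1-u^2) - (1 + u^2))) (at u)"
      using u1 by (auto intro!: derivative_eq_intros)
    have "u^2 \<le> (1/2)^2" using u1 by (metis abs_ge_zero power2_abs power_mono)
    then have l: "1 - u^2 \<ge> 1/2" by (simp add: power2_eq_square)
    have eq: "1/(1-u^2) - (1 + u^2) = u^4/(1-u^2)"
      using l by (simp add: field_simps power2_eq_square power4_eq_xxxx)
    have "\<bar>1/(1-u^2) - (1 + u^2)\<bar> = u^4 / (1-u^2)" unfolding eq using l by simp
    also have "\<dots> \<le> u^4 / (1/2)" using l by (intro divide_left_mono) auto
    also have "\<dots> \<le> 2 * \<bar>x\<bar>^4" using u power_mono[of "\<bar>u\<bar>" "\<bar>x\<bar>" 4] by simp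
    finally show "\<bar>1/(1-u^2) - (1 + u^2)\<bar> \<le> 2 * \<bar>x\<bar>^4" .
  qed
  then show ?thesis by (simp add: power_numeral_reduce mult.assoc)
qed

lemma exp_quadratic_bound:
  fixes x :: real
  assumes "\<bar>x\<bar> \<le> 2"
  shows "\<bar>exp x - (1 + x + x^2/2)\<bar> \<le> 2 * \<bar>x\<bar>^3"
proof -
  obtain t where t: "\<bar>t\<bar> \<le> \<bar>x\<bar>" "exp x = (\<Sum>m<3. (x ^ m) / fact m) + (exp t / fact 3) * x ^ 3"
    using Maclaurin_exp_le by blast
  have "exp t \<le> exp (1 + 1)" using t(1) assms by simp
  also have "\<dots> = exp 1 * exp (1::real)" by (rule exp_add)
  also have "\<dots> \<le> 3 * 3" by (intro mult_mono exp_le) auto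
  finally have "exp t \<le> 9" by simp
  have "exp x - (1 + x + x^2/2) = (exp t / 6) * x^3"
    using t(2) by (simp add: numeral_3_eq_3 fact_numeral power2_eq_square)
  also have "\<bar>\<dots>\<bar> = (exp t / 6) * \<bar>x\<bar>^3" by (simp add: abs_mult power_abs)
  also have "\<dots> \<le> 2 * \<bar>x\<bar>^3" using \<open>exp t \<le> 9\<close> by (intro mult_right_mono) auto
  finally show ?thesis .
qed

lemma sinh_cubic_bound:
  fixes x :: real
  assumes "\<bar>x\<bar> \<le> 1"
  shows "\<bar>sinh x - (x + x^3/6)\<bar> \<le> \<bar>x\<bar>^5"
proof -
  have *: "\<exists>t. \<bar>t\<bar> \<le> 1 \<and> exp u = 1 + u + u^2/2 + u^3/6 + u^4/24 + (exp t / 120) * u ^ 5" 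
    if "\<bar>u\<bar> \<le> 1" for u :: real
  proof -
    obtain t where t: "\<bar>t\<bar> \<le> \<bar>u\<bar>" "exp u = (\<Sum>m<5. (u ^ m) / fact m) + (exp t / fact 5) * u ^ 5"
      using Maclaurin_exp_le by blast
    then show ?thesis using that by (intro exI[of _ t]) (simp add: eval_nat_numeral fact_numeral)
  qed
  obtain t where t: "\<bar>t\<bar> \<le> 1" "exp x = 1 + x + x^2/2 + x^3/6 + x^4/24 + (exp t / 120) * x ^ 5"
    using *[of x] assms by auto
  obtain v where v: "\<bar>v\<bar> \<le> 1" "exp (-x) = 1 - x + x^2/2 - x^3/6 + x^4/24 - (exp v / 120) * x ^ 5"
    using *[of "-x"] assms by auto
  have e: "exp t \<le> 3" "exp v \<le> 3" using t v exp_le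
    by (meson abs_le_D1 exp_le_cancel_iff order_trans)+
  have "sinh x - (x + x^3/6) = ((exp t + exp v)/240) * x^5"
    unfolding sinh_field_def t(2) v(2) by (simp add: field_simps)
  also have "\<bar>\<dots>\<bar> = ((exp t + exp v)/240) * \<bar>x\<bar>^5"
    by (simp add: abs_mult power_abs)
  also have "\<dots> \<le> 1 * \<bar>x\<bar>^5" using e by (intro mult_right_mono) auto
  finally show ?thesis by simp
qed

text \<open>The differences of exponentials in the risk-neutral probability are values of
  \<open>sinh\<close>. The term x^2/6 is the source of the summand m/12 in the expansion of the
  log-odds.\<close>

lemma ln_sinh_over_bound:
  fixes x :: real
  assumes "0 < x" "x \<le> 1/2"
  shows "\<bar>ln (sinh x / x) - x^2/6\<bar> \<le> 2 * x^4"
proof -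
  define w where "w = sinh x / x - 1"
  have x4: "x^4 \<le> (1/4) * x^2"
    using assms mult_mono[of x "1/2" x "1/2"] 
    by (simp add: power4_eq_xxxx power2_eq_square mult_mono mult.assoc)
  have "\<bar>sinh x - (x + x^3/6)\<bar> \<le> x^5"
    using sinh_cubic_bound[of x] assms by simp
  moreover have "w - x^2/6 = (sinh x - (x + x^3/6)) / x"
    using assms unfolding w_def by (simp add: field_simps power2_eq_square power3_eq_cube)
  ultimately have w: "\<bar>w - x^2/6\<bar> \<le> x^4"
    using assms by (simp add: abs_divide divide_le_eq power_numeral_reduce)
  have x2: "x^2 \<le> (1/2)^2" using assms by (intro power_mono) auto
  have w2: "\<bar>w\<bar> \<le> x^2/2" using w x4 x2 by (simp add: abs_if split: if_splits) 
  have "\<bar>ln (1 + w) - w\<bar> \<le> 2 * w^2"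
    by (rule abs_ln_one_plus_x_minus_x_bound) (use w2 x2 in \<open>simp add: power2_eq_square\<close>)
  also have "2 * w^2 \<le> 2 * (x^2/2)^2"
    using w2 by (metis abs_ge_zero power2_abs power_mono mult_left_mono zero_le_numeral)
  also have "\<dots> = x^4/2" by (simp add: power2_eq_square power4_eq_xxxx)
  finally have "\<bar>ln (1 + w) - w\<bar> \<le> x^4/2" .
  moreover have "1 + w = sinh x / x" by (simp add: w_def)
  ultimately show ?thesis using w assms by (simp add: abs_if split: if_splits)
qed

text \<open>The derivative of cosh x exp (-x^2/2) has the sign of sinh x - x cosh x, which is
  nonpositive for x \<ge> 0. This is the subgaussian bound for a symmetric coin.\<close>

lemma cosh_le_exp_square: "cosh x \<le> exp (x^2/2 :: real)"
proof -
  have le: "cosh x \<le> exp (x^2/2)" if "0 \<le> x" for x :: real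
  proof -
    define F where "F = (\<lambda>x::real. exp (x^2/2) - cosh x)"
    have sinh_le: "sinh u \<le> u * cosh u" if "0 \<le> u" for u :: real
    proof -
      have "0 * cosh 0 - sinh 0 \<le> u * cosh u - sinh u"
        by (rule DERIV_nonneg_imp_nondecreasing[OF that])
           (auto intro!: exI derivative_eq_intros)
      then show ?thesis by simp
    qed
    have "cosh x * exp (-(x^2)/2) \<le> cosh 0 * exp (-(0^2)/2)"
    proof (rule DERIV_nonpos_imp_nonincreasing[OF that])
      fix u :: real assume u: "0 \<le> u"
      have "((\<lambda>x. cosh x * exp (-(x^2)/2)) has_real_derivative (sinh u - u * cosh u) * exp (-(u^2)/2)) (at u)"
        by (auto intro!: derivative_eq_intros simp: algebra_simps)
      moreover have "(sinh u - u * cosh u) * exp (-(u^2)/2) \<le> 0"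
        using sinh_le[OF u] by (simp add: mult_le_0_iff)
      ultimately show "\<exists>y. ((\<lambda>x. cosh x * exp (-(x^2)/2)) has_real_derivative y) (at u) \<and> y \<le> 0" by blast
    qed
    then show ?thesis by (simp add: exp_minus field_simps)
  qed
  show ?thesis using le[of "\<bar>x\<bar>"] by simp
qed

subsection \<open>The Gaussian tail\<close>

definition gauss_tail :: "real \<Rightarrow> real" where
  "gauss_tail z = measure std_normal_distribution {z..}"

lemma space_std_normal [simp]: "space std_normal_distribution = UNIV"
  by (simp add: space_density)

lemma sets_std_normal [simp, measurable_cong]: "sets std_normal_distribution = sets borel"
  by (simp add: sets_density)

lemma prob_space_std_normal: "prob_space std_normal_distribution"
  using prob_space_normal_density[of 1 0] by simp

lemma measure_std_normal_eq_integral: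
  assumes "A \<in> sets borel"
  shows "measure std_normal_distribution A = (LINT x|lborel. indicator A x * std_normal_density x)"
proof -
  have i: "integrable lborel (\<lambda>x. indicator A x * std_normal_density x)"
    by (rule Bochner_Integration.integrable_bound[OF integrable_normal_density[of 1 0]])
       (use assms in \<open>auto simp: indicator_def\<close>)
  have "emeasure std_normal_distribution A = (\<integral>\<^sup>+x. ennreal (indicator A x * std_normal_density x) \<partial>lborel)"
    using assms by (subst emeasure_density) (auto intro!: nn_integral_cong simp: indicator_def)
  also have "\<dots> = ennreal (LINT x|lborel. indicator A x * std_normal_density x)"
    by (rule nn_integral_eq_integral[OF i]) auto
  finally show ?thesis
    by (simp add: measure_def integral_nonneg_AE)
qed

text \<open>Exponential tilting: exp (t (x - z)) is at least 1 on \<open>A\<close> and turns the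
  standard density into exp (t^2/2 - t z) times the density centred at t. The sign of t is free, so
  both tails are covered.\<close>

lemma measure_std_normal_le_exp:
  assumes "A \<in> sets borel" and "\<And>x. x \<in> A \<Longrightarrow> t * z \<le> t * x"
  shows "measure std_normal_distribution A \<le> exp (t^2/2 - t * z)"
proof -
  have "(LINT x|lborel. indicator A x * std_normal_density x) 
      \<le> (LINT x|lborel. exp (t^2/2 - t * z) * normal_density t 1 x)"
  proof (rule integral_mono_AE)
    show "integrable lborel (\<lambda>x. indicator A x * std_normal_density x)"
      by (rule Bochner_Integration.integrable_bound[OF integrable_normal_density[of 1 0]])
         (use assms in \<open>auto simp: indicator_def\<close>)
    show "integrable lborel (\<lambda>x. exp (t^2/2 - t * z) * normal_density t 1 x)"
      by simp
    show "AE x in lborel. indicator A x * std_normal_density x \<le> exp (t^2/2 - t * z) * normal_density t 1 x"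
    proof (rule AE_I2)
      fix x
      have "x \<in> A \<Longrightarrow> - (x^2)/2 \<le> (t^2/2 - t * z) + - ((x-t)^2)/2"
        using assms(2)[of x] by (simp add: power2_eq_square field_simps)
      then show "indicator A x * std_normal_density x \<le> exp (t^2/2 - t * z) * normal_density t 1 x"
        by (auto simp: normal_density_def exp_add[symmetric] indicator_def divide_right_mono)
    qed
  qed
  also have "\<dots> = exp (t^2/2 - t * z)" by simp
  finally show ?thesis by (simp add: measure_std_normal_eq_integral assms)
qed

lemma gauss_tail_le_exp: "t \<ge> 0 \<Longrightarrow> gauss_tail z \<le> exp (t^2/2 - t * z)"
  unfolding gauss_tail_def by (rule measure_std_normal_le_exp) (auto intro: mult_left_mono)

lemma one_minus_gauss_tail_le_exp: "t \<ge> 0 \<Longrightarrow> 1 - gauss_tail z \<le> exp (t^2/2 + t * z)"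
proof -
  assume t: "t \<ge> 0"
  interpret prob_space std_normal_distribution by (rule prob_space_std_normal)
  have "1 - gauss_tail z = measure std_normal_distribution {..<z}"
    unfolding gauss_tail_def by (subst prob_compl[symmetric]) (auto intro!: arg_cong[where f=prob])
  also have "\<dots> \<le> exp ((-t)^2/2 - (-t) * z)"
    by (rule measure_std_normal_le_exp) (use t in \<open>auto intro: mult_left_mono\<close>)
  finally show ?thesis by simp
qed

lemma gauss_tail_nonneg: "0 \<le> gauss_tail z"
  by (simp add: gauss_tail_def)

lemma gauss_tail_le_1: "gauss_tail z \<le> 1"
  using prob_space.prob_le_1[OF prob_space_std_normal] by (simp add: gauss_tail_def)

lemma gauss_tail_has_derivative [derivative_intros]:
  assumes "(g has_real_derivative g') (at x within X)"
  shows "((\<lambda>x. gauss_tail (g x)) has_real_derivative - std_normal_density (g x) * g') (at x within X)"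
proof -
  have "(gauss_tail has_real_derivative - std_normal_density z) (at z)" for z
  proof -
    interpret prob_space std_normal_distribution by (rule prob_space_std_normal)
    \<comment> \<open>Any base point to the left of z would do; it reduces the tail to an integral
      over a compact interval.\<close>
    define c where "c = z - 1"
    have cont: "continuous_on S std_normal_density" for S
      unfolding normal_density_def by (intro continuous_intros) auto
    have eq: "gauss_tail x = gauss_tail c - integral {c..x} std_normal_density" if "x \<ge> c" for x
    proof -
      have "gauss_tail c = prob ({c..<x} \<union> {x..})"
        unfolding gauss_tail_def using that by (auto intro!: arg_cong[where f=prob])
      also have "\<dots> = prob {c..<x} + gauss_tail x"
        unfolding gauss_tail_def by (rule finite_measure_Union) auto
      also have "prob {c..<x} = (LINT u|lborel. indicator {c..<x} u * std_normal_density u)" 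
        by (rule measure_std_normal_eq_integral) simp
      also have "\<dots> = (LINT u:{c..x}|lborel. std_normal_density u)" 
        unfolding set_lebesgue_integral_def
        by (intro integral_cong_AE)
           (auto simp: indicator_def intro!: AE_I[where N="{x}"])
      also have "\<dots> = integral {c..x} std_normal_density"
        by (rule set_borel_integral_eq_integral)
           (rule borel_integrable_atLeastAtMost', rule cont)
      finally show ?thesis by simp
    qed
    have "((\<lambda>x. integral {c..x} std_normal_density) has_real_derivative std_normal_density z) (at z within {c..z+1})"
      by (rule integral_has_real_derivative) (auto intro: cont simp: c_def)
    moreover have "at z within {c..z+1} = at z"
      by (rule at_within_Icc_at) (auto simp: c_def)
    ultimately have "((\<lambda>x. integral {c..x} std_normal_density) has_real_derivative std_normal_density z) (at z)"
      by simp
    then have "((\<lambda>x. gauss_tail c - integral {c..x} std_normal_density) has_real_derivative 0 - std_normal_density z) (at z)"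
      by (intro DERIV_diff DERIV_const)
    then have "((\<lambda>x. gauss_tail c - integral {c..x} std_normal_density) has_real_derivative - std_normal_density z) (at z)"
      by simp
    then show ?thesis
    proof (rule has_field_derivative_transform_within_open[where S="{c<..}"])
      show "gauss_tail c - integral {c..x} std_normal_density = gauss_tail x" if "x \<in> {c<..}" for x
        using eq[of x] that by simp
    qed (auto simp: c_def)
  qed
  from DERIV_chain2[OF this assms] show ?thesis .
qed

lemma std_normal_density_has_derivative:
  "(std_normal_density has_real_derivative - x * std_normal_density x) (at x)"
  unfolding std_normal_density_def by (auto intro!: derivative_eq_intros simp: field_simps)

lemma std_normal_density_le_exp: "std_normal_density x \<le> exp (t^2/2 - t * \<bar>x\<bar>)"
proof -
  have "sqrt (2*pi) \<ge> sqrt 1" using pi_ge_two by (intro real_sqrt_le_mono) auto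
  then have "1 / sqrt (2*pi) \<le> 1" by simp
  then have "std_normal_density x \<le> exp (- x\<^sup>2 / 2)" 
    unfolding std_normal_density_def by (intro mult_left_le_one_le) auto
  also have "(\<bar>x\<bar> - t)^2 \<ge> 0" by simp
  then have "exp (- x\<^sup>2 / 2) \<le> exp (t^2/2 - t * \<bar>x\<bar>)" by (simp add: power2_eq_square algebra_simps)
  finally show ?thesis .
qed

text \<open>Since (1 + |x|)^k \<le> exp (k |x|), raising the rate from t to t + k absorbs the
  polynomial. Thus all corrections decay at any prescribed exponential rate.\<close>

lemma std_normal_density_times_power_le:
  "std_normal_density x * (1 + \<bar>x\<bar>)^k \<le> exp ((t + real k)^2/2) * exp (- t * \<bar>x\<bar>)"
proof -
  have "std_normal_density x * (1 + \<bar>x\<bar>)^k \<le> exp ((t + real k)^2/2 - (t + real k) * \<bar>x\<bar>) * exp \<bar>x\<bar> ^ k"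
    by (intro mult_mono power_mono std_normal_density_le_exp exp_ge_add_one_self) auto
  also have "\<dots> = exp ((t + real k)^2/2) * exp (- t * \<bar>x\<bar>)"
    by (simp add: exp_of_nat_mult[symmetric] exp_add[symmetric] algebra_simps)
  finally show ?thesis .
qed

subsection \<open>Gaussian masses of lattice cells\<close>

text \<open>\<open>tail_poly\<close> is \<open>B\<^sub>n\<close> as a polynomial in \<open>z = - d2\<close>. It is determined by the requirement that
  \<open>(z\<^sup>2 - 1) / 6 + dens_poly \<rho> b z\<close> be, up to a constant, the coefficient of \<open>1 / n\<close> in the logarithm
  of the binomial masses; the summand \<open>(z\<^sup>2 - 1) / 6\<close> is the midpoint-rule error of a cell.\<close>

definition tail_poly :: "real \<Rightarrow> real \<Rightarrow> real \<Rightarrow> real" where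
  "tail_poly \<rho> b z = - (z^3)/12 - \<rho> * z^2/3 + (1/12 - \<rho>^2/2) * z + b"

text \<open>This is z P - P' with P = \<open>tail_poly\<close>, that is, minus the derivative of
  \<phi> P divided by the normal density \<phi>.\<close>

definition dens_poly :: "real \<Rightarrow> real \<Rightarrow> real \<Rightarrow> real" where
  "dens_poly \<rho> b z = z * tail_poly \<rho> b z - (- (z^2)/4 - 2 * \<rho> * z/3 + (1/12 - \<rho>^2/2))"

definition edge_tail :: "real \<Rightarrow> real \<Rightarrow> real \<Rightarrow> real \<Rightarrow> real" where
  "edge_tail \<rho> b e z = gauss_tail z + std_normal_density z * tail_poly \<rho> b z * e^2"

lemma tail_poly_has_derivative:
  "(tail_poly \<rho> b has_real_derivative (- (z^2)/4 - 2 * \<rho> * z/3 + (1/12 - \<rho>^2/2))) (at z)"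
  unfolding tail_poly_def [abs_def] by (auto intro!: derivative_eq_intros simp: power2_eq_square)

lemma edge_tail_has_derivative:
  "(edge_tail \<rho> b e has_real_derivative - std_normal_density z * (1 + e^2 * dens_poly \<rho> b z)) (at z)"
  unfolding edge_tail_def [abs_def]
  by (auto intro!: derivative_eq_intros std_normal_density_has_derivative tail_poly_has_derivative
      simp: dens_poly_def algebra_simps)

lemma dens_poly_has_derivative:
  "(dens_poly \<rho> b has_real_derivative
     (- (z^3)/3 - \<rho> * z^2 + 2 * (1/12 - \<rho>^2/2) * z + b + z/2 + 2 * \<rho>/3)) (at z)"
  unfolding dens_poly_def [abs_def]
  by (auto intro!: derivative_eq_intros tail_poly_has_derivative simp: tail_poly_def field_simps power_numeral_reduce)

lemma abs_mult_le_mult: "\<bar>a\<bar> \<le> A \<Longrightarrow> \<bar>b\<bar> \<le> B \<Longrightarrow> \<bar>a * b\<bar> \<le> A * (B::real)"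
  by (simp add: abs_mult mult_mono')

lemma abs_power_le_power: "\<bar>a\<bar> \<le> A \<Longrightarrow> \<bar>a ^ k\<bar> \<le> A ^ k" for a :: real
  by (simp add: power_abs power_mono)

lemma le_one_if_mult_le_one:
  assumes "0 < e" "e * L \<le> 1" "1 \<le> L" shows "e \<le> (1::real)"
proof -
  have "e * 1 \<le> e * L" using assms by (intro mult_left_mono) auto
  then show ?thesis using assms(2) by linarith
qed

context
  fixes \<rho> b M L z :: real
  assumes \<rho>: "\<bar>\<rho>\<bar> \<le> M" and b: "\<bar>b\<bar> \<le> M" and M: "1 \<le> M" and L: "1 \<le> L"
begin

text \<open>Replaces all lower monomials in M and L by one common monomial, after which the
  polynomial bounds are linear arithmetic.\<close>

private lemma monomial_le: "i \<le> 2 \<Longrightarrow> j \<le> k \<Longrightarrow> M^i * L^j \<le> M^2 * L^k"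
  using M L by (intro mult_mono power_increasing) auto

text \<open>The range 2 L leaves room for the points z + t of a cell whose centre z lies in
  [-L, L].\<close>

lemma dens_poly_bound:
  assumes "\<bar>x\<bar> \<le> 2 * L"
  shows "\<bar>dens_poly \<rho> b x\<bar> \<le> 12 * (M^2 * L^4)"
proof -
  define K where "K = M^2 * L^4"
  have K: "L^4 \<le> K" "M * L^3 \<le> K" "L^2 \<le> K" "M^2 * L^2 \<le> K" "M * L \<le> K" "M^2 \<le> K" "1 \<le> K"
    using monomial_le[of 0 4 4] monomial_le[of 1 3 4] monomial_le[of 0 2 4] monomial_le[of 2 2 4]
      monomial_le[of 1 1 4] monomial_le[of 2 0 4] monomial_le[of 0 0 4] by (simp_all add: K_def)
  have "\<bar>x^4\<bar> \<le> (2*L)^4" "\<bar>\<rho> * x^3\<bar> \<le> M * (2*L)^3" "\<bar>x^2\<bar> \<le> (2*L)^2" "\<bar>\<rho>^2 * x^2\<bar> \<le> M^2 * (2*L)^2"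
    "\<bar>b * x\<bar> \<le> M * (2*L)" "\<bar>\<rho> * x\<bar> \<le> M * (2*L)" "\<bar>\<rho>^2\<bar> \<le> M^2"
    by (intro abs_mult_le_mult abs_power_le_power \<rho> b assms)+
  moreover have "(2*L)^4 = 16 * L^4" "M * (2*L)^3 = 8 * (M * L^3)" "(2*L)^2 = 4 * L^2"
     "M^2 * (2*L)^2 = 4 * (M^2 * L^2)" "M * (2*L) = 2 * (M * L)"
    by (simp_all add: power_mult_distrib)
  moreover have "dens_poly \<rho> b x = - (x^4)/12 - (\<rho> * x^3)/3 + x^2/12 - (\<rho>^2 * x^2) / 2 + b * x
      + x^2/4 + 2 * (\<rho> * x)/3 - 1/12 + \<rho>^2/2"
    by (simp add: dens_poly_def tail_poly_def algebra_simps power_numeral_reduce)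
  ultimately have "\<bar>dens_poly \<rho> b x\<bar> \<le> 12 * K" using K by linarith
  then show ?thesis by (simp add: K_def)
qed

lemma dens_poly_diff_bound:
  assumes "\<bar>x\<bar> \<le> L" "\<bar>t\<bar> \<le> e" "e \<le> 1"
  shows "\<bar>dens_poly \<rho> b (x + t) - dens_poly \<rho> b x\<bar> \<le> 12 * (M^2 * L^3) * e"
proof -
  have "\<bar>dens_poly \<rho> b (x + t) - dens_poly \<rho> b (x + 0)\<bar> \<le> 12 * (M^2 * L^3) * \<bar>t\<bar>"
  proof (rule diff_zero_le_of_deriv_bound)
    fix u :: real assume u: "\<bar>u\<bar> \<le> \<bar>t\<bar>"
    define y where "y = x + u"
    have y: "\<bar>y\<bar> \<le> 2 * L" using u assms L by (simp add: y_def)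
    show "((\<lambda>u. dens_poly \<rho> b (x + u)) has_real_derivative 
      (- (y^3)/3 - \<rho> * y^2 + 2 * (1/12 - \<rho>^2/2) * y + b + y/2 + 2 * \<rho>/3)) (at u)"
      using dens_poly_has_derivative[of \<rho> b y] unfolding y_def by (simp add: DERIV_shift add.commute)
    define K where "K = M^2 * L^3"
    have K: "L^3 \<le> K" "M * L^2 \<le> K" "M^2 * L \<le> K" "M \<le> K" "L \<le> K"
      using monomial_le[of 0 3 3] monomial_le[of 1 2 3] monomial_le[of 2 1 3] 
        monomial_le[of 1 0 3] monomial_le[of 0 1 3] by (simp_all add: K_def)
    have "\<bar>y^3\<bar> \<le> (2*L)^3" "\<bar>\<rho> * y^2\<bar> \<le> M * (2*L)^2" "\<bar>\<rho>^2 * y\<bar> \<le> M^2 * (2*L)"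
      by (intro abs_mult_le_mult abs_power_le_power \<rho> b y)+
    moreover have "(2*L)^3 = 8 * L^3" "M * (2*L)^2 = 4 * (M * L^2)" "M^2 * (2*L) = 2 * (M^2 * L)"
      by (simp_all add: power_mult_distrib)
    moreover have "- (y^3)/3 - \<rho> * y^2 + 2 * (1/12 - \<rho>^2/2) * y + b + y/2 + 2 * \<rho>/3
       = - (y^3)/3 - \<rho> * y^2 + y/6 - \<rho>^2 * y + b + y/2 + 2 * \<rho>/3"
      by (simp add: algebra_simps)
    ultimately have "\<bar>- (y^3)/3 - \<rho> * y^2 + 2 * (1/12 - \<rho>^2/2) * y + b + y/2 + 2 * \<rho>/3\<bar> \<le> 12 * K"
      using K \<rho> b y by linarith
    then show "\<bar>- (y^3)/3 - \<rho> * y^2 + 2 * (1/12 - \<rho>^2/2) * y + b + y/2 + 2 * \<rho>/3\<bar> \<le> 12 * (M^2 * L^3)"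
      by (simp add: K_def)
  qed
  also have "\<dots> \<le> 12 * (M^2 * L^3) * e" using assms L by (intro mult_left_mono) auto
  finally show ?thesis by simp
qed

text \<open>The exponential is the ratio of the normal densities at z + t and z. The condition e L
  \<le> 1 keeps the exponent below 3/2 in absolute value, so one Taylor estimate at 0 serves the
  whole window.\<close>

lemma gauss_density_ratio_bound:
  assumes "\<bar>z\<bar> \<le> L" "\<bar>t\<bar> \<le> e" "0 < e" "e * L \<le> 1"
  shows "\<bar>exp (- z * t - t^2/2) - (1 - z * t + (z^2 - 1) * t^2/2)\<bar> \<le> 8 * (e^3 * L^3)"
    and "\<bar>exp (- z * t - t^2/2) - 1\<bar> \<le> 11 * (e * L)"
proof -
  define u where "u = - z * t - t^2/2"
  have e1: "e \<le> 1" using assms(3,4) L by (rule le_one_if_mult_le_one)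
  have zt: "\<bar>z * t\<bar> \<le> L * e" using assms by (intro abs_mult_le_mult)
  have t2: "\<bar>t^2\<bar> \<le> e^2" using assms by (intro abs_power_le_power)
  have e2: "e^2 \<le> L * e" using e1 L assms(3) by (simp add: power2_eq_square)
  have uB: "\<bar>u\<bar> \<le> 3/2 * (L * e)" 
  proof -
    have "u = - (z * t) - t^2/2" by (simp add: u_def)
    moreover have "0 \<le> t^2" by simp
    ultimately show ?thesis using zt t2 e2 by linarith
  qed
  have u2: "\<bar>u\<bar> \<le> 3/2" using uB assms by (simp add: mult.commute)
  have "\<bar>exp u - (1 + u + u^2/2)\<bar> \<le> 2 * \<bar>u\<bar>^3"
    by (rule exp_quadratic_bound) (use u2 in simp)
  also have "\<dots> \<le> 2 * (3/2 * (L * e))^3" using uB by (intro mult_left_mono power_mono) auto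
  finally have *: "\<bar>exp u - (1 + u + u^2/2)\<bar> \<le> 27/4 * (e^3 * L^3)" by (simp add: power_mult_distrib power_divide mult_ac)
  have "1 + u + u^2/2 - (1 - z * t + (z^2 - 1) * t^2/2) = z * t^3/2 + t^4/8"
    unfolding u_def by (simp add: field_simps power_numeral_reduce)
  also have "\<bar>\<dots>\<bar> \<le> \<bar>z * t^3\<bar>/2 + \<bar>t^4\<bar>/8" by linarith
  also have "\<dots> \<le> (L * e^3)/2 + e^4/8"
    using assms by (intro add_mono divide_right_mono abs_mult_le_mult abs_power_le_power) auto
  also have "\<dots> \<le> (L^3 * e^3)/2 + (L^3 * e^3)/8"
  proof (intro add_mono divide_right_mono mult_right_mono)
    show "L \<le> L^3" using L power_increasing[of 1 3 L] by simp
    have "e^4 \<le> e^3 * 1" using e1 assms(3) power_decreasing[of 3 4 e] by simp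
    also have "\<dots> \<le> e^3 * L^3" using L assms by (intro mult_left_mono) auto
    finally show "e^4 \<le> L^3 * e^3" by (simp add: mult.commute)
  qed (use assms in auto)
  finally show "\<bar>exp (- z * t - t^2/2) - (1 - z * t + (z^2 - 1) * t^2/2)\<bar> \<le> 8 * (e^3 * L^3)"
    using * unfolding u_def by (simp add: mult_ac abs_if split: if_splits)
  have "\<bar>u\<bar>^2 \<le> (3/2) * \<bar>u\<bar>" unfolding power2_eq_square using u2 by (intro mult_right_mono) auto
  moreover have "\<bar>u\<bar>^3 \<le> (9/4) * \<bar>u\<bar>"
  proof -
    have "\<bar>u\<bar>^3 = \<bar>u\<bar>^2 * \<bar>u\<bar>" by (simp add: power_numeral_reduce)
    also have "\<dots> \<le> (3/2)^2 * \<bar>u\<bar>" using u2 by (intro mult_right_mono power_mono) auto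
    finally show ?thesis by (simp add: power2_eq_square)
  qed
  moreover have "\<bar>exp u - (1 + u + u^2/2)\<bar> \<le> 2 * \<bar>u\<bar>^3"
    by (rule exp_quadratic_bound) (use u2 in simp)
  moreover have "\<bar>u\<bar>^2 = u^2" "0 \<le> u^2" by simp_all
  ultimately have "\<bar>exp u - 1\<bar> \<le> 7 * \<bar>u\<bar>" by linarith
  also have "\<dots> \<le> 11 * (e * L)" using uB assms L by (simp add: mult.commute)
  finally show "\<bar>exp (- z * t - t^2/2) - 1\<bar> \<le> 11 * (e * L)" by (simp add: u_def)
qed

text \<open>The quotient is the average over |t| \<le> e of the density ratio times 1 + e^2
  \<open>dens_poly\<close>. The term - z t cancels by symmetry and (z^2 - 1) t^2/2 averages to (z^2
  - 1) e^2/6.\<close>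

lemma cell_mass_bound:
  assumes z: "\<bar>z\<bar> \<le> L" and e: "0 < e" "e * L \<le> 1"
  shows "\<bar>(edge_tail \<rho> b e (z - e) - edge_tail \<rho> b e (z + e)) / (2 * e * std_normal_density z)
     - (1 + e^2 * ((z^2 - 1)/6 + dens_poly \<rho> b z))\<bar> \<le> 160 * (M^2 * L^5 * e^3)"
proof -
  define k where "k = (\<lambda>t. exp (- z * t - t^2/2) * (1 + e^2 * dens_poly \<rho> b (z + t)))"
  define k0 where "k0 = (\<lambda>t. (1 - z * t + (z^2 - 1) * t^2/2) + e^2 * dens_poly \<rho> b z)"
  \<comment> \<open>The derivative of F is the exact integrand minus the approximate one, so a bound
    on F' replaces integration. The even term z t^2/2 drops out of F e - F (-e).\<close>
  define F where "F = (\<lambda>t. (edge_tail \<rho> b e z - edge_tail \<rho> b e (z + t)) / std_normal_density z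
     - (t - z * t^2/2 + (z^2-1) * t^3/6 + e^2 * dens_poly \<rho> b z * t))"
  have e1: "e \<le> 1" using e L by (rule le_one_if_mult_le_one)
  have pos: "std_normal_density z > 0" by (rule normal_density_pos) simp
  have bound: "\<bar>F t - F 0\<bar> \<le> 160 * (M^2 * L^5 * e^3) * \<bar>t\<bar>" if "\<bar>t\<bar> \<le> e" for t
  proof (rule diff_zero_le_of_deriv_bound)
    fix u :: real assume "\<bar>u\<bar> \<le> \<bar>t\<bar>"
    then have u: "\<bar>u\<bar> \<le> e" using that by simp
    have ratio: "std_normal_density (z + u) = std_normal_density z * exp (- z * u - u^2/2)"
      unfolding std_normal_density_def by (simp add: exp_add[symmetric] field_simps power2_eq_square)
    have "((\<lambda>t. edge_tail \<rho> b e (z + t)) has_real_derivative 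
        - std_normal_density (z+u) * (1 + e^2 * dens_poly \<rho> b (z+u))) (at u)"
      using edge_tail_has_derivative[of \<rho> b e "z + u"] by (simp add: DERIV_shift add.commute)
    from DERIV_cdivide[OF DERIV_diff[OF DERIV_const[of "edge_tail \<rho> b e z"] this], of "std_normal_density z"]
    have "((\<lambda>t. (edge_tail \<rho> b e z - edge_tail \<rho> b e (z + t)) / std_normal_density z)
        has_real_derivative k u) (at u)"
      by (rule DERIV_cong) (use pos in \<open>simp add: ratio k_def\<close>)
    moreover have "((\<lambda>t. t - z * t^2/2 + (z^2-1) * t^3/6 + e^2 * dens_poly \<rho> b z * t)
        has_real_derivative k0 u) (at u)"
      unfolding k0_def by (auto intro!: derivative_eq_intros simp: power2_eq_square)
    ultimately show "(F has_real_derivative (k u - k0 u)) (at u)"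
      unfolding F_def by (rule DERIV_diff)
    have "k u - k0 u = (exp (- z * u - u^2/2) - (1 - z * u + (z^2 - 1) * u^2/2))
       + e^2 * ((exp (- z * u - u^2/2) - 1) * dens_poly \<rho> b (z + u))
       + e^2 * (dens_poly \<rho> b (z + u) - dens_poly \<rho> b z)"
      unfolding k_def k0_def by (simp add: algebra_simps)
    also have "\<bar>\<dots>\<bar> \<le> 8 * (e^3 * L^3) + e^2 * (11 * (e * L) * (12 * (M^2 * L^4))) + e^2 * (12 * (M^2 * L^3) * e)"
      using z e e1 u L
      by (intro order_trans[OF abs_triangle_ineq] add_mono abs_mult_le_mult 
            gauss_density_ratio_bound dens_poly_bound dens_poly_diff_bound) auto
    also have "\<dots> = 8 * (e^3 * (M^0 * L^3)) + 132 * (e^3 * (M^2 * L^5)) + 12 * (e^3 * (M^2 * L^3))"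
      by (simp add: power_numeral_reduce algebra_simps)
    also have "\<dots> \<le> 8 * (e^3 * (M^2 * L^5)) + 132 * (e^3 * (M^2 * L^5)) + 12 * (e^3 * (M^2 * L^5))"
      using e by (intro add_mono mult_left_mono monomial_le) auto
    also have "\<dots> \<le> 160 * (M^2 * L^5 * e^3)" using e L M by (simp add: mult_ac)
    finally show "\<bar>k u - k0 u\<bar> \<le> 160 * (M^2 * L^5 * e^3)" .
  qed
  have "(edge_tail \<rho> b e (z - e) - edge_tail \<rho> b e (z + e)) / (2 * e * std_normal_density z)
     - (1 + e^2 * ((z^2 - 1)/6 + dens_poly \<rho> b z)) = ((F e - F 0) - (F (-e) - F 0)) / (2 * e)"
    unfolding F_def using e pos by (simp add: field_simps power_numeral_reduce)
  also have "\<bar>\<dots>\<bar> = \<bar>(F e - F 0) - (F (-e) - F 0)\<bar> / (2 * e)"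
    unfolding abs_divide using e by simp
  also have "\<dots> \<le> (2 * (160 * (M^2 * L^5 * e^3)) * e) / (2 * e)"
  proof (rule divide_right_mono)
    have "\<bar>F e - F 0\<bar> \<le> 160 * (M^2 * L^5 * e^3) * e" "\<bar>F (-e) - F 0\<bar> \<le> 160 * (M^2 * L^5 * e^3) * e"
      using bound[of e] bound[of "-e"] e by simp_all
    then show "\<bar>(F e - F 0) - (F (-e) - F 0)\<bar> \<le> 2 * (160 * (M^2 * L^5 * e^3)) * e" by linarith
  qed (use e in simp)
  also have "\<dots> = 160 * (M^2 * L^5 * e^3)" using e by simp
  finally show ?thesis .
qed

text \<open>The condition with 400 makes the relative correction W at most (173/400) e as well as of
  order e^2, so that the W^2 lost in the logarithm is again of order e^3. The constant is 310 = 160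
  + 150.\<close>

lemma ln_cell_mass_bound:
  assumes z: "\<bar>z\<bar> \<le> L" and e: "0 < e" "400 * (M^2 * L^5 * e) \<le> 1"
  defines "\<beta> \<equiv> edge_tail \<rho> b e (z - e) - edge_tail \<rho> b e (z + e)"
  shows "\<beta> > 0"
    and "\<bar>ln \<beta> - (ln (2 * e / sqrt (2 * pi)) - (z^2)/2 + e^2 * ((z^2 - 1)/6 + dens_poly \<rho> b z))\<bar>
            \<le> 310 * (M^2 * L^5 * e^3)"
proof -
  have "e * L \<le> e * (M^2 * L^5)" using monomial_le[of 0 1 5] e by (intro mult_left_mono) auto
  also have "\<dots> \<le> 1" using e M L by (simp add: mult_ac)
  finally have eL': "e * L \<le> 1" .
  note eL = eL' le_one_if_mult_le_one[OF e(1) eL' L]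
  define P where "P = (z^2 - 1)/6 + dens_poly \<rho> b z"
  define W where "W = \<beta> / (2 * e * std_normal_density z) - 1"
  have pos: "std_normal_density z > 0" by (rule normal_density_pos) simp
  have "0 \<le> z^2" "z^2 \<le> L^2" "1 \<le> L^2" using abs_power_le_power[OF z, of 2] L by simp_all
  moreover have "L^2 \<le> M^2 * L^4" using monomial_le[of 0 2 4] by simp
  moreover have "\<bar>dens_poly \<rho> b z\<bar> \<le> 12 * (M^2 * L^4)" using z L by (intro dens_poly_bound) auto
  moreover define K where "K = M^2 * L^4"
  moreover have "6 * P = (z^2 - 1) + 6 * dens_poly \<rho> b z" by (simp add: P_def)
  ultimately have "\<bar>P\<bar> \<le> 13 * K" by linarith
  also have "\<dots> = 13 * (M^2 * L^4)" by (simp add: K_def)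
  also have "\<dots> \<le> 13 * (M^2 * L^5)" by (intro mult_left_mono monomial_le) auto
  finally have "\<bar>e^2 * P\<bar> \<le> e^2 * (13 * (M^2 * L^5))" by (simp add: abs_mult mult_left_mono)
  moreover have WP: "\<bar>W - e^2 * P\<bar> \<le> 160 * (M^2 * L^5 * e^3)"
    using cell_mass_bound[OF z e(1) eL(1)] by (simp add: W_def P_def \<beta>_def algebra_simps)
  moreover have "M^2 * L^5 * e^3 \<le> M^2 * L^5 * e^2" 
    using e eL L M power_decreasing[of 2 3 e] by (intro mult_left_mono) auto
  ultimately have W: "\<bar>W\<bar> \<le> 173 * (M^2 * L^5 * e^2)" by (simp add: mult_ac abs_if split: if_splits)
  also have "\<dots> = (173/400 * e) * (400 * (M^2 * L^5 * e))" by (simp add: power2_eq_square)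
  also have "\<dots> \<le> (173/400 * e) * 1" using e by (intro mult_left_mono) auto
  finally have W1: "\<bar>W\<bar> \<le> 173/400 * e" by simp
  then have Whalf: "\<bar>W\<bar> \<le> 1/2" using eL by simp
  have "\<bar>ln (1 + W) - W\<bar> \<le> 2 * W^2" by (rule abs_ln_one_plus_x_minus_x_bound) (rule Whalf)
  also have "2 * W^2 = 2 * (\<bar>W\<bar> * \<bar>W\<bar>)" by (simp add: power2_eq_square)
  also have "\<dots> \<le> 2 * (173 * (M^2 * L^5 * e^2) * (173/400 * e))"
    using W W1 by (intro mult_left_mono mult_mono) auto
  also have "\<dots> \<le> 150 * (M^2 * L^5 * e^3)"
    using e M L by (simp add: power_numeral_reduce)
  finally have *: "\<bar>ln (1 + W) - W\<bar> \<le> 150 * (M^2 * L^5 * e^3)" .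
  have \<beta>: "\<beta> = 2 * e * std_normal_density z * (1 + W)" using e pos by (simp add: W_def)
  then show "\<beta> > 0" using e pos Whalf by simp
  have "ln \<beta> = ln (2 * e * std_normal_density z) + ln (1 + W)"
    unfolding \<beta> using e pos Whalf by (subst ln_mult) auto
  also have "2 * e * std_normal_density z = (2 * e / sqrt (2 * pi)) * exp (- (z^2)/2)"
    by (simp add: std_normal_density_def)
  also have "ln \<dots> = ln (2 * e / sqrt (2 * pi)) - (z^2)/2"
    using e by (subst ln_mult) auto
  finally show "\<bar>ln \<beta> - (ln (2 * e / sqrt (2 * pi)) - (z^2)/2 + e^2 * ((z^2 - 1)/6 + dens_poly \<rho> b z))\<bar>
            \<le> 310 * (M^2 * L^5 * e^3)"
    using * WP unfolding P_def[symmetric] by (simp add: abs_if split: if_splits)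
qed

end

subsection \<open>Binomial masses\<close>

definition binom_mass :: "nat \<Rightarrow> real \<Rightarrow> nat \<Rightarrow> real" where
  "binom_mass n p j = real (n choose j) * p^j * (1 - p)^(n - j)"

definition std_node :: "nat \<Rightarrow> real \<Rightarrow> real \<Rightarrow> real" where
  "std_node n \<rho> x = (2 * x - real n) / sqrt (real n) - \<rho>"

lemma sum_binom_mass: "(\<Sum>j=0..n. binom_mass n p j) = 1"
  using binomial_ring[of p "1 - p" n] by (simp add: binom_mass_def atLeast0AtMost)

lemma binom_mass_nonneg: "0 \<le> p \<Longrightarrow> p \<le> 1 \<Longrightarrow> 0 \<le> binom_mass n p j"
  by (simp add: binom_mass_def)

lemma binom_mass_pos: "0 < p \<Longrightarrow> p < 1 \<Longrightarrow> j \<le> n \<Longrightarrow> 0 < binom_mass n p j"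
  by (simp add: binom_mass_def)

lemma binom_mass_Suc:
  assumes "j < n" "p < 1"
  shows "binom_mass n p (Suc j) * real (Suc j) * (1 - p) = binom_mass n p j * real (n - j) * p"
proof -
  have "Suc j * (n choose Suc j) = (n - j) * (n choose j)"
    using binomial_absorb_comp[of n j] binomial_absorption[of j "n-1"] assms
    by (metis Suc_diff_1 binomial_absorption gr_implies_not0 mult.commute not_gr0)
  then have *: "real (Suc j) * real (n choose Suc j) = real (n - j) * real (n choose j)"
    by (metis of_nat_mult)
  have "n - j = Suc (n - Suc j)" using assms by simp
  then have pow: "(1 - p)^(n - j) = (1-p) * (1 - p)^(n - Suc j)" by simp
  have "binom_mass n p (Suc j) * real (Suc j) * (1 - p) 
      = (real (Suc j) * real (n choose Suc j)) * p^Suc j * ((1-p) * (1 - p)^(n - Suc j))"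
    by (simp add: binom_mass_def mult_ac)
  also have "\<dots> = binom_mass n p j * real (n - j) * p"
    unfolding * pow[symmetric] by (simp add: binom_mass_def mult_ac)
  finally show ?thesis .
qed

text \<open>With half log-odds r one has p = exp r / (2 cosh r): the biased coin is a tilted
  symmetric coin, so its moment generating function is the symmetric one, shifted by r and
  normalised.\<close>

lemma cosh_tilt:
  fixes p r x :: real
  assumes "0 < p" "p < 1" "p / (1 - p) = exp (2 * r)"
  shows "p * exp x + (1 - p) * exp (- x) = cosh (x + r) / cosh r"
proof -
  have p: "p = exp (2 * r) * (1 - p)" using assms by (simp add: field_simps)
  have "exp (2*r) = exp r * exp r" by (simp add: exp_add[symmetric])
  moreover have "exp r * exp (-r) = 1" by (simp add: exp_minus)
  \<comment> \<open>Both sides equal 1 / (2 cosh r); this allows the two mixed terms of the product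
    below to be exchanged.\<close>
  ultimately have q: "p * exp (-r) = (1 - p) * exp r" 
    using p by (metis (no_types, lifting) mult.assoc mult.commute mult.right_neutral)
  have c: "cosh r * 2 = exp r + exp (- r)" by (simp add: cosh_field_def)
  have E: "exp (x + r) = exp x * exp r" "exp (- (x + r)) = exp (- x) * exp (- r)"
    by (simp_all only: minus_add_distrib exp_add)
  have alg1: "(p * a + (1 - p) * c) * (b + d) = p * (a * b) + (p * d) * a + ((1 - p) * b) * c + (1 - p) * (c * d)"
    and alg2: "p * (a * b) + ((1 - p) * b) * a + (p * d) * c + (1 - p) * (c * d) = a * b + c * d"
    for a b c d :: real by (simp_all add: algebra_simps)
  have "(p * exp x + (1 - p) * exp (- x)) * (exp r + exp (-r)) 
     = p * exp (x + r) + (p * exp (-r)) * exp x + ((1 - p) * exp r) * exp (-x) + (1 - p) * exp (- (x + r))"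
    unfolding E by (rule alg1)
  also have "\<dots> = p * exp (x + r) + ((1 - p) * exp r) * exp x + (p * exp (- r)) * exp (-x) + (1 - p) * exp (- (x + r))"
    by (simp add: q)
  also have "\<dots> = exp (x + r) + exp (- (x + r))"
    unfolding E by (rule alg2)
  also have "\<dots> = cosh (x + r) * 2" by (simp add: cosh_field_def)
  finally have "((p * exp x + (1 - p) * exp (- x)) * cosh r) * 2 = cosh (x + r) * 2"
    unfolding c[symmetric] by (simp only: mult.assoc)
  then have "(p * exp x + (1 - p) * exp (- x)) * cosh r = cosh (x + r)" by simp
  then show ?thesis by (simp add: eq_divide_eq)
qed

text \<open>The normalising cosh is at least 1 and is dropped. In the subgaussian bound the n-th
  power cancels the 1/n of the squared argument, so the result is free of n.\<close>

lemma binom_mgf_le: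
  assumes "0 < p" "p < 1" "n > 0" "p / (1 - p) = exp (2 * (\<rho> / sqrt n))"
  shows "(\<Sum>j=0..n. binom_mass n p j * exp (t * (2 * real j - real n) / sqrt n)) \<le> exp ((t + \<rho>)^2/2)"
proof -
  define x where "x = t / sqrt n"
  have "(\<Sum>j=0..n. binom_mass n p j * exp (t * (2 * real j - real n) / sqrt n)) 
     = (\<Sum>j\<le>n. real (n choose j) * (p * exp x)^j * ((1 - p) * exp (- x))^(n - j))"
    unfolding atLeast0AtMost
  proof (rule sum.cong)
    fix j assume "j \<in> {..n}"
    then have "t * (2 * real j - real n) / sqrt n = real j * x + real (n - j) * (- x)"
      by (simp add: x_def of_nat_diff algebra_simps diff_divide_distrib add_divide_distrib)
    then have "exp (t * (2 * real j - real n) / sqrt n) = exp x ^ j * exp (- x) ^ (n - j)"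
      by (simp only: exp_add exp_of_nat_mult)
    then show "binom_mass n p j * exp (t * (2 * real j - real n) / sqrt n) =
         real (n choose j) * (p * exp x)^j * ((1 - p) * exp (- x))^(n - j)"
      by (simp only: binom_mass_def power_mult_distrib mult_ac)
  qed simp
  also have "\<dots> = (p * exp x + (1 - p) * exp (- x))^n"
    by (rule binomial_ring[symmetric])
  also have "\<dots> = (cosh (x + \<rho> / sqrt n) / cosh (\<rho> / sqrt n))^n"
    using cosh_tilt[OF assms(1,2,4)] by simp
  also have "\<dots> \<le> (cosh (x + \<rho> / sqrt n))^n"
  proof (intro power_mono)
    have "cosh (x + \<rho> / sqrt n) / cosh (\<rho> / sqrt n) \<le> cosh (x + \<rho> / sqrt n) / 1"
      using cosh_real_ge_1[of "\<rho> / sqrt n"] by (intro divide_left_mono) auto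
    then show "cosh (x + \<rho> / sqrt n) / cosh (\<rho> / sqrt n) \<le> cosh (x + \<rho> / sqrt n)" by simp
  qed auto
  also have "\<dots> \<le> exp ((x + \<rho> / sqrt n)^2/2)^n"
    by (intro power_mono cosh_le_exp_square) auto
  also have "\<dots> = exp (real n * ((x + \<rho> / sqrt n)^2/2))" by (rule exp_of_nat_mult[symmetric])
  also have "x + \<rho> / sqrt n = (t + \<rho>) / sqrt n" by (simp add: x_def add_divide_distrib)
  also have "real n * (((t + \<rho>) / sqrt n)^2/2) = (t + \<rho>)^2/2"
    using assms by (simp add: power_divide)
  finally show ?thesis .
qed

text \<open>Markov's inequality with an exponential weight; a negative t yields the lower
  tail.\<close>

lemma binom_mass_sum_le_exp:
  assumes "0 < p" "p < 1" "n > 0" "p / (1 - p) = exp (2 * (\<rho> / sqrt n))"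
    and A: "A \<subseteq> {0..n}" "\<And>j. j \<in> A \<Longrightarrow> t * x \<le> t * ((2 * real j - real n) / sqrt n)"
  shows "(\<Sum>j\<in>A. binom_mass n p j) \<le> exp ((t + \<rho>)^2/2 - t * x)"
proof -
  have "(\<Sum>j\<in>A. binom_mass n p j) \<le> (\<Sum>j\<in>A. exp (- t * x) * (binom_mass n p j * exp (t * (2 * real j - real n) / sqrt n)))"
  proof (rule sum_mono)
    fix j assume "j \<in> A"
    then have "1 \<le> exp (- t * x + t * (2 * real j - real n) / sqrt n)" using A(2)[of j] by simp
    then have "binom_mass n p j * 1 \<le> binom_mass n p j * exp (- t * x + t * (2 * real j - real n) / sqrt n)"
      using assms by (intro mult_left_mono binom_mass_nonneg) auto
    then show "binom_mass n p j \<le> exp (- t * x) * (binom_mass n p j * exp (t * (2 * real j - real n) / sqrt n))"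
      by (simp only: exp_add mult_ac mult_1_right)
  qed
  also have "\<dots> \<le> (\<Sum>j=0..n. exp (- t * x) * (binom_mass n p j * exp (t * (2 * real j - real n) / sqrt n)))"
    using assms A by (intro sum_mono2) (auto intro!: mult_nonneg_nonneg binom_mass_nonneg)
  also have "\<dots> \<le> exp (- t * x) * exp ((t + \<rho>)^2/2)"
    unfolding sum_distrib_left[symmetric] using binom_mgf_le[OF assms(1-4)] by (intro mult_left_mono) auto
  also have "\<dots> = exp ((t + \<rho>)^2/2 - t * x)" by (simp add: exp_add[symmetric])
  finally show ?thesis .
qed

section \<open>The logarithmic profile shared by binomial masses and cell masses\<close>

definition log_profile :: "real \<Rightarrow> real \<Rightarrow> real \<Rightarrow> real \<Rightarrow> real" where
  "log_profile \<rho> b e z = - (z^2)/2 + e^2 * ((z^2 - 1)/6 + dens_poly \<rho> b z)"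

text \<open>An exact identity, because the profile is a polynomial of degree four. Here v is the
  midpoint of the two nodes with the centring undone. The term v e^5/3 stems from the cubic and
  quartic terms of \<open>dens_poly\<close> and is kept to preserve equality.\<close>

lemma log_profile_step:
  fixes \<rho> b e z :: real
  defines "v \<equiv> z + e + \<rho>"
  shows "log_profile \<rho> b e (z + 2 * e) - log_profile \<rho> b e z
    = 2 * e * (\<rho> + (b - \<rho>/3 + \<rho>^3/3) * e^2) - 2 * (v * e - v * e^3 + v^3 * e^3 / 3 + v * e^5 / 3)"
  unfolding log_profile_def dens_poly_def tail_poly_def v_def
  by (simp add: field_simps power_numeral_reduce)

text \<open>The polynomial is the one produced by \<open>log_profile_step\<close>. The factor 1/(1 +
  e^2) yields - v e^3, the cube in the series yields v^3 e^3/3, and v e^5/3 is already within the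
  error.\<close>

lemma artanh_step_bound:
  fixes v e V :: real
  assumes "\<bar>v\<bar> \<le> V" "1 \<le> V" "0 < e" "V * e \<le> 1/2"
  shows "\<bar>artanh (v * e / (1 + e^2)) - (v * e - v * e^3 + v^3 * e^3 / 3 + v * e^5 / 3)\<bar> \<le> 5 * (V^5 * e^5)"
proof -
  define c where "c = 1 + e^2"
  define y where "y = v * e / c"
  have c: "c \<ge> 1" by (simp add: c_def)
  have ve: "\<bar>v * e\<bar> \<le> V * e" using assms by (intro abs_mult_le_mult) auto
  have y: "\<bar>y\<bar> \<le> V * e"
  proof -
    have "\<bar>y\<bar> = \<bar>v * e\<bar> / c" using c by (simp add: y_def)
    also have "\<dots> \<le> \<bar>v * e\<bar> / 1" using c by (intro divide_left_mono) auto
    finally show ?thesis using ve by simp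
  qed
  have "\<bar>artanh y - (y + y^3/3)\<bar> \<le> 2 * \<bar>y\<bar>^5"
    using y assms by (intro artanh_cubic_bound) auto
  also have "\<dots> \<le> 2 * (V * e)^5" using y by (intro mult_left_mono power_mono) auto
  finally have 1: "\<bar>artanh y - (y + y^3/3)\<bar> \<le> 2 * (V^5 * e^5)" by (simp add: power_mult_distrib)
  have Vk: "V * e^5 \<le> V^5 * e^5" "V^3 * e^5 \<le> V^5 * e^5"
    using assms power_increasing[of 1 5 V] power_increasing[of 3 5 V] by (auto intro!: mult_right_mono)
  have "y - (v * e - v * e^3) = v * e^5 * (1 / c)"
    using c unfolding y_def by (simp add: field_simps) (simp add: c_def algebra_simps power_numeral_reduce)
  also have "\<bar>\<dots>\<bar> \<le> (V * e^5) * 1"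
    using assms c by (intro abs_mult_le_mult) (auto simp: divide_le_eq)
  finally have 2: "\<bar>y - (v * e - v * e^3)\<bar> \<le> V^5 * e^5" using Vk by simp
  have "y^3 - v^3 * e^3 = (v^3 * e^5) * ((1/c^3 - 1) / e^2)"
    using assms c unfolding y_def by (simp add: field_simps power_numeral_reduce)
  also have "\<bar>\<dots>\<bar> \<le> (V^3 * e^5) * 3"
  proof (intro abs_mult_le_mult)
    have "1 - 1/c^3 = (1 - 1/c) * (1 + 1/c + 1/c^2)" using c by (simp add: field_simps power_numeral_reduce)
    also have "\<dots> \<le> (1 - 1/c) * (1 + 1 + 1)"
      using c by (intro mult_left_mono add_mono) (auto simp: divide_le_eq one_le_power)
    also have "1 - 1/c = (c - 1) / c" using c by (simp add: field_simps)
    also have "c - 1 = e^2" by (simp add: c_def)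
    also have "e^2 / c \<le> e^2 / 1" using c by (intro divide_left_mono) auto
    finally have "1 - 1/c^3 \<le> 3 * e^2" by simp
    moreover have "1/c^3 \<le> 1" using c by (simp add: divide_le_eq one_le_power)
    ultimately show "\<bar>(1/c^3 - 1) / e^2\<bar> \<le> 3" using assms by (simp add: abs_divide divide_le_eq)
    show "\<bar>v^3\<bar> \<le> V^3" using assms by (intro abs_power_le_power)
  qed (use assms in auto)
  finally have 3: "\<bar>y^3 - v^3 * e^3\<bar> \<le> 3 * (V^5 * e^5)" using Vk by simp
  have "\<bar>v * e^5\<bar> \<le> V * e^5" using assms by (intro abs_mult_le_mult) auto
  then have 4: "\<bar>v * e^5\<bar> \<le> V^5 * e^5" using Vk by simp
  have "artanh y - (v * e - v * e^3 + v^3 * e^3 / 3 + v * e^5 / 3)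
     = (artanh y - (y + y^3/3)) + (y - (v * e - v * e^3)) + (y^3 - v^3 * e^3)/3 - v * e^5 / 3"
    by (simp add: field_simps)
  then show ?thesis using 1 2 3 4 unfolding y_def c_def by linarith
qed

text \<open>Neighbouring binomial coefficients have the ratio (n - j)/(j + 1) = (1 - y)/(1 + y) with
  y = (2j + 1 - n)/(n + 1), and 2 artanh y = ln ((1 + y)/(1 - y)). No factorial has to be
  estimated.\<close>

lemma ln_binom_mass_step:
  assumes p: "0 < p" "p < 1" "p / (1 - p) = exp (2 * r)" and j: "j < n"
  shows "ln (binom_mass n p (Suc j)) - ln (binom_mass n p j) = 2 * r - 2 * artanh ((2 * real j + 1 - real n) / (real n + 1))"
proof -
  define y where "y = (2 * real j + 1 - real n) / (real n + 1)"
  have y: "1 - y = 2 * real (n - j) / (real n + 1)" "1 + y = 2 * real (Suc j) / (real n + 1)"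
    using j by (simp_all add: y_def of_nat_diff field_simps)
  have gen: "(2 * A / N) / (2 * B / N) = A / B" if "N \<noteq> 0" for A B N :: real
    using that by simp
  have "real n + 1 \<noteq> 0" by (simp add: add_nonneg_eq_0_iff)
  from gen[OF this] have "(1 + y) / (1 - y) = real (Suc j) / real (n - j)"
    unfolding y .
  then have art: "2 * artanh y = ln (real (Suc j) / real (n - j))"
    unfolding artanh_def by simp
  have pos: "0 < binom_mass n p (Suc j)" "0 < binom_mass n p j" using p j by (auto intro!: binom_mass_pos)
  have "binom_mass n p (Suc j) = binom_mass n p j * (p / (1 - p)) / (real (Suc j) / real (n - j))"
  proof -
    have "x = B * (p / Q) / (S / N)" if "x * S * Q = B * N * p" "S \<noteq> 0" "Q \<noteq> 0" "N \<noteq> 0" for x S Q B N :: real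
      using that by (simp add: field_simps)
    from this[OF binom_mass_Suc[OF j p(2)]] show ?thesis using p j by simp
  qed
  then have "ln (binom_mass n p (Suc j)) = ln (binom_mass n p j) + ln (p / (1 - p)) - ln (real (Suc j) / real (n - j))"
    using pos p j by (simp add: ln_mult ln_div)
  then show ?thesis unfolding p(3) art[symmetric] y_def by simp
qed

lemma std_node_Suc: "n > 0 \<Longrightarrow> std_node n \<rho> (real (Suc j)) = std_node n \<rho> (real j) + 2 * (1 / sqrt n)"
  by (simp add: std_node_def field_simps)

text \<open>The two step formulas agree in their constant parts by the assumption on \<rho> -
  \<rho>0 and in the rest by the expansion of \<open>artanh\<close>; the constant is 12 = 2 + 2 *
  5.\<close>

lemma ln_binom_mass_profile_step:
  fixes \<rho> \<rho>0 b M V p :: real and n j :: nat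
  defines "e \<equiv> 1 / sqrt n"
  assumes p: "0 < p" "p < 1" "p / (1 - p) = exp (2 * (\<rho> * e))" and j: "j < n"
    and \<rho>: "\<bar>\<rho> - \<rho>0 - (b - \<rho>0/3 + \<rho>0^3/3) * e^2\<bar> \<le> M * e^3" and M: "1 \<le> M"
    and v: "\<bar>std_node n \<rho>0 j + e + \<rho>0\<bar> \<le> V" and V: "1 \<le> V" "V * e \<le> 1/2"
  shows "\<bar>(ln (binom_mass n p (Suc j)) - log_profile \<rho>0 b e (std_node n \<rho>0 (Suc j)))
      - (ln (binom_mass n p j) - log_profile \<rho>0 b e (std_node n \<rho>0 j))\<bar> \<le> 12 * (M * V^5 * e^4)"
proof -
  define w where "w = std_node n \<rho>0 j + e + \<rho>0"
  define q where "q = w * e - w * e^3 + w^3 * e^3 / 3 + w * e^5 / 3"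
  have n: "n > 0" using j by simp
  have e: "0 < e" "e^2 = 1 / real n" using n by (simp_all add: e_def power_divide)
  have "w = (2 * real j + 1 - real n) * e"
    using n by (simp add: w_def std_node_def e_def field_simps)
  then have "w * e = (2 * real j + 1 - real n) * e^2" by (simp add: power2_eq_square)
  \<comment> \<open>As e^2 = 1/n, the factor 1 + e^2 turns the denominator n into n + 1.\<close>
  then have y: "w * e / (1 + e^2) = (2 * real j + 1 - real n) / (real n + 1)"
    unfolding e(2) using n by (simp add: field_simps)
  have 1: "ln (binom_mass n p (Suc j)) - ln (binom_mass n p j) = 2 * (\<rho> * e) - 2 * artanh (w * e / (1 + e^2))"
    unfolding y using p j by (rule ln_binom_mass_step)
  have 2: "log_profile \<rho>0 b e (std_node n \<rho>0 (Suc j)) - log_profile \<rho>0 b e (std_node n \<rho>0 j)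
     = 2 * e * (\<rho>0 + (b - \<rho>0/3 + \<rho>0^3/3) * e^2) - 2 * q"
    unfolding std_node_Suc[OF n, folded e_def] log_profile_step q_def w_def ..
  have 3: "\<bar>artanh (w * e / (1 + e^2)) - q\<bar> \<le> 5 * (V^5 * e^5)"
    unfolding q_def using v V e by (intro artanh_step_bound) (auto simp: w_def)
  have "\<bar>2 * e * (\<rho> - \<rho>0 - (b - \<rho>0/3 + \<rho>0^3/3) * e^2)\<bar> \<le> 2 * e * (M * e^3)"
    using \<rho> e by (intro abs_mult_le_mult) auto
  also have "\<dots> = 2 * (M * 1 * e^4)" by (simp add: power_numeral_reduce)
  also have "\<dots> \<le> 2 * (M * V^5 * e^4)" using M V e by (intro mult_left_mono mult_right_mono one_le_power) auto
  finally have 4: "\<bar>2 * e * (\<rho> - \<rho>0 - (b - \<rho>0/3 + \<rho>0^3/3) * e^2)\<bar> \<le> 2 * (M * V^5 * e^4)" .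
  have "V^5 * e^5 = (1 * V^5 * e^4) * e" by (simp add: power_numeral_reduce)
  also have "\<dots> \<le> (M * V^5 * e^4) * 1"
  proof (intro mult_mono)
    show "e \<le> 1" using V e le_one_if_mult_le_one[of e V] by (simp add: mult.commute)
  qed (use M V e in auto)
  finally have 5: "V^5 * e^5 \<le> M * V^5 * e^4" by simp
  have "(ln (binom_mass n p (Suc j)) - log_profile \<rho>0 b e (std_node n \<rho>0 (Suc j)))
      - (ln (binom_mass n p j) - log_profile \<rho>0 b e (std_node n \<rho>0 j))
     = 2 * e * (\<rho> - \<rho>0 - (b - \<rho>0/3 + \<rho>0^3/3) * e^2) - 2 * (artanh (w * e / (1 + e^2)) - q)"
    using 1 2 by (simp add: algebra_simps)
  also have "\<bar>\<dots>\<bar> \<le> 2 * (M * V^5 * e^4) + 2 * (5 * (V^5 * e^5))"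
    using 4 3 abs_triangle_ineq4 by (smt (verit, ccfv_SIG))
  finally show ?thesis using 5 by linarith
qed

text \<open>The common normalising factor of \<open>b\<close> and \<open>\<beta>\<close> is pinned down by the two total masses.\<close>

lemma sum_compare_of_ratio:
  fixes b \<beta> :: "'a \<Rightarrow> real"
  assumes fin: "finite I" and I: "A \<subseteq> I" "I \<noteq> {}"
    and pos: "\<And>j. j \<in> I \<Longrightarrow> b j > 0" "\<And>j. j \<in> I \<Longrightarrow> \<beta> j > 0"
    and ratio: "\<And>j k. j \<in> I \<Longrightarrow> k \<in> I \<Longrightarrow> (ln (b j) - ln (\<beta> j)) - (ln (b k) - ln (\<beta> k)) \<le> D"
    and D: "0 \<le> D" "D \<le> 1"
    and b1: "1 - \<tau> \<le> sum b I" "sum b I \<le> 1" and \<beta>1: "1 - \<tau> \<le> sum \<beta> I" "sum \<beta> I \<le> 1 + \<tau>"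
    and \<tau>: "0 \<le> \<tau>"
  shows "\<bar>sum b A - sum \<beta> A\<bar> \<le> 2 * D + 2 * \<tau>"
proof -
  \<comment> \<open>Cross-multiplied, the ratio bounds can be summed over A and I at once, without a
    reference index.\<close>
  have cross: "b j * \<beta> k \<le> exp D * (b k * \<beta> j)" if "j \<in> I" "k \<in> I" for j k
  proof -
    have p: "0 < b j" "0 < b k" "0 < \<beta> j" "0 < \<beta> k" using pos that by auto
    have "ln (b j * \<beta> k) \<le> ln (exp D * (b k * \<beta> j))"
      using ratio[OF that] p by (simp add: ln_mult)
    then show ?thesis using p by (subst (asm) ln_le_cancel_iff) auto
  qed
  have S: "sum \<beta> I > 0" "sum b I > 0" using fin I pos by (auto intro!: sum_pos)
  have r1: "sum b I * sum \<beta> A = (\<Sum>j\<in>A. \<Sum>k\<in>I. b k * \<beta> j)"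
    unfolding sum_product by (rule sum.swap)
  have r2: "exp D * (sum b I * sum \<beta> A) = (\<Sum>j\<in>A. \<Sum>k\<in>I. exp D * (b k * \<beta> j))"
    by (subst r1) (simp only: sum_distrib_left)
  have r3: "exp D * (sum b A * sum \<beta> I) = (\<Sum>j\<in>A. \<Sum>k\<in>I. exp D * (b j * \<beta> k))"
    by (subst sum_product) (simp only: sum_distrib_left)
  have up: "sum b A * sum \<beta> I \<le> exp D * (sum b I * sum \<beta> A)"
    unfolding r2 unfolding sum_product using I cross by (intro sum_mono) auto
  have lo: "sum b I * sum \<beta> A \<le> exp D * (sum b A * sum \<beta> I)"
    unfolding r1 r3 using I cross by (intro sum_mono) auto
  have A: "0 \<le> sum \<beta> A" "sum \<beta> A \<le> sum \<beta> I" "0 \<le> sum b A" "sum b A \<le> sum b I"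
    using fin I pos by (auto intro!: sum_nonneg sum_mono2 simp: less_imp_le subset_iff)
  have eD: "exp D \<le> 1 + 2 * D"
    using exp_bound[of D] D mult_left_mono[of D 1 D] by (simp add: power2_eq_square)
  \<comment> \<open>The sign of exp D * sum b I - sum \<beta> I decides. If it is nonpositive, so is
    the difference on A; otherwise sum \<beta> A may be enlarged to sum \<beta> I, which then
    cancels.\<close>
  have "sum b A - sum \<beta> A \<le> 2 * D + \<tau>"
  proof (cases "exp D * sum b I \<le> sum \<beta> I")
    case True
    have "sum b A * sum \<beta> I \<le> (exp D * sum b I) * sum \<beta> A" using up by (simp add: mult_ac)
    also have "\<dots> \<le> sum \<beta> I * sum \<beta> A" using True A by (intro mult_right_mono)
    finally have "sum b A \<le> sum \<beta> A" using S by (simp add: mult.commute)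
    then show ?thesis using D \<tau> by simp
  next
    case False
    have "(sum b A - sum \<beta> A) * sum \<beta> I \<le> (exp D * sum b I - sum \<beta> I) * sum \<beta> A"
      using up by (simp add: algebra_simps)
    also have "\<dots> \<le> (exp D * sum b I - sum \<beta> I) * sum \<beta> I"
      using False A by (intro mult_left_mono) auto
    finally have "sum b A - sum \<beta> A \<le> exp D * sum b I - sum \<beta> I" using S by simp
    also have "\<dots> \<le> exp D * 1 - (1 - \<tau>)" using b1 \<beta>1 by (intro diff_mono mult_left_mono) auto
    finally show ?thesis using eD by simp
  qed
  moreover have "sum \<beta> A - sum b A \<le> 2 * D + 2 * \<tau>"
  proof (cases "sum \<beta> I \<le> exp (-D) * sum b I")
    case True
    have lo': "exp (-D) * sum b I * sum \<beta> A \<le> sum b A * sum \<beta> I"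
      using lo by (simp add: exp_minus field_simps)
    have "sum \<beta> I * sum \<beta> A \<le> exp (-D) * sum b I * sum \<beta> A" using True A by (intro mult_right_mono)
    also note lo'
    finally have "sum \<beta> A \<le> sum b A" using S by (simp add: mult.commute)
    then show ?thesis using D \<tau> by simp
  next
    case False
    have lo': "exp (-D) * sum b I * sum \<beta> A \<le> sum b A * sum \<beta> I"
      using lo by (simp add: exp_minus field_simps)
    have "(sum \<beta> A - sum b A) * sum \<beta> I \<le> (sum \<beta> I - exp (-D) * sum b I) * sum \<beta> A"
      using lo' by (simp add: algebra_simps)
    also have "\<dots> \<le> (sum \<beta> I - exp (-D) * sum b I) * sum \<beta> I"
      using False A by (intro mult_left_mono) auto
    finally have "sum \<beta> A - sum b A \<le> sum \<beta> I - exp (-D) * sum b I" using S by simp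
    moreover have "1 - D \<le> exp (-D)" using exp_ge_add_one_self[of "-D"] by simp
    then have "(1 - D) * sum b I \<le> exp (-D) * sum b I" using S by (intro mult_right_mono) auto
    moreover have "D * sum b I \<le> D * 1" using D b1 by (intro mult_left_mono)
    ultimately show ?thesis using b1 \<beta>1 D by (simp add: algebra_simps)
  qed
  ultimately show ?thesis using \<tau> D by (simp add: abs_le_iff)
qed

subsection \<open>Uniform expansion of binomial tails\<close>

lemma abs_tail_poly_le:
  assumes "\<bar>\<rho>\<bar> \<le> M" "\<bar>b\<bar> \<le> M" "1 \<le> M"
  shows "\<bar>tail_poly \<rho> b x\<bar> \<le> 3 * M^2 * (1 + \<bar>x\<bar>)^3"
proof -
  define X where "X = 1 + \<bar>x\<bar>"
  have X: "1 \<le> X" "\<bar>x\<bar> \<le> X" by (auto simp: X_def)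
  have M1: "M \<le> M^2" "1 \<le> M^2" using assms(3) power_increasing[of 1 2 M] by auto
  have X1: "X^i \<le> X^3" if "i \<le> 3" for i using X that by (intro power_increasing)
  have "\<bar>x^3\<bar> \<le> X^3" "\<bar>\<rho> * x^2\<bar> \<le> M * X^2" "\<bar>\<rho>^2 * x\<bar> \<le> M^2 * X"
    using X assms by (intro abs_mult_le_mult abs_power_le_power; simp)+
  moreover have "1 * X^3 \<le> M^2 * X^3" "M * X^2 \<le> M^2 * X^3" "M^2 * X^1 \<le> M^2 * X^3" "M * X^0 \<le> M^2 * X^3" "1 * X^1 \<le> M^2 * X^3"
    using M1 X1[of 0] X1[of 1] X1[of 2] assms X by (intro mult_mono; simp)+
  moreover have "tail_poly \<rho> b x = - (x^3)/12 - (\<rho> * x^2)/3 + x/12 - (\<rho>^2 * x)/2 + b"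
    by (simp add: tail_poly_def algebra_simps)
  moreover define K where "K = M^2 * X^3"
  ultimately have "\<bar>tail_poly \<rho> b x\<bar> \<le> 3 * K" using X(2) assms(2) by simp
  then show ?thesis by (simp add: K_def X_def)
qed

text \<open>The summands belong to the binomial tail, the Gaussian tail and the correction terms, in
  this order.\<close>

definition tail_const :: "real \<Rightarrow> real \<Rightarrow> real" where
  "tail_const M t = exp ((t + M)^2/2 + t * M) + exp (t^2/2) + (3 + 3 * M^2) * exp ((t + 3)^2/2)"

lemma correction_le_exp:
  assumes "\<bar>\<rho>\<bar> \<le> M" "\<bar>b\<bar> \<le> M" "1 \<le> M" "0 \<le> e" "e \<le> 1" "\<bar>\<delta>\<bar> \<le> 1"
  shows "\<bar>std_normal_density x * (\<delta> * e + x * \<delta>^2 * e^2/2 + tail_poly \<rho> b x * e^2)\<bar>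
     \<le> (3 + 3 * M^2) * exp ((t + 3)^2/2) * exp (- t * \<bar>x\<bar>)"
proof -
  have e2: "\<bar>e^2\<bar> \<le> 1" and d2: "\<bar>\<delta>^2\<bar> \<le> 1"
    using abs_power_le_power[of e 1 2] abs_power_le_power[of \<delta> 1 2] assms by simp_all
  have X: "1 \<le> (1 + \<bar>x\<bar>)^3" "\<bar>x\<bar> \<le> (1 + \<bar>x\<bar>)^3"
    using power_increasing[of 1 3 "1 + \<bar>x\<bar>"] by auto
  have 1: "\<bar>\<delta> * e\<bar> \<le> 1 * 1" using assms by (intro abs_mult_le_mult) auto
  have 2: "\<bar>x * \<delta>^2 * e^2\<bar> \<le> \<bar>x\<bar> * 1 * 1" using e2 d2 by (intro abs_mult_le_mult) auto
  have 3: "\<bar>tail_poly \<rho> b x * e^2\<bar> \<le> 3 * M^2 * (1 + \<bar>x\<bar>)^3 * 1"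
    using e2 assms by (intro abs_mult_le_mult abs_tail_poly_le) auto
  have "\<bar>\<delta> * e + x * \<delta>^2 * e^2/2 + tail_poly \<rho> b x * e^2\<bar> \<le> (1 + \<bar>x\<bar>)^3 + (1 + \<bar>x\<bar>)^3 + 3 * M^2 * (1 + \<bar>x\<bar>)^3"
  proof -
    have "\<bar>u + v/2 + w\<bar> \<le> U + V + W" if "\<bar>u\<bar> \<le> 1 * 1" "\<bar>v\<bar> \<le> \<bar>x\<bar> * 1 * 1" "\<bar>w\<bar> \<le> W * 1" "1 \<le> U" "\<bar>x\<bar> \<le> V"
      for u v w U V W :: real using that by linarith
    from this[OF 1 2 3 X] show ?thesis .
  qed
  also have "\<dots> \<le> (3 + 3 * M^2) * (1 + \<bar>x\<bar>)^3" using X by (simp add: algebra_simps)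
  finally have "\<bar>std_normal_density x * (\<delta> * e + x * \<delta>^2 * e^2/2 + tail_poly \<rho> b x * e^2)\<bar>
     \<le> std_normal_density x * ((3 + 3 * M^2) * (1 + \<bar>x\<bar>)^3)"
    by (intro abs_mult_le_mult) auto
  also have "\<dots> = (3 + 3 * M^2) * (std_normal_density x * (1 + \<bar>x\<bar>)^3)" by (simp add: mult_ac)
  also have "\<dots> \<le> (3 + 3 * M^2) * (exp ((t + real 3)^2/2) * exp (- t * \<bar>x\<bar>))"
    by (intro mult_left_mono std_normal_density_times_power_le) auto
  finally show ?thesis by simp
qed

text \<open>The Gaussian tail is expanded to second order, with \<phi>' = - z \<phi> giving the term
  z \<delta>^2 e^2/2. The correction already carries e^2, so for it a mean value bound is
  enough.\<close>

lemma edge_tail_Taylor: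
  assumes "\<bar>\<rho>\<bar> \<le> M" "\<bar>b\<bar> \<le> M" "1 \<le> M" "0 \<le> e" "\<bar>\<delta>\<bar> \<le> 1"
  shows "\<bar>edge_tail \<rho> b e (z - \<delta> * e) 
      - (gauss_tail z + std_normal_density z * (\<delta> * e + z * \<delta>^2 * e^2/2 + tail_poly \<rho> b z * e^2))\<bar>
     \<le> 24 * M^2 * exp 8 * e^3"
proof -
  let ?\<phi> = std_normal_density
  \<comment> \<open>F, F1, F2 are successive derivatives, and all vanish at 0. The mean value bound
    is used three times, starting from the bound exp 8 on the derivative of F2.\<close>
  define F where "F = (\<lambda>u. gauss_tail (z - u) - gauss_tail z - u * ?\<phi> z - u^2 * z * ?\<phi> z / 2)"
  define F1 where "F1 = (\<lambda>u. ?\<phi> (z - u) - ?\<phi> z - u * z * ?\<phi> z)"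
  define F2 where "F2 = (\<lambda>u. (z - u) * ?\<phi> (z - u) - z * ?\<phi> z)"
  note [derivative_intros] = DERIV_chain2[OF std_normal_density_has_derivative]
  have b3: "\<bar>((z-u)^2 - 1) * ?\<phi> (z - u)\<bar> \<le> exp 8" for u
  proof -
    have "\<bar>(z-u)^2 - 1\<bar> \<le> (1 + \<bar>z - u\<bar>)^2"
    proof -
      have "\<bar>y^2 - 1\<bar> \<le> (1 + \<bar>y\<bar>)^2" for y :: real
      proof -
        have "(1 + \<bar>y\<bar>)^2 = 1 + 2 * \<bar>y\<bar> + y^2" by (simp add: power2_sum)
        then show ?thesis using zero_le_power2[of y] by linarith
      qed
      then show ?thesis .
    qed
    then have "\<bar>((z-u)^2 - 1) * ?\<phi> (z - u)\<bar> \<le> (1 + \<bar>z - u\<bar>)^2 * ?\<phi> (z - u)"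
      by (intro abs_mult_le_mult) auto
    also have "\<dots> \<le> exp ((0 + real 2)^2/2) * exp (- 0 * \<bar>z - u\<bar>)"
      using std_normal_density_times_power_le[of "z - u" 2 0] by (simp add: mult.commute)
    also have "\<dots> \<le> exp 8" by simp
    finally show ?thesis .
  qed
  have F2: "\<bar>F2 u\<bar> \<le> exp 8 * \<bar>u\<bar>" for u
  proof -
    have "\<bar>F2 u - F2 0\<bar> \<le> exp 8 * \<bar>u\<bar>"
    proof (rule diff_zero_le_of_deriv_bound[OF _ b3])
      show "(F2 has_real_derivative ((z-v)^2 - 1) * ?\<phi> (z - v)) (at v)" for v
        unfolding F2_def by (auto intro!: derivative_eq_intros simp: algebra_simps power2_eq_square)
    qed
    then show ?thesis by (simp add: F2_def)
  qed
  have F1: "\<bar>F1 u\<bar> \<le> exp 8 * \<bar>u\<bar> * \<bar>u\<bar>" for u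
  proof -
    have "\<bar>F1 u - F1 0\<bar> \<le> exp 8 * \<bar>u\<bar> * \<bar>u\<bar>"
    proof (rule diff_zero_le_of_deriv_bound[where F' = F2])
      fix v assume "\<bar>v\<bar> \<le> \<bar>u\<bar>"
      then have "exp 8 * \<bar>v\<bar> \<le> exp 8 * \<bar>u\<bar>" by simp
      then show "\<bar>F2 v\<bar> \<le> exp 8 * \<bar>u\<bar>" using F2[of v] by linarith
      show "(F1 has_real_derivative F2 v) (at v)"
        unfolding F1_def F2_def by (auto intro!: derivative_eq_intros simp: algebra_simps)
    qed
    then show ?thesis by (simp add: F1_def)
  qed
  have "\<bar>F (\<delta> * e) - F 0\<bar> \<le> exp 8 * \<bar>\<delta> * e\<bar> * \<bar>\<delta> * e\<bar> * \<bar>\<delta> * e\<bar>"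
  proof (rule diff_zero_le_of_deriv_bound[where F' = F1])
    fix v assume v: "\<bar>v\<bar> \<le> \<bar>\<delta> * e\<bar>"
    then have "\<bar>v\<bar> * \<bar>v\<bar> \<le> \<bar>\<delta> * e\<bar> * \<bar>\<delta> * e\<bar>" by (intro mult_mono) auto
    then have "exp 8 * (\<bar>v\<bar> * \<bar>v\<bar>) \<le> exp 8 * (\<bar>\<delta> * e\<bar> * \<bar>\<delta> * e\<bar>)" by simp
    then show "\<bar>F1 v\<bar> \<le> exp 8 * \<bar>\<delta> * e\<bar> * \<bar>\<delta> * e\<bar>" using F1[of v] by (simp only: mult.assoc)
    show "(F has_real_derivative F1 v) (at v)"
      unfolding F_def F1_def by (auto intro!: derivative_eq_intros)
  qed
  moreover have "F 0 = 0" by (simp add: F_def)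
  ultimately have "\<bar>F (\<delta> * e)\<bar> \<le> exp 8 * \<bar>\<delta> * e\<bar>^3"
    by (simp only: power3_eq_cube mult.assoc diff_zero)
  also have "\<dots> \<le> exp 8 * e^3"
    using assms abs_mult_le_mult[of \<delta> 1 e e] by (intro mult_left_mono power_mono) auto
  finally have G: "\<bar>F (\<delta> * e)\<bar> \<le> exp 8 * e^3" .
  define H where "H = (\<lambda>u. ?\<phi> (z - u) * tail_poly \<rho> b (z - u))"
  have "\<bar>H (\<delta> * e) - H 0\<bar> \<le> (12 * M^2 * exp 8) * \<bar>\<delta> * e\<bar>"
  proof (rule diff_zero_le_of_deriv_bound)
    fix u
    define y where "y = z - u"
    show "(H has_real_derivative ?\<phi> y * dens_poly \<rho> b y) (at u)"
      unfolding H_def y_def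
      by (auto intro!: derivative_eq_intros DERIV_chain2[OF tail_poly_has_derivative] simp: dens_poly_def field_simps)
    have "\<bar>?\<phi> y * dens_poly \<rho> b y\<bar> \<le> ?\<phi> y * (12 * (M^2 * (1 + \<bar>y\<bar>)^4))"
      using assms by (intro abs_mult_le_mult dens_poly_bound) auto
    also have "\<dots> = 12 * M^2 * (?\<phi> y * (1 + \<bar>y\<bar>)^4)" by (simp add: mult_ac)
    also have "\<dots> \<le> 12 * M^2 * (exp ((0 + real 4)^2/2) * exp (- 0 * \<bar>y\<bar>))"
      by (intro mult_left_mono std_normal_density_times_power_le) auto
    finally show "\<bar>?\<phi> y * dens_poly \<rho> b y\<bar> \<le> 12 * M^2 * exp 8" by simp
  qed
  also have "\<dots> \<le> (12 * M^2 * exp 8) * e"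
    using assms abs_mult_le_mult[of \<delta> 1 e e] by (intro mult_left_mono) auto
  finally have "\<bar>H (\<delta> * e) - H 0\<bar> * e^2 \<le> (12 * M^2 * exp 8) * e * e^2" by (rule mult_right_mono) simp
  then have H: "\<bar>(H (\<delta> * e) - H 0) * e^2\<bar> \<le> (12 * M^2 * exp 8) * e^3"
    by (simp add: abs_mult power_numeral_reduce mult_ac)
  have "edge_tail \<rho> b e (z - \<delta> * e) 
      - (gauss_tail z + ?\<phi> z * (\<delta> * e + z * \<delta>^2 * e^2/2 + tail_poly \<rho> b z * e^2))
     = F (\<delta> * e) + (H (\<delta> * e) - H 0) * e^2"
    unfolding F_def H_def edge_tail_def by (simp add: algebra_simps power_mult_distrib)
  also have "\<bar>\<dots>\<bar> \<le> exp 8 * e^3 + (12 * M^2 * exp 8) * e^3" using G H by linarith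
  also have "\<dots> \<le> (12 * M^2 * exp 8) * e^3 + (12 * M^2 * exp 8) * e^3"
  proof (intro add_mono mult_right_mono)
    have "1 \<le> M^2" using assms by simp
    then have "1 * exp 8 \<le> (12 * M^2) * exp (8::real)" by (intro mult_right_mono) auto
    then show "exp 8 \<le> 12 * M^2 * exp (8::real)" by simp
  qed (use assms in auto)
  finally show ?thesis by (simp add: mult_ac)
qed

lemma edge_tail_upper:
  assumes "\<bar>\<rho>\<bar> \<le> M" "\<bar>b\<bar> \<le> M" "1 \<le> M" "0 \<le> e" "e \<le> 1" "0 \<le> t" "0 \<le> x"
  shows "\<bar>edge_tail \<rho> b e x\<bar> \<le> tail_const M t * exp (- t * x)"
proof -
  \<comment> \<open>With \<delta> = 0 the bound of \<open>correction_le_exp\<close> retains only the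
    \<open>tail_poly\<close> term.\<close>
  have "\<bar>edge_tail \<rho> b e x\<bar> \<le> \<bar>gauss_tail x\<bar> + \<bar>std_normal_density x * (0 * e + x * 0^2 * e^2/2 + tail_poly \<rho> b x * e^2)\<bar>"
    unfolding edge_tail_def by (simp add: mult.assoc)
  also have "\<dots> \<le> exp (t^2/2) * exp (- t * x) + (3 + 3 * M^2) * exp ((t + 3)^2/2) * exp (- t * \<bar>x\<bar>)"
    using assms gauss_tail_le_exp[of t x] gauss_tail_nonneg[of x]
    by (intro add_mono correction_le_exp) (auto simp: exp_add[symmetric])
  also have "\<dots> \<le> tail_const M t * exp (- t * x)"
    using assms by (simp add: tail_const_def algebra_simps)
  finally show ?thesis .
qed

lemma edge_tail_lower:
  assumes "\<bar>\<rho>\<bar> \<le> M" "\<bar>b\<bar> \<le> M" "1 \<le> M" "0 \<le> e" "e \<le> 1" "0 \<le> t" "x \<le> 0"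
  shows "\<bar>1 - edge_tail \<rho> b e x\<bar> \<le> tail_const M t * exp (t * x)"
proof -
  have "\<bar>1 - edge_tail \<rho> b e x\<bar> \<le> \<bar>1 - gauss_tail x\<bar> + \<bar>std_normal_density x * (0 * e + x * 0^2 * e^2/2 + tail_poly \<rho> b x * e^2)\<bar>"
    unfolding edge_tail_def by (simp add: mult.assoc)
  also have "\<dots> \<le> exp (t^2/2) * exp (t * x) + (3 + 3 * M^2) * exp ((t + 3)^2/2) * exp (- t * \<bar>x\<bar>)"
    using assms one_minus_gauss_tail_le_exp[of t x] gauss_tail_le_1[of x]
    by (intro add_mono correction_le_exp) (auto simp: exp_add[symmetric])
  also have "\<dots> \<le> tail_const M t * exp (t * x)"
    using assms by (simp add: tail_const_def algebra_simps)
  finally show ?thesis .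
qed

text \<open>Here \<rho> is the exact scaled half log-odds and \<rho>0 the centre of the nodes. All
  parameters but \<open>M\<close> may vary with n, so that constants extracted from the locale
  depend on \<open>M\<close> alone.\<close>

locale tilted_binomial =
  fixes n :: nat and p \<rho> \<rho>0 b M e :: real
  assumes n: "n > 0" and p: "0 < p" "p < 1" and odds: "p / (1 - p) = exp (2 * (\<rho> * e))"
    and M: "1 \<le> M" and \<rho>: "\<bar>\<rho>\<bar> \<le> M" and \<rho>0: "\<bar>\<rho>0\<bar> \<le> M" and b: "\<bar>b\<bar> \<le> M"
    and \<rho>_approx: "\<bar>\<rho> - \<rho>0 - (b - \<rho>0/3 + \<rho>0^3/3) * e^2\<bar> \<le> M * e^3"
    and e_def: "e = 1 / sqrt n"
begin

abbreviation "node \<equiv> std_node n \<rho>0"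

text \<open>The index is an integer since strikes below or above the whole lattice lead to indices
  outside 0..n, where the sum is 1 or 0.\<close>

definition upper_sum :: "int \<Rightarrow> real" where
  "upper_sum i = (\<Sum>j | j \<le> n \<and> i \<le> int j. binom_mass n p j)"

definition expansion :: "real \<Rightarrow> real \<Rightarrow> real" where
  "expansion \<delta> z = gauss_tail z + std_normal_density z * (\<delta> * e + z * \<delta>^2 * e^2/2 + tail_poly \<rho>0 b z * e^2)"

lemma e_pos: "0 < e" and e_le_1: "e \<le> 1"
  using n by (simp_all add: e_def)

lemma node_eq: "node x = (2 * x - real n) * e - \<rho>0"
  by (simp add: std_node_def e_def)

lemma node_mono: "x \<le> y \<Longrightarrow> node x \<le> node y"
  using e_pos by (simp add: node_eq)

lemma node_diff: "node x - node y = 2 * e * (x - y)"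
  by (simp add: node_eq algebra_simps)

text \<open>The sign s selects the tail. Tilt and centring are bounded by M and cost only a constant
  factor.\<close>

lemma mass_sum_le:
  assumes "A \<subseteq> {0..n}" "0 \<le> t" "\<bar>s\<bar> = 1" "\<And>j. j \<in> A \<Longrightarrow> s * z \<le> s * node (real j)"
  shows "(\<Sum>j\<in>A. binom_mass n p j) \<le> exp ((t + M)^2/2 + t * M) * exp (- t * (s * z))"
proof -
  have s2: "s^2 = 1" using assms(3) by (metis one_power2 power2_abs)
  have "(\<Sum>j\<in>A. binom_mass n p j) \<le> exp ((t * s + \<rho>)^2/2 - t * s * (z + \<rho>0))"
  proof (rule binom_mass_sum_le_exp[OF p n])
    show "p / (1 - p) = exp (2 * (\<rho> / sqrt n))" using odds by (simp add: e_def)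
    fix j assume "j \<in> A"
    from assms(4)[OF this] have "s * (z + \<rho>0) \<le> s * ((2 * real j - real n) / sqrt n)"
      by (simp add: std_node_def algebra_simps)
    then have "t * (s * (z + \<rho>0)) \<le> t * (s * ((2 * real j - real n) / sqrt n))"
      using assms(2) by (rule mult_left_mono)
    then show "t * s * (z + \<rho>0) \<le> t * s * ((2 * real j - real n) / sqrt n)" by (simp only: mult.assoc)
  qed (rule assms(1))
  also have "\<dots> \<le> exp (((t + M)^2/2 + t * M) + (- t * (s * z)))"
  proof -
    have "\<bar>t * s + \<rho>\<bar> \<le> t + M" using assms \<rho> abs_triangle_ineq[of "t * s" \<rho>] by (simp add: abs_mult)
    then have "(t * s + \<rho>)^2 \<le> (t + M)^2" by (metis abs_ge_zero power2_abs power_mono)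
    moreover have "\<bar>(t * s) * \<rho>0\<bar> \<le> t * M" using assms \<rho>0 by (intro abs_mult_le_mult) (auto simp: abs_mult)
    moreover have "t * s * (z + \<rho>0) = t * (s * z) + (t * s) * \<rho>0" by (simp add: algebra_simps)
    ultimately show ?thesis by simp
  qed
  also have "\<dots> = exp ((t + M)^2/2 + t * M) * exp (- t * (s * z))" by (rule exp_add)
  finally show ?thesis .
qed

lemma upper_sum_nonneg: "0 \<le> upper_sum i"
  unfolding upper_sum_def using p by (intro sum_nonneg binom_mass_nonneg) auto

lemma one_minus_upper_sum: "1 - upper_sum i = (\<Sum>j | j \<le> n \<and> int j < i. binom_mass n p j)"
proof -
  have "1 = (\<Sum>j\<in>{j. j \<le> n \<and> i \<le> int j} \<union> {j. j \<le> n \<and> int j < i}. binom_mass n p j)"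
    unfolding sum_binom_mass[of n p, symmetric] by (rule sum.cong) auto
  also have "\<dots> = upper_sum i + (\<Sum>j | j \<le> n \<and> int j < i. binom_mass n p j)"
    unfolding upper_sum_def by (rule sum.union_disjoint) auto
  finally show ?thesis by simp
qed

text \<open>The value \<open>\<theta> = 1\<close> is allowed on purpose: then \<open>z\<close> is the node with index \<open>i - 1\<close>, and the
  statement concerns the strict inequality at a lattice point, with \<open>\<Delta>\<^sub>n - 2 = -1\<close>.\<close>

lemma expansion_error_tail:
  assumes "0 \<le> t" "0 \<le> \<theta>" "\<theta> \<le> 1" and z: "z = node (real_of_int i) - 2 * \<theta> * e"
  shows "\<bar>upper_sum i - expansion (1 - 2 * \<theta>) z\<bar> \<le> tail_const M t * exp (- t * \<bar>z\<bar>)"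
proof -
  define c where "c = std_normal_density z * ((1 - 2 * \<theta>) * e + z * (1 - 2 * \<theta>)^2 * e^2/2 + tail_poly \<rho>0 b z * e^2)"
  have c: "\<bar>c\<bar> \<le> (3 + 3 * M^2) * exp ((t + 3)^2/2) * exp (- t * \<bar>z\<bar>)"
    unfolding c_def using \<rho>0 b M e_pos e_le_1 assms by (intro correction_le_exp) auto
  have ex: "expansion (1 - 2 * \<theta>) z = gauss_tail z + c" by (simp add: expansion_def c_def)
  have gen: "\<bar>x - (g + c)\<bar> \<le> tail_const M t * exp (- t * \<bar>z\<bar>)"
    if "0 \<le> x" "x \<le> exp ((t + M)^2/2 + t * M) * exp (- t * \<bar>z\<bar>)" "0 \<le> g" "g \<le> exp (t^2/2) * exp (- t * \<bar>z\<bar>)"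
    for x g
    using that c unfolding tail_const_def distrib_right by linarith
  \<comment> \<open>For z \<ge> 0 both tails are small. For z < 0 they are close to 1, and their
    complements are compared.\<close>
  show ?thesis
  proof (cases "0 \<le> z")
    case True
    have "upper_sum i \<le> exp ((t + M)^2/2 + t * M) * exp (- t * (1 * z))"
      unfolding upper_sum_def
    proof (rule mass_sum_le)
      fix j assume "j \<in> {j. j \<le> n \<and> i \<le> int j}"
      then have "node (real_of_int i) \<le> node (real j)" by (intro node_mono) auto
      then show "1 * z \<le> 1 * node (real j)" 
      proof -
        have "0 \<le> 2 * \<theta> * e" using assms e_pos by simp
        then show ?thesis using z \<open>node (real_of_int i) \<le> node (real j)\<close> by linarith
      qed
    qed (use assms in auto)
    moreover have "gauss_tail z \<le> exp (t^2/2) * exp (- t * \<bar>z\<bar>)"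
      using gauss_tail_le_exp[of t z] assms(1) True by (simp add: exp_add[symmetric])
    ultimately show ?thesis unfolding ex using gen[of "upper_sum i" "gauss_tail z"] upper_sum_nonneg gauss_tail_nonneg True by simp
  next
    case False
    have U: "1 - upper_sum i \<le> exp ((t + M)^2/2 + t * M) * exp (- t * (-1 * z))"
      unfolding one_minus_upper_sum
    proof (rule mass_sum_le)
      fix j assume "j \<in> {j. j \<le> n \<and> int j < i}"
      then have "node (real j) \<le> node (real_of_int i - 1)" by (intro node_mono) auto
      also have "\<dots> = z + 2 * \<theta> * e - 2 * e" using node_diff[of "real_of_int i - 1" "real_of_int i"] z by (simp add: algebra_simps)
      \<comment> \<open>Here \<theta> \<le> 1 enters: the last node before index i is z + 2 \<theta>
        e - 2 e, which does not exceed z.\<close>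
      also have "\<dots> \<le> z" using assms e_pos mult_right_mono[of \<theta> 1 e] by simp
      finally show "-1 * z \<le> -1 * node (real j)" by simp
    qed (use assms in auto)
    have G: "1 - gauss_tail z \<le> exp (t^2/2) * exp (- t * \<bar>z\<bar>)"
      using one_minus_gauss_tail_le_exp[of t z] assms(1) False by (simp add: exp_add[symmetric])
    have U0: "0 \<le> 1 - upper_sum i"
      unfolding one_minus_upper_sum using p by (intro sum_nonneg binom_mass_nonneg) auto
    have gen': "\<bar>x - (g + (-c))\<bar> \<le> tail_const M t * exp (- t * \<bar>z\<bar>)"
      if "0 \<le> x" "x \<le> exp ((t + M)^2/2 + t * M) * exp (- t * \<bar>z\<bar>)" "0 \<le> g" "g \<le> exp (t^2/2) * exp (- t * \<bar>z\<bar>)"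
      for x g
      using that c unfolding tail_const_def distrib_right by linarith
    have "\<bar>(1 - upper_sum i) - ((1 - gauss_tail z) + (- c))\<bar> \<le> tail_const M t * exp (- t * \<bar>z\<bar>)"
      by (rule gen'[OF U0 _ _ G]) (use U False gauss_tail_le_1[of z] in auto)
    then show ?thesis unfolding ex by (simp add: abs_minus_commute)
  qed
qed

end

lemma powr_interpolate_le:
  fixes x a b :: real
  assumes "0 \<le> x" "x \<le> a" "x \<le> b" "0 \<le> s" "s \<le> 1"
  shows "x \<le> a powr s * b powr (1 - s)"
proof -
  have "x = x powr s * x powr (1 - s)" using assms by (simp add: powr_add[symmetric])
  also have "\<dots> \<le> a powr s * b powr (1 - s)" using assms by (intro mult_mono powr_mono2) auto
  finally show ?thesis .
qed

section \<open>Comparison of the masses inside a logarithmic window\<close>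

context tilted_binomial
begin

text \<open>The width 2 e is the spacing of the nodes, so adjacent cells share an edge and sums
  telescope.\<close>

definition cell :: "nat \<Rightarrow> real" where
  "cell j = edge_tail \<rho>0 b e (node (real j) - e) - edge_tail \<rho>0 b e (node (real j) + e)"

lemma node_Suc: "node (real (Suc j)) = node (real j) + 2 * e"
  by (simp add: node_eq algebra_simps)

lemma sum_cell: "i \<le> Suc h \<Longrightarrow> 
   (\<Sum>j=i..h. cell j) = edge_tail \<rho>0 b e (node (real i) - e) - edge_tail \<rho>0 b e (node (real h) + e)"
  using sum_Suc_diff[of i h "\<lambda>j. - edge_tail \<rho>0 b e (node (real j) - e)"]
  unfolding cell_def node_Suc by (simp add: algebra_simps)

text \<open>V bounds the uncentred step midpoints \<open>node j + e + \<rho>0\<close> in the window.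
  The condition V e \<le> 1/2 keeps the arguments of \<open>artanh\<close> small and places the
  window inside 0..n.\<close>

context
  fixes L V :: real
  assumes L: "1 \<le> L" and V: "V = L + M + 1" and Ve: "V * e \<le> 1/2" and small: "400 * (M^2 * L^5 * e) \<le> 1"
begin

lemma V_ge_1: "1 \<le> V" and L_le_V: "L \<le> V"
  using L M by (simp_all add: V)

lemma log_mass_profile_diff:
  assumes "j \<le> k" "k \<le> n" "- L \<le> node (real j)" "node (real k) \<le> L"
  shows "\<bar>(ln (binom_mass n p k) - log_profile \<rho>0 b e (node (real k))) 
      - (ln (binom_mass n p j) - log_profile \<rho>0 b e (node (real j)))\<bar> \<le> real (k - j) * (12 * (M * V^5 * e^4))"
  using assms(1,2,4)
proof (induction k rule: dec_induct)
  case base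
  then show ?case by simp
next
  case (step k)
  have k: "node (real j) \<le> node (real k)" "node (real k) \<le> node (real (Suc k))"
    using step by (auto intro!: node_mono)
  have "\<bar>(ln (binom_mass n p (Suc k)) - log_profile \<rho>0 b e (node (real (Suc k)))) 
      - (ln (binom_mass n p k) - log_profile \<rho>0 b e (node (real k)))\<bar> \<le> 12 * (M * V^5 * e^4)"
    unfolding e_def
  proof (rule ln_binom_mass_profile_step)
    show "p / (1 - p) = exp (2 * (\<rho> * (1 / sqrt (real n))))" using odds by (simp add: e_def)
    show "\<bar>\<rho> - \<rho>0 - (b - \<rho>0/3 + \<rho>0^3/3) * (1 / sqrt (real n))^2\<bar> \<le> M * (1 / sqrt (real n))^3"
      using \<rho>_approx by (simp add: e_def)
    show "\<bar>node (real k) + 1 / sqrt (real n) + \<rho>0\<bar> \<le> V"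
      using k step.prems assms(3) \<rho>0 e_pos e_le_1 unfolding V e_def[symmetric] by linarith
    show "V * (1 / sqrt (real n)) \<le> 1/2" using Ve by (simp add: e_def)
  qed (use p step M V_ge_1 in auto)
  moreover have "real (Suc k - j) = real (k - j) + 1" using step by (simp add: of_nat_diff)
  moreover have "\<bar>(ln (binom_mass n p k) - log_profile \<rho>0 b e (node (real k))) 
      - (ln (binom_mass n p j) - log_profile \<rho>0 b e (node (real j)))\<bar> \<le> real (k - j) * (12 * (M * V^5 * e^4))"
    using step k by simp
  ultimately show ?case by (simp only: distrib_right)
qed

lemma cell_pos: "\<bar>node (real j)\<bar> \<le> L \<Longrightarrow> 0 < cell j"
  unfolding cell_def by (rule ln_cell_mass_bound(1)[OF \<rho>0 b M L _ e_pos small])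

lemma log_cell_profile:
  assumes "\<bar>node (real j)\<bar> \<le> L"
  shows "\<bar>ln (cell j) - (ln (2 * e / sqrt (2 * pi)) + log_profile \<rho>0 b e (node (real j)))\<bar> \<le> 310 * (M^2 * V^6 * e^3)"
proof -
  have "L^5 \<le> V^5" "V^5 \<le> V^6" using L L_le_V V_ge_1 by (auto intro!: power_mono power_increasing)
  then have "M^2 * L^5 * e^3 \<le> M^2 * V^6 * e^3" using M e_pos by (intro mult_right_mono mult_left_mono) auto
  moreover have "\<bar>ln (cell j) - (ln (2 * e / sqrt (2 * pi)) - (node (real j))^2/2 
       + e^2 * (((node (real j))^2 - 1)/6 + dens_poly \<rho>0 b (node (real j))))\<bar> \<le> 310 * (M^2 * L^5 * e^3)"
    unfolding cell_def by (rule ln_cell_mass_bound(2)[OF \<rho>0 b M L assms e_pos small])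
  ultimately show ?thesis unfolding log_profile_def by (simp add: algebra_simps)
qed

text \<open>Two nodes of the window are at most V/e steps apart, so step errors of order e^4 add up
  to order e^3. The constant 700 covers 12 for the steps and 310 for each of the two cells.\<close>

lemma log_ratio_diff:
  assumes "j \<le> k" "k \<le> n" "- L \<le> node (real j)" "node (real k) \<le> L"
  shows "\<bar>(ln (binom_mass n p k) - ln (cell k)) - (ln (binom_mass n p j) - ln (cell j))\<bar> \<le> 700 * (M^2 * V^6 * e^3)"
proof -
  define K where "K = M^2 * V^6 * e^3"
  have jk: "node (real j) \<le> node (real k)" using assms by (intro node_mono) auto
  have "real (k - j) * (2 * e) = node (real k) - node (real j)"
    using assms by (simp add: node_diff of_nat_diff)
  also have "\<dots> \<le> 2 * V" using assms L_le_V by linarith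
  finally have "real (k - j) * e \<le> V" by simp
  moreover have "0 \<le> 12 * (M * V^5 * e^3)" using M V_ge_1 e_pos by simp
  ultimately have "(real (k - j) * e) * (12 * (M * V^5 * e^3)) \<le> V * (12 * (M * V^5 * e^3))" 
    by (rule mult_right_mono)
  also have "\<dots> = 12 * (M * (V^6 * e^3))" by (simp add: power_numeral_reduce)
  also have "\<dots> \<le> 12 * (M^2 * (V^6 * e^3))"
    using M V_ge_1 e_pos power_increasing[of 1 2 M] by (intro mult_left_mono mult_right_mono) auto
  finally have 1: "real (k - j) * (12 * (M * V^5 * e^4)) \<le> 12 * K" by (simp add: K_def power_numeral_reduce mult_ac)
  have "\<bar>node (real j)\<bar> \<le> L" "\<bar>node (real k)\<bar> \<le> L" using jk assms by linarith+
  note 2 = this[THEN log_cell_profile, folded K_def]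
  have "0 \<le> K" using M V_ge_1 e_pos by (simp add: K_def)
  then show ?thesis using log_mass_profile_diff[OF assms] 1 2 unfolding K_def[symmetric] by linarith
qed

text \<open>On the window the ratios of masses to cells are nearly constant and both totals are
  within \<tau> of 1, so partial sums differ by at most 2 D + 2 \<tau>, with D the bound on the log
  ratios. The cells telescope to the edge at node i - e, and the parts above the window cost
  \<tau>/2 for each family.\<close>

lemma upper_sum_near_edge_tail:
  fixes t \<tau> :: real and i :: int
  assumes t: "0 \<le> t" and \<tau>: "tail_const M t * exp (- t * (L - 1)) \<le> \<tau> / 2"
    and D: "700 * (M^2 * V^6 * e^3) \<le> 1"
    and i: "\<bar>node (real_of_int i)\<bar> \<le> L"
  shows "\<bar>upper_sum i - edge_tail \<rho>0 b e (node (real_of_int i) - e)\<bar> \<le> 2 * (700 * (M^2 * V^6 * e^3)) + 3 * \<tau>"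
proof -
  \<comment> \<open>These are the real indices whose nodes are -L and L.\<close>
  define c1 c2 where "c1 = (real n + (\<rho>0 - L) / e) / 2" and "c2 = (real n + (\<rho>0 + L) / e) / 2"
  define lo hi where "lo = nat \<lceil>c1\<rceil>" and "hi = nat \<lfloor>c2\<rfloor>"
  have e2: "e * e = 1 / real n" using n by (simp add: e_def)
  have ne: "real n * e = 1 / e" using n e2 e_pos by (simp add: field_simps)
  have LM: "(L + M) * e \<le> 1/2" using Ve e_pos by (simp add: V algebra_simps)
  have "(L + M) / e = (L + M) * e * real n"
    using e_pos ne by (simp add: field_simps)
  also have "\<dots> \<le> 1/2 * real n" using LM by (intro mult_right_mono) auto
  finally have LMe: "(L + M) / e \<le> real n / 2" by simp
  have "(\<rho>0 + L) / e \<le> (L + M) / e" "- ((L + M) / e) \<le> (\<rho>0 - L) / e" "0 \<le> (L + M) / e" "(\<rho>0 - L) / e \<le> (\<rho>0 + L) / e"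
    using \<rho>0 e_pos L M by (auto simp: field_simps abs_le_iff)
  moreover have "0 < (N + B) / 2 \<and> (N + A) / 2 \<le> N \<and> 0 \<le> (N + A) / 2"
    if "A \<le> C" "- C \<le> B" "0 \<le> C" "B \<le> A" "C \<le> N / 2" "0 < N" for A B C N :: real
    using that by auto
  \<comment> \<open>Strictness at 0 makes \<open>lo\<close> positive: node 0 lies below the window,
    hence i > 0, and \<open>lo\<close> has a predecessor whose node is below -L.\<close>
  ultimately have c: "0 < c1" "c2 \<le> real n" "0 \<le> c2" 
    using LMe n unfolding c1_def c2_def by (meson of_nat_0_less_iff)+
  have lo: "lo \<le> j \<longleftrightarrow> - L \<le> node (real j)" for j
  proof -
    have "lo \<le> j \<longleftrightarrow> c1 \<le> real j" by (simp add: lo_def)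
    also have "\<dots> \<longleftrightarrow> (\<rho>0 - L) / e \<le> 2 * real j - real n" by (auto simp: c1_def field_simps)
    also have "\<dots> \<longleftrightarrow> - L \<le> node (real j)" using e_pos by (auto simp: node_eq pos_divide_le_eq)
    finally show ?thesis .
  qed
  have hi: "j \<le> hi \<longleftrightarrow> node (real j) \<le> L" for j
  proof -
    have "j \<le> hi \<longleftrightarrow> real j \<le> c2" using c unfolding hi_def by (simp add: le_nat_iff le_floor_iff)
    also have "\<dots> \<longleftrightarrow> 2 * real j - real n \<le> (\<rho>0 + L) / e" by (auto simp: c2_def field_simps)
    also have "\<dots> \<longleftrightarrow> node (real j) \<le> L" using e_pos by (auto simp: node_eq pos_le_divide_eq)
    finally show ?thesis .
  qed
  have "real hi \<le> c2" using c by (simp add: hi_def of_nat_floor)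
  then have hin: "hi \<le> n" using c by linarith
  have lo0: "0 < lo" using c by (simp add: lo_def)
  have "node 0 < - L" using lo[of 0] lo0 by auto
  moreover have "node (real_of_int i) \<le> node 0" if "i \<le> 0" using that by (intro node_mono) auto
  ultimately have "0 < i" using i by force
  then obtain k where k: "i = int k" using zero_less_imp_eq_int by blast
  have kI: "lo \<le> k" "k \<le> hi" using i lo[of k] hi[of k] by (auto simp: k)
  let ?E = "exp ((t + M)^2/2 + t * M) * exp (- t * L)"
  have E: "?E \<le> \<tau> / 2"
  proof -
    have "?E \<le> exp ((t + M)^2/2 + t * M) * exp (- t * (L - 1))" using t by (simp add: algebra_simps)
    also have "\<dots> \<le> tail_const M t * exp (- t * (L - 1))" by (intro mult_right_mono) (auto simp: tail_const_def)
    finally show ?thesis using \<tau> by simp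
  qed
  have up: "(\<Sum>j\<in>{hi<..n}. binom_mass n p j) \<le> \<tau> / 2"
  proof -
    have "(\<Sum>j\<in>{hi<..n}. binom_mass n p j) \<le> exp ((t + M)^2/2 + t * M) * exp (- t * (1 * L))"
      by (rule mass_sum_le) (use t hi in \<open>auto simp: not_le[symmetric]\<close>)
    then show ?thesis using E by simp
  qed
  have dn: "(\<Sum>j\<in>{..<lo}. binom_mass n p j) \<le> \<tau> / 2"
  proof -
    have "(\<Sum>j\<in>{..<lo}. binom_mass n p j) \<le> exp ((t + M)^2/2 + t * M) * exp (- t * (- 1 * (- L)))"
    proof (rule mass_sum_le)
      show "{..<lo} \<subseteq> {0..n}" using kI hin by auto
    qed (use t lo in \<open>auto simp: not_le[symmetric]\<close>)
    then show ?thesis using E by simp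
  qed
  have nn: "0 \<le> binom_mass n p j" for j using p by (intro binom_mass_nonneg) auto
  have "(\<Sum>j=0..n. binom_mass n p j) = (\<Sum>j\<in>{..<lo} \<union> {lo..hi} \<union> {hi<..n}. binom_mass n p j)"
    using kI hin by (intro sum.cong) auto
  also have "\<dots> = (\<Sum>j\<in>{..<lo}. binom_mass n p j) + (\<Sum>j=lo..hi. binom_mass n p j) + (\<Sum>j\<in>{hi<..n}. binom_mass n p j)"
    using kI by (subst sum.union_disjoint, auto)+
  finally have tot: "1 = (\<Sum>j\<in>{..<lo}. binom_mass n p j) + (\<Sum>j=lo..hi. binom_mass n p j) + (\<Sum>j\<in>{hi<..n}. binom_mass n p j)"
    by (simp only: sum_binom_mass)
  have nns: "0 \<le> (\<Sum>j\<in>A. binom_mass n p j)" for A by (intro sum_nonneg nn)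
  \<comment> \<open>The node after \<open>hi\<close> exceeds L and the upper edge lies only e \<le>
    1 below it; this explains L - 1 in the assumption on \<tau>.\<close>
  have top: "\<bar>edge_tail \<rho>0 b e (node (real hi) + e)\<bar> \<le> \<tau> / 2"
  proof -
    have "L < node (real (Suc hi))" using hi[of "Suc hi"] by auto
    then have x: "L - 1 \<le> node (real hi) + e" using e_pos e_le_1 unfolding node_Suc by linarith
    have "\<bar>edge_tail \<rho>0 b e (node (real hi) + e)\<bar> \<le> tail_const M t * exp (- t * (node (real hi) + e))"
      using \<rho>0 b M e_pos e_le_1 t x L by (intro edge_tail_upper) auto
    also have "\<dots> \<le> tail_const M t * exp (- t * (L - 1))"
      using t x by (intro mult_left_mono) (auto simp: tail_const_def mult_left_mono)
    finally show ?thesis using \<tau> by simp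
  qed
  have bot: "\<bar>1 - edge_tail \<rho>0 b e (node (real lo) - e)\<bar> \<le> \<tau> / 2"
  proof -
    obtain l where l: "lo = Suc l" using lo0 gr0_implies_Suc by blast
    have "node (real l) < - L" using lo[of l] l by auto
    then have x: "node (real lo) - e \<le> - (L - 1)" using e_pos e_le_1 unfolding l node_Suc by linarith
    have "\<bar>1 - edge_tail \<rho>0 b e (node (real lo) - e)\<bar> \<le> tail_const M t * exp (t * (node (real lo) - e))"
      using \<rho>0 b M e_pos e_le_1 t x L by (intro edge_tail_lower) auto
    also have "\<dots> \<le> tail_const M t * exp (- t * (L - 1))"
    proof (rule mult_left_mono)
      have "t * (node (real lo) - e) \<le> - t * (L - 1)"
        using mult_left_mono[OF x t] by (simp only: mult_minus_left mult_minus_right)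
      then show "exp (t * (node (real lo) - e)) \<le> exp (- t * (L - 1))" by (simp only: exp_le_cancel_iff)
    qed (simp add: tail_const_def)
    finally show ?thesis using \<tau> by simp
  qed
  have \<tau>0: "0 \<le> \<tau>" using up nns[of "{hi<..n}"] by simp
  have D0: "0 \<le> 700 * (M^2 * V^6 * e^3)" using M V_ge_1 e_pos by simp
  have "\<bar>sum (binom_mass n p) {k..hi} - sum cell {k..hi}\<bar> \<le> 2 * (700 * (M^2 * V^6 * e^3)) + 2 * \<tau>"
  proof (rule sum_compare_of_ratio[where I="{lo..hi}"])
    fix j assume j: "j \<in> {lo..hi}"
    then show "0 < binom_mass n p j" using hin p by (intro binom_mass_pos) auto
    show "0 < cell j" using j lo hi by (intro cell_pos) auto
    fix m assume m: "m \<in> {lo..hi}"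
    have jm: "j \<le> n" "m \<le> n" using j m hin by auto
    have nd: "- L \<le> node (real j)" "node (real j) \<le> L" "- L \<le> node (real m)" "node (real m) \<le> L"
      using j m lo hi by auto
    show "ln (binom_mass n p j) - ln (cell j) - (ln (binom_mass n p m) - ln (cell m)) \<le> 700 * (M^2 * V^6 * e^3)"
    proof (cases "j \<le> m")
      case True
      have "\<bar>(ln (binom_mass n p m) - ln (cell m)) - (ln (binom_mass n p j) - ln (cell j))\<bar> \<le> 700 * (M^2 * V^6 * e^3)"
        using jm nd True by (intro log_ratio_diff) auto
      then show ?thesis by linarith
    next
      case False
      have "\<bar>(ln (binom_mass n p j) - ln (cell j)) - (ln (binom_mass n p m) - ln (cell m))\<bar> \<le> 700 * (M^2 * V^6 * e^3)"
        using jm nd False by (intro log_ratio_diff) auto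
      then show ?thesis by linarith
    qed
  next
    show "1 - \<tau> \<le> sum (binom_mass n p) {lo..hi}" "sum (binom_mass n p) {lo..hi} \<le> 1"
      using tot up dn nns by (smt (verit) field_sum_of_halves)+
    have "sum cell {lo..hi} = edge_tail \<rho>0 b e (node (real lo) - e) - edge_tail \<rho>0 b e (node (real hi) + e)"
      using kI by (intro sum_cell) auto
    then show "1 - \<tau> \<le> sum cell {lo..hi}" "sum cell {lo..hi} \<le> 1 + \<tau>"
      using top bot by linarith+
  qed (use kI D D0 \<tau>0 in auto)
  moreover have "sum cell {k..hi} = edge_tail \<rho>0 b e (node (real k) - e) - edge_tail \<rho>0 b e (node (real hi) + e)"
    using kI by (intro sum_cell) auto
  moreover have "upper_sum i = sum (binom_mass n p) {k..hi} + sum (binom_mass n p) {hi<..n}"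
  proof -
    have "upper_sum i = sum (binom_mass n p) ({k..hi} \<union> {hi<..n})"
      unfolding upper_sum_def k using kI hin by (intro sum.cong) auto
    also have "\<dots> = sum (binom_mass n p) {k..hi} + sum (binom_mass n p) {hi<..n}"
      by (rule sum.union_disjoint) auto
    finally show ?thesis .
  qed
  ultimately show ?thesis using up nns[of "{hi<..n}"] top unfolding k by simp
qed

lemma expansion_error_mid:
  fixes t \<tau> \<theta> z :: real and i :: int
  assumes t: "0 \<le> t" and \<tau>: "tail_const M t * exp (- t * (L - 1)) \<le> \<tau> / 2"
    and D: "700 * (M^2 * V^6 * e^3) \<le> 1"
    and \<theta>: "0 \<le> \<theta>" "\<theta> \<le> 1" and z: "z = node (real_of_int i) - 2 * \<theta> * e" "\<bar>z\<bar> \<le> L - 1"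
  shows "\<bar>upper_sum i - expansion (1 - 2 * \<theta>) z\<bar> \<le> 2 * (700 * (M^2 * V^6 * e^3)) + 3 * \<tau> + 24 * M^2 * exp 8 * e^3"
proof -
  \<comment> \<open>Since 2 e \<le> 1, the node of index i is within distance 1 of z and remains in
    the window.\<close>
  have "1 * e \<le> V * e" using V_ge_1 e_pos by (intro mult_right_mono) auto
  then have "2 * e \<le> 1" using Ve by simp
  moreover have "\<theta> * (2 * e) \<le> 1 * (2 * e)" using \<theta> e_pos by (intro mult_right_mono) auto
  moreover have "0 \<le> \<theta> * (2 * e)" using \<theta> e_pos by simp
  moreover have zi: "node (real_of_int i) = z + \<theta> * (2 * e)" using z by simp
  ultimately have "\<bar>node (real_of_int i)\<bar> \<le> L" using z(2) by linarith
  from upper_sum_near_edge_tail[OF t \<tau> D this]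
  have 1: "\<bar>upper_sum i - edge_tail \<rho>0 b e (node (real_of_int i) - e)\<bar> \<le> 2 * (700 * (M^2 * V^6 * e^3)) + 3 * \<tau>" .
  have "z - (1 - 2 * \<theta>) * e = node (real_of_int i) - e" unfolding zi by (simp add: algebra_simps)
  then have "\<bar>edge_tail \<rho>0 b e (node (real_of_int i) - e) - expansion (1 - 2 * \<theta>) z\<bar> \<le> 24 * M^2 * exp 8 * e^3"
    using edge_tail_Taylor[OF \<rho>0 b M less_imp_le[OF e_pos], of "1 - 2 * \<theta>" z] \<theta> unfolding expansion_def by simp
  then show ?thesis using 1 by linarith
qed

end

end

text \<open>Taken with L = ln n and rate t = 2. The parameters are quantified inside the
  eventuality, so the threshold for n is common to all of them.\<close>

lemma expansion_error_uniform:
  assumes "1 \<le> M"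
  shows "\<exists>C>0. \<forall>\<^sub>F n in sequentially. \<forall>p \<rho> \<rho>0 b i \<theta>. tilted_binomial n p \<rho> \<rho>0 b M (1 / sqrt n) \<longrightarrow> 0 \<le> \<theta> \<longrightarrow> \<theta> \<le> 1 \<longrightarrow>
     \<bar>tilted_binomial.upper_sum n p i - tilted_binomial.expansion \<rho>0 b (1 / sqrt n) (1 - 2 * \<theta>) 
         (std_node n \<rho>0 (real_of_int i) - 2 * \<theta> * (1 / sqrt n))\<bar> \<le> C * real n powr (-11/8)"
proof (intro exI conjI)
  \<comment> \<open>The factor exp 2 pays for L - 1 in place of L in the tail bound.\<close>
  define c where "c = tail_const M 2 * exp 2"
  let ?C = "2 + 7 * c + 24 * M^2 * exp 8"
  have c: "0 < c" unfolding c_def tail_const_def by (intro mult_pos_pos add_pos_nonneg) auto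
  show "0 < ?C" using c by (intro add_pos_nonneg) auto
  have "\<forall>\<^sub>F n in sequentially. 1 \<le> ln (real n)" by real_asymp
  moreover have "\<forall>\<^sub>F n in sequentially. (ln (real n) + M + 1) * (1 / sqrt n) \<le> 1/2" by real_asymp
  moreover have "\<forall>\<^sub>F n in sequentially. 400 * (M^2 * ln (real n)^5 * (1 / sqrt n)) \<le> 1" by real_asymp
  moreover have "\<forall>\<^sub>F n in sequentially. 700 * (M^2 * (ln (real n) + M + 1)^6 * (1 / sqrt n)^3) \<le> 1" by real_asymp
  moreover have "\<forall>\<^sub>F n in sequentially. 700 * (M^2 * (ln (real n) + M + 1)^6 * (1 / sqrt n)^3) \<le> real n powr (-11/8)" by real_asymp
  moreover have "\<forall>\<^sub>F n in sequentially. (1 / sqrt (real n))^3 \<le> real n powr (-11/8)" by real_asymp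
  moreover have "\<forall>\<^sub>F n in sequentially. exp (- 2 * ln (real n)) \<le> real n powr (-11/8)" by real_asymp
  ultimately show "\<forall>\<^sub>F n in sequentially. \<forall>p \<rho> \<rho>0 b i \<theta>. tilted_binomial n p \<rho> \<rho>0 b M (1 / sqrt n) \<longrightarrow> 0 \<le> \<theta> \<longrightarrow> \<theta> \<le> 1 \<longrightarrow>
     \<bar>tilted_binomial.upper_sum n p i - tilted_binomial.expansion \<rho>0 b (1 / sqrt n) (1 - 2 * \<theta>) 
         (std_node n \<rho>0 (real_of_int i) - 2 * \<theta> * (1 / sqrt n))\<bar> \<le> ?C * real n powr (-11/8)"
  proof (eventually_elim, safe)
    fix n p \<rho> \<rho>0 b i and \<theta> :: real
    define L where "L = ln (real n)"
    define q where "q = real n powr (-11/8)"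
    assume *: "1 \<le> ln (real n)" "(ln (real n) + M + 1) * (1 / sqrt n) \<le> 1/2" 
      "400 * (M^2 * ln (real n)^5 * (1 / sqrt n)) \<le> 1"
      "700 * (M^2 * (ln (real n) + M + 1)^6 * (1 / sqrt n)^3) \<le> 1"
      and **: "700 * (M^2 * (ln (real n) + M + 1)^6 * (1 / sqrt n)^3) \<le> real n powr (-11/8)"
      "(1 / sqrt (real n))^3 \<le> real n powr (-11/8)" "exp (- 2 * ln (real n)) \<le> real n powr (-11/8)"
      and tb: "tilted_binomial n p \<rho> \<rho>0 b M (1 / sqrt n)" and \<theta>: "0 \<le> \<theta>" "\<theta> \<le> 1"
    interpret tilted_binomial n p \<rho> \<rho>0 b M "1 / sqrt n" by (rule tb)
    define z where "z = node (real_of_int i) - 2 * \<theta> * (1 / sqrt n)"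
    have q0: "0 \<le> q" by (simp add: q_def)
    have expL: "tail_const M 2 * exp (- 2 * (L - 1)) \<le> c * q"
    proof -
      have "exp (- 2 * (L - 1)) = exp 2 * exp (- 2 * L)" by (simp add: exp_add[symmetric])
      also have "\<dots> \<le> exp 2 * q" using **(3) by (simp add: L_def q_def)
      finally have "tail_const M 2 * exp (- 2 * (L - 1)) \<le> tail_const M 2 * (exp 2 * q)"
        by (intro mult_left_mono) (auto simp: tail_const_def)
      then show ?thesis by (simp add: c_def mult_ac)
    qed
    have "\<bar>upper_sum i - expansion (1 - 2 * \<theta>) z\<bar> \<le> ?C * q"
    proof (cases "\<bar>z\<bar> \<le> L - 1")
      case True
      have "\<bar>upper_sum i - expansion (1 - 2 * \<theta>) z\<bar> 
         \<le> 2 * (700 * (M^2 * (L + M + 1)^6 * (1 / sqrt n)^3)) + 3 * (2 * (c * q)) + 24 * M^2 * exp 8 * (1 / sqrt n)^3"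
        by (rule expansion_error_mid[OF _ refl _ _ _ _ _ \<theta> z_def True, of 2])
           (use * expL in \<open>auto simp: L_def\<close>)
      also have "\<dots> \<le> 2 * q + 3 * (2 * (c * q)) + 24 * M^2 * exp 8 * q"
        using ** c by (intro add_mono mult_left_mono) (auto simp: L_def q_def)
      also have "\<dots> \<le> ?C * q" using c q0 by (simp add: algebra_simps)
      finally show ?thesis .
    next
      case False
      have "\<bar>upper_sum i - expansion (1 - 2 * \<theta>) z\<bar> \<le> tail_const M 2 * exp (- 2 * \<bar>z\<bar>)"
        by (rule expansion_error_tail) (use \<theta> in \<open>auto simp: z_def\<close>)
      also have "\<dots> \<le> tail_const M 2 * exp (- 2 * (L - 1))"
        using False by (intro mult_left_mono) (auto simp: tail_const_def)
      also have "\<dots> \<le> c * q" by (rule expL)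
      also have "\<dots> \<le> ?C * q" using c q0 by (intro mult_right_mono) auto
      finally show ?thesis .
    qed
    then show "\<bar>upper_sum i - expansion (1 - 2 * \<theta>) (node (real_of_int i) - 2 * \<theta> * (1 / sqrt n))\<bar> \<le> ?C * real n powr (-11/8)"
      by (simp add: z_def q_def)
  qed
qed

lemma expansion_error_weighted:
  assumes "1 \<le> M" "0 \<le> K"
  shows "\<exists>C>0. \<forall>\<^sub>F n in sequentially. \<forall>p \<rho> \<rho>0 b i \<theta> z. tilted_binomial n p \<rho> \<rho>0 b M (1 / sqrt n) \<longrightarrow> 0 \<le> \<theta> \<longrightarrow> \<theta> \<le> 1 \<longrightarrow>
     z = std_node n \<rho>0 (real_of_int i) - 2 * \<theta> * (1 / sqrt n) \<longrightarrow>
     \<bar>tilted_binomial.upper_sum n p i - tilted_binomial.expansion \<rho>0 b (1 / sqrt n) (1 - 2 * \<theta>) z\<bar> 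
       \<le> C * real n powr (-5/4) * exp (- K * \<bar>z\<bar>)"
proof -
  obtain C where C: "C > 0" and ev: "\<forall>\<^sub>F n in sequentially. \<forall>p \<rho> \<rho>0 b i \<theta>. tilted_binomial n p \<rho> \<rho>0 b M (1 / sqrt n) \<longrightarrow> 0 \<le> \<theta> \<longrightarrow> \<theta> \<le> 1 \<longrightarrow>
     \<bar>tilted_binomial.upper_sum n p i - tilted_binomial.expansion \<rho>0 b (1 / sqrt n) (1 - 2 * \<theta>) 
         (std_node n \<rho>0 (real_of_int i) - 2 * \<theta> * (1 / sqrt n))\<bar> \<le> C * real n powr (-11/8)"
    using expansion_error_uniform[OF assms(1)] by blast
  define T where "T = tail_const M (11 * K)"
  have T: "0 < T" unfolding T_def tail_const_def by (intro add_pos_nonneg) auto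
  show ?thesis
  proof (rule exI[of _ "C powr (10/11) * T powr (1/11)"], intro conjI)
    show "0 < C powr (10/11) * T powr (1/11)" using C T by simp
    from ev show "\<forall>\<^sub>F n in sequentially. \<forall>p \<rho> \<rho>0 b i \<theta> z. tilted_binomial n p \<rho> \<rho>0 b M (1 / sqrt n) \<longrightarrow> 0 \<le> \<theta> \<longrightarrow> \<theta> \<le> 1 \<longrightarrow>
       z = std_node n \<rho>0 (real_of_int i) - 2 * \<theta> * (1 / sqrt n) \<longrightarrow>
       \<bar>tilted_binomial.upper_sum n p i - tilted_binomial.expansion \<rho>0 b (1 / sqrt n) (1 - 2 * \<theta>) z\<bar> 
         \<le> C powr (10/11) * T powr (1/11) * real n powr (-5/4) * exp (- K * \<bar>z\<bar>)"
    proof (eventually_elim, intro allI impI)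
      fix n p \<rho> \<rho>0 b i and \<theta> z :: real
      assume bd: "\<forall>p \<rho> \<rho>0 b i \<theta>. tilted_binomial n p \<rho> \<rho>0 b M (1 / sqrt n) \<longrightarrow> 0 \<le> \<theta> \<longrightarrow> \<theta> \<le> 1 \<longrightarrow>
         \<bar>tilted_binomial.upper_sum n p i - tilted_binomial.expansion \<rho>0 b (1 / sqrt n) (1 - 2 * \<theta>) 
         (std_node n \<rho>0 (real_of_int i) - 2 * \<theta> * (1 / sqrt n))\<bar> \<le> C * real n powr (-11/8)"
      assume tb: "tilted_binomial n p \<rho> \<rho>0 b M (1 / sqrt n)" and \<theta>: "0 \<le> \<theta>" "\<theta> \<le> 1"
        and z: "z = std_node n \<rho>0 (real_of_int i) - 2 * \<theta> * (1 / sqrt n)"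
      interpret tilted_binomial n p \<rho> \<rho>0 b M "1 / sqrt n" by (rule tb)
      define x where "x = \<bar>upper_sum i - expansion (1 - 2 * \<theta>) z\<bar>"
      have "x \<le> C * real n powr (-11/8)" using bd tb \<theta> unfolding x_def z by blast
      moreover have "x \<le> T * exp (- (11 * K) * \<bar>z\<bar>)"
        unfolding x_def T_def using assms \<theta> z by (intro expansion_error_tail) auto
      ultimately have "x \<le> (C * real n powr (-11/8)) powr (10/11) * (T * exp (- (11 * K) * \<bar>z\<bar>)) powr (1 - 10/11)"
        by (intro powr_interpolate_le) (auto simp: x_def)
      also have "\<dots> = C powr (10/11) * T powr (1/11) * real n powr (-5/4) * exp (- K * \<bar>z\<bar>)"
      proof -
        have "exp (- (11 * K) * \<bar>z\<bar>) powr (1/11) = exp (- K * \<bar>z\<bar>)" by (simp add: powr_def)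
        then show ?thesis using C T by (simp add: powr_mult powr_powr)
      qed
      finally show "\<bar>upper_sum i - expansion (1 - 2 * \<theta>) z\<bar> \<le> C powr (10/11) * T powr (1/11) * real n powr (-5/4) * exp (- K * \<bar>z\<bar>)"
        unfolding x_def .
    qed
  qed
qed

subsection \<open>The generalised binomial model\<close>

text \<open>By exp x - exp y = 2 exp ((x+y)/2) sinh ((x-y)/2) the odds factor into exp
  (-\<epsilon>), a/b and a quotient of values of sinh x / x. Half the logarithm of a/b is artanh (m
  \<epsilon>), and the sinh terms contribute (a^2 - b^2)/12 = m \<epsilon>^3/12.\<close>

lemma half_log_odds_expansion:
  fixes m \<epsilon> K :: real
  assumes m: "\<bar>m\<bar> \<le> K" and K: "1 \<le> K" and \<epsilon>: "0 < \<epsilon>" "K * \<epsilon> \<le> 1/2"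
  defines "odds \<equiv> (exp (m * \<epsilon>^2) - exp (- \<epsilon>)) / (exp \<epsilon> - exp (m * \<epsilon>^2))"
  shows "\<bar>ln odds / 2 - (\<epsilon> * (m - 1/2) + \<epsilon>^3 * (m^3/3 + m/12))\<bar> \<le> 4 * K^5 * \<epsilon>^4"
    and "exp (- \<epsilon>) < exp (m * \<epsilon>^2)" and "exp (m * \<epsilon>^2) < exp \<epsilon>"
proof -
  define S where "S = (\<lambda>x::real. ln (sinh x / x))"
  define a b where "a = (\<epsilon> + m * \<epsilon>^2) / 2" and "b = (\<epsilon> - m * \<epsilon>^2) / 2"
  have "1 * \<epsilon> \<le> K * \<epsilon>" using K \<epsilon> by (intro mult_right_mono) auto
  then have \<epsilon>1: "\<epsilon> \<le> 1/2" using \<epsilon>(2) by linarith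
  have m\<epsilon>: "\<bar>m * \<epsilon>\<bar> \<le> K * \<epsilon>" using m \<epsilon> by (intro abs_mult_le_mult) auto
  have "\<bar>(m * \<epsilon>) * \<epsilon>\<bar> \<le> 1/2 * \<epsilon>" using m\<epsilon> \<epsilon> by (intro abs_mult_le_mult) auto
  then have m\<epsilon>2: "\<bar>m * \<epsilon>^2\<bar> \<le> \<epsilon> / 2" by (simp add: power2_eq_square mult.assoc)
  have a: "0 < a" "a \<le> \<epsilon>" "a \<le> 1/2" and b: "0 < b" "b \<le> \<epsilon>" "b \<le> 1/2"
    using m\<epsilon>2 \<epsilon> \<epsilon>1 by (auto simp: a_def b_def)
  show "exp (- \<epsilon>) < exp (m * \<epsilon>^2)" and "exp (m * \<epsilon>^2) < exp \<epsilon>" using m\<epsilon>2 \<epsilon> by auto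
  have sinh2: "exp x - exp y = 2 * exp ((x + y) / 2) * sinh ((x - y) / 2)" for x y :: real
  proof -
    have "exp x = exp ((x + y) / 2) * exp ((x - y) / 2)" "exp y = exp ((x + y) / 2) * exp (- ((x - y) / 2))"
      by (simp_all add: exp_add[symmetric] field_simps)
    then show ?thesis by (simp add: sinh_field_def algebra_simps)
  qed
  have ab: "a / b = (1 + m * \<epsilon>) / (1 - m * \<epsilon>)"
  proof -
    have eqs: "a = \<epsilon> / 2 * (1 + m * \<epsilon>)" "b = \<epsilon> / 2 * (1 - m * \<epsilon>)"
      by (simp_all add: a_def b_def algebra_simps power2_eq_square)
    show ?thesis unfolding eqs by (rule mult_divide_mult_cancel_left) (use \<epsilon> in simp)
  qed
  have "odds = (2 * exp ((m * \<epsilon>^2 - \<epsilon>) / 2) * sinh a) / (2 * exp ((\<epsilon> + m * \<epsilon>^2) / 2) * sinh b)"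
    unfolding odds_def sinh2 a_def b_def by (simp add: add.commute)
  also have "\<dots> = exp ((m * \<epsilon>^2 - \<epsilon>) / 2) / exp ((\<epsilon> + m * \<epsilon>^2) / 2) * (sinh a / sinh b)" by simp
  also have "exp ((m * \<epsilon>^2 - \<epsilon>) / 2) / exp ((\<epsilon> + m * \<epsilon>^2) / 2) = exp (- \<epsilon>)"
    by (simp add: exp_diff[symmetric] field_simps)
  also have "sinh a / sinh b = (a / b) * ((sinh a / a) / (sinh b / b))"
    using a b by simp
  finally have odds: "odds = exp (- \<epsilon>) * ((a / b) * ((sinh a / a) / (sinh b / b)))" .
  have "ln odds = - \<epsilon> + (ln (a / b) + (S a - S b))"
    unfolding odds S_def using a b by (simp add: ln_mult ln_div)
  also have "ln (a / b) = 2 * artanh (m * \<epsilon>)" unfolding ab artanh_def by simp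
  finally have ln_odds: "ln odds = - \<epsilon> + (2 * artanh (m * \<epsilon>) + (S a - S b))" .
  have main: "ln odds / 2 - (\<epsilon> * (m - 1/2) + \<epsilon>^3 * (m^3/3 + m/12))
     = (artanh (m * \<epsilon>) - (m * \<epsilon> + (m * \<epsilon>)^3/3)) + ((S a - a^2/6) - (S b - b^2/6)) / 2"
  proof -
    have "a^2 - b^2 = m * \<epsilon>^3" by (simp add: a_def b_def field_simps power_numeral_reduce)
    then have "a^2 = b^2 + m * \<epsilon>^3" by simp
    then show ?thesis using ln_odds
      by (simp add: field_simps power_mult_distrib)
  qed
  have "\<bar>artanh (m * \<epsilon>) - (m * \<epsilon> + (m * \<epsilon>)^3/3)\<bar> \<le> 2 * \<bar>m * \<epsilon>\<bar>^5"
    using m\<epsilon> \<epsilon> by (intro artanh_cubic_bound) auto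
  also have "2 * \<bar>m * \<epsilon>\<bar>^5 \<le> 2 * (K * \<epsilon>)^5" using m\<epsilon> by (intro mult_left_mono power_mono) auto
  also have "2 * (K * \<epsilon>)^5 \<le> K^5 * \<epsilon>^4"
  proof -
    have "2 * (K * \<epsilon>)^5 = (K^5 * \<epsilon>^4) * (2 * \<epsilon>)" by (simp add: power_mult_distrib power_numeral_reduce)
    also have "\<dots> \<le> (K^5 * \<epsilon>^4) * 1" using \<epsilon>1 K \<epsilon> by (intro mult_left_mono) auto
    finally show ?thesis by simp
  qed
  finally have A: "\<bar>artanh (m * \<epsilon>) - (m * \<epsilon> + (m * \<epsilon>)^3/3)\<bar> \<le> K^5 * \<epsilon>^4" .
  have Sa: "\<bar>S a - a^2/6\<bar> \<le> 2 * \<epsilon>^4"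
  proof -
    have "\<bar>S a - a^2/6\<bar> \<le> 2 * a^4" unfolding S_def using a by (intro ln_sinh_over_bound) auto
    also have "\<dots> \<le> 2 * \<epsilon>^4" using a by (intro mult_left_mono power_mono) auto
    finally show ?thesis .
  qed
  have Sb: "\<bar>S b - b^2/6\<bar> \<le> 2 * \<epsilon>^4"
  proof -
    have "\<bar>S b - b^2/6\<bar> \<le> 2 * b^4" unfolding S_def using b by (intro ln_sinh_over_bound) auto
    also have "\<dots> \<le> 2 * \<epsilon>^4" using b by (intro mult_left_mono power_mono) auto
    finally show ?thesis .
  qed
  have E: "\<epsilon>^4 \<le> K^5 * \<epsilon>^4" using K one_le_power[of K 5] \<epsilon> by simp
  have "\<bar>x + (y - w) / 2\<bar> \<le> 4 * Q" if "\<bar>x\<bar> \<le> Q" "\<bar>y\<bar> \<le> 2 * E" "\<bar>w\<bar> \<le> 2 * E" "E \<le> Q" for x y w Q E :: real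
    using that unfolding diff_divide_distrib by linarith
  from this[OF A Sa Sb E] show "\<bar>ln odds / 2 - (\<epsilon> * (m - 1/2) + \<epsilon>^3 * (m^3/3 + m/12))\<bar> \<le> 4 * K^5 * \<epsilon>^4"
    unfolding main by (simp only: mult.assoc)
qed

locale binomial_model =
  fixes S0 \<sigma> r T :: real and lam :: "nat \<Rightarrow> real"
  assumes S0: "S0 > 0" and \<sigma>: "\<sigma> > 0" and T: "T > 0" and lam: "Bseq lam"
begin

definition vol :: real where "vol = \<sigma> * sqrt T"

text \<open>The growth rate relative to the centre line of the tree, in units of \<sigma>^2. In
  these units the common factor of \<open>up_factor\<close> and \<open>down_factor\<close> drops out
  of \<open>prob_up\<close>.\<close>

definition drift :: "nat \<Rightarrow> real" where "drift n = (r - lam n * \<sigma>^2) / \<sigma>^2"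

definition shift :: "nat \<Rightarrow> real" where "shift n = vol * (drift n - 1/2)"

text \<open>The first summand is the 1/n coefficient of \<open>tilt n\<close>. The others are chosen
  so that b - \<rho>0/3 + \<rho>0^3/3, as required in \<open>tilted_binomial\<close>, equals
  it.\<close>

definition coef :: "nat \<Rightarrow> real" where
  "coef n = vol^3 * ((drift n)^3/3 + drift n/12) + shift n/3 - (shift n)^3/3"

abbreviation prob_up :: "nat \<Rightarrow> real" where
  "prob_up n \<equiv> risk_neutral_prob \<sigma> r T lam n"

definition tilt :: "nat \<Rightarrow> real" where
  "tilt n = sqrt (real n) * (ln (prob_up n / (1 - prob_up n)) / 2)"

text \<open>The strike in the standard normal coordinate: for a > 0 the Black-Scholes price is at
  least a exactly when the normal variable is at least \<open>z_of a\<close>.\<close>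

definition z_of :: "real \<Rightarrow> real" where "z_of a = - d2 S0 \<sigma> r T a"

lemma vol_pos: "0 < vol" using \<sigma> T by (simp add: vol_def)

lemma vol_sq: "vol^2 = \<sigma>^2 * T" using T by (simp add: vol_def power_mult_distrib)

lemma drift_bounded: obtains K where "1 \<le> K" "\<And>n. \<bar>drift n\<bar> \<le> K"
proof -
  obtain K0 where K0: "\<And>n. \<bar>lam n\<bar> \<le> K0" using lam unfolding Bseq_def by auto
  have "\<bar>drift n\<bar> \<le> 1 + \<bar>r\<bar> / \<sigma>^2 + K0" for n
  proof -
    have "drift n = r / \<sigma>^2 - lam n" using \<sigma> by (simp add: drift_def field_simps)
    moreover have "\<bar>r / \<sigma>^2\<bar> = \<bar>r\<bar> / \<sigma>^2" by (simp add: abs_divide)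
    ultimately show ?thesis using K0[of n] by linarith
  qed
  moreover have "1 \<le> 1 + \<bar>r\<bar> / \<sigma>^2 + K0" using K0[of 0] by (simp add: add_nonneg_nonneg order_trans[OF abs_ge_zero])
  ultimately show ?thesis using that by blast
qed

lemma steps:
  assumes "n \<ge> 1"
  defines "\<epsilon> \<equiv> vol / sqrt n"
  shows "up_factor \<sigma> T lam n = exp (\<epsilon> + lam n * \<sigma>^2 * (T / n))"
    and "down_factor \<sigma> T lam n = exp (- \<epsilon> + lam n * \<sigma>^2 * (T / n))"
    and "r * (T / n) = drift n * \<epsilon>^2 + lam n * \<sigma>^2 * (T / n)"
proof -
  have e: "\<sigma> * sqrt (T / n) = \<epsilon>" by (simp add: \<epsilon>_def vol_def real_sqrt_divide)
  show "up_factor \<sigma> T lam n = exp (\<epsilon> + lam n * \<sigma>^2 * (T / n))"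
    unfolding up_factor_def e ..
  show "down_factor \<sigma> T lam n = exp (- \<epsilon> + lam n * \<sigma>^2 * (T / n))"
    unfolding down_factor_def mult_minus_left e ..
  have "\<epsilon>^2 = \<sigma>^2 * (T / n)" by (simp add: \<epsilon>_def power_divide vol_sq)
  then have "drift n * \<epsilon>^2 = (r - lam n * \<sigma>^2) * (T / n)" using \<sigma> by (simp add: drift_def)
  then show "r * (T / n) = drift n * \<epsilon>^2 + lam n * \<sigma>^2 * (T / n)"
    by (simp only: left_diff_distrib diff_add_cancel)
qed

lemma prob_up_eq:
  assumes "n \<ge> 1"
  defines "\<epsilon> \<equiv> vol / sqrt n"
  shows "prob_up n = (exp (drift n * \<epsilon>^2) - exp (- \<epsilon>)) / (exp \<epsilon> - exp (- \<epsilon>))"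
proof -
  have "prob_up n = (exp (lam n * \<sigma>^2 * (T / n)) * (exp (drift n * \<epsilon>^2) - exp (- \<epsilon>))) / (exp (lam n * \<sigma>^2 * (T / n)) * (exp \<epsilon> - exp (- \<epsilon>)))"
    unfolding risk_neutral_prob_def steps[OF assms(1), folded \<epsilon>_def] exp_add by (simp only: algebra_simps)
  then show ?thesis by simp
qed

text \<open>In \<open>M\<close>, the terms R and R^3 dominate \<open>shift n\<close> and its cube,
  while Q dominates the cubic term of the log-odds and the constant of its remainder.\<close>

lemma tilted_binomial_model:
  "\<exists>M\<ge>1. (\<forall>n. \<bar>shift n\<bar> \<le> M) \<and> (\<forall>n. \<bar>coef n\<bar> \<le> M) \<and>
     (\<forall>\<^sub>F n in sequentially. tilted_binomial n (prob_up n) (tilt n) (shift n) (coef n) M (1 / sqrt n))"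
proof -
  obtain K where K: "1 \<le> K" "\<And>n. \<bar>drift n\<bar> \<le> K" using drift_bounded by blast
  define R where "R = vol * (K + 1)"
  define Q where "Q = vol^3 * K^3 + 4 * K^5 * vol^4"
  define M where "M = 1 + R + R^3 + Q"
  have R0: "0 \<le> R" using vol_pos K by (simp add: R_def)
  have Q0: "vol^3 * K^3 \<le> Q" "4 * K^5 * vol^4 \<le> Q" "0 \<le> Q" using vol_pos K by (auto simp: Q_def)
  have M1: "1 \<le> M" using R0 Q0 by (simp add: M_def)
  have sh: "\<bar>shift n\<bar> \<le> R" for n
    unfolding shift_def R_def using vol_pos K(2)[of n] by (intro abs_mult_le_mult) auto
  have cf: "\<bar>vol^3 * ((drift n)^3/3 + drift n/12)\<bar> \<le> vol^3 * K^3" for n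
  proof (intro abs_mult_le_mult)
    have "\<bar>(drift n)^3\<bar> \<le> K^3" "\<bar>drift n\<bar> \<le> K" using K(2)[of n] by (auto intro: abs_power_le_power)
    moreover have "K \<le> K^3" using K power_increasing[of 1 3 K] by simp
    ultimately show "\<bar>(drift n)^3/3 + drift n/12\<bar> \<le> K^3" by linarith
  qed (use vol_pos in simp)
  have R3: "0 \<le> R^3" using R0 by simp
  have shM: "\<bar>shift n\<bar> \<le> M" for n using sh[of n] R3 Q0 unfolding M_def by linarith
  have cfM: "\<bar>coef n\<bar> \<le> M" for n 
    using cf[of n] sh[of n] abs_power_le_power[OF sh, of n 3] R0 R3 Q0 unfolding coef_def M_def by linarith
  have "\<forall>\<^sub>F n in sequentially. K * (vol / sqrt n) \<le> 1/2" by real_asymp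
  moreover have "\<forall>\<^sub>F n::nat in sequentially. 1 \<le> n" by (rule eventually_ge_at_top)
  ultimately have "\<forall>\<^sub>F n in sequentially. tilted_binomial n (prob_up n) (tilt n) (shift n) (coef n) M (1 / sqrt n)"
  proof eventually_elim
    fix n :: nat assume n: "K * (vol / sqrt n) \<le> 1/2" "1 \<le> n"
    define \<epsilon> where "\<epsilon> = vol / sqrt n"
    define e where "e = 1 / sqrt n"
    have e: "0 < e" "e \<le> 1" "e * sqrt n = 1" using n by (auto simp: e_def)
    have \<epsilon>: "0 < \<epsilon>" "K * \<epsilon> \<le> 1/2" "\<epsilon> = vol * e" using n vol_pos by (auto simp: \<epsilon>_def e_def)
    note H = half_log_odds_expansion[OF K(2)[of n] K(1) \<epsilon>(1,2)]
    have pu: "prob_up n = (exp (drift n * \<epsilon>^2) - exp (- \<epsilon>)) / (exp \<epsilon> - exp (- \<epsilon>))"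
      unfolding \<epsilon>_def by (rule prob_up_eq) (rule n)
    have pd: "1 - prob_up n = (exp \<epsilon> - exp (drift n * \<epsilon>^2)) / (exp \<epsilon> - exp (- \<epsilon>))"
      unfolding pu using H by (simp add: field_simps)
    have p: "0 < prob_up n" "0 < 1 - prob_up n" unfolding pu pd using H by auto
    have odds: "prob_up n / (1 - prob_up n) = (exp (drift n * \<epsilon>^2) - exp (- \<epsilon>)) / (exp \<epsilon> - exp (drift n * \<epsilon>^2))"
      unfolding pd using H by (simp add: pu)
    have "tilt n * e = (sqrt (real n) * e) * (ln (prob_up n / (1 - prob_up n)) / 2)"
      by (simp add: tilt_def mult_ac)
    then have te: "tilt n * e = ln (prob_up n / (1 - prob_up n)) / 2"
      using e(3) by (simp add: mult.commute)
    have shn: "shift n * e = \<epsilon> * (drift n - 1/2)" by (simp add: shift_def \<epsilon>(3))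
    \<comment> \<open>Multiplied by e, the approximation required of \<rho> becomes the expansion of
      the half log-odds, term by term.\<close>
    have "(coef n - shift n/3 + (shift n)^3/3) * e^2 * e = \<epsilon>^3 * ((drift n)^3/3 + drift n/12)"
      by (simp add: coef_def \<epsilon>(3) power_mult_distrib power_numeral_reduce)
    then have "(tilt n - shift n - (coef n - shift n/3 + (shift n)^3/3) * e^2) * e 
       = ln (prob_up n / (1 - prob_up n)) / 2 - (\<epsilon> * (drift n - 1/2) + \<epsilon>^3 * ((drift n)^3/3 + drift n/12))"
      using te shn by (simp only: left_diff_distrib) 
    then have "\<bar>(tilt n - shift n - (coef n - shift n/3 + (shift n)^3/3) * e^2) * e\<bar> \<le> 4 * K^5 * \<epsilon>^4"
      using H(1) unfolding odds by simp
    also have "4 * K^5 * \<epsilon>^4 = (4 * K^5 * vol^4 * e^3) * e"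
      by (simp add: \<epsilon>(3) power_mult_distrib power_numeral_reduce)
    finally have ap: "\<bar>tilt n - shift n - (coef n - shift n/3 + (shift n)^3/3) * e^2\<bar> \<le> 4 * K^5 * vol^4 * e^3"
      using e by (simp only: abs_mult abs_of_pos mult_le_cancel_right_pos)
    have QM: "4 * K^5 * vol^4 \<le> M" using Q0 R0 by (simp add: M_def add_nonneg_nonneg add_increasing)
    show "tilted_binomial n (prob_up n) (tilt n) (shift n) (coef n) M (1 / sqrt n)"
      unfolding e_def[symmetric]
    proof
      show "0 < n" using n by simp
      show "0 < prob_up n" "prob_up n < 1" using p by auto
      show "prob_up n / (1 - prob_up n) = exp (2 * (tilt n * e))" unfolding te using p by simp
      show "1 \<le> M" by (rule M1)
      show "\<bar>shift n\<bar> \<le> M" "\<bar>coef n\<bar> \<le> M" by (rule shM cfM)+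
      show "\<bar>tilt n - shift n - (coef n - shift n/3 + (shift n)^3/3) * e^2\<bar> \<le> M * e^3"
        using e by (intro order_trans[OF ap] mult_right_mono QM) auto
      show "e = 1 / sqrt n" by (rule e_def)
      have "coef n - shift n/3 + (shift n)^3/3 = vol^3 * ((drift n)^3/3 + drift n/12)" by (simp add: coef_def)
      then have "\<bar>(coef n - shift n/3 + (shift n)^3/3) * e^2\<bar> \<le> (vol^3 * K^3) * 1"
        using cf[of n] e by (intro abs_mult_le_mult) (auto simp: power_le_one)
      moreover have "4 * K^5 * vol^4 * e^3 \<le> 4 * K^5 * vol^4 * 1"
        using e K vol_pos by (intro mult_left_mono) (auto simp: power_le_one)
      ultimately show "\<bar>tilt n\<bar> \<le> M" using ap sh[of n] R3 unfolding M_def Q_def by linarith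
    qed
  qed
  then show ?thesis using M1 shM cfM by blast
qed

lemma z_of_eq: "0 < a \<Longrightarrow> z_of a = (ln a - (ln S0 + (r - \<sigma>^2/2) * T)) / vol"
proof -
  assume a: "0 < a"
  have "\<sigma> * sqrt T = vol^2 / vol" using vol_pos by (simp add: vol_def power2_eq_square)
  then have "z_of a = (vol^2 - (ln (S0 / a) + (r + \<sigma>\<^sup>2 / 2) * T)) / vol"
    unfolding z_of_def d2_def d1_def vol_def[symmetric] using vol_pos by (simp add: diff_divide_distrib)
  also have "\<dots> = (ln a - (ln S0 + (r - \<sigma>^2/2) * T)) / vol"
    using a S0 unfolding vol_sq by (simp add: ln_div algebra_simps)
  finally show ?thesis .
qed

lemma z_of_le_iff: "0 < a \<Longrightarrow> 0 < a' \<Longrightarrow> z_of a \<le> z_of a' \<longleftrightarrow> a \<le> a'"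
  using vol_pos by (simp add: z_of_eq divide_le_cancel)

lemma z_of_less_iff: "0 < a \<Longrightarrow> 0 < a' \<Longrightarrow> z_of a < z_of a' \<longleftrightarrow> a < a'"
  using vol_pos by (simp add: z_of_eq divide_less_cancel)

lemma z_of_BS_stock: "z_of (BS_stock S0 \<sigma> r T z) = z"
  using S0 vol_pos by (simp add: BS_stock_def z_of_eq ln_mult vol_def[symmetric])

lemma BS_stock_pos: "0 < BS_stock S0 \<sigma> r T z"
  using S0 by (simp add: BS_stock_def)

lemma lattice_point_pos: "0 < lattice_point S0 \<sigma> T lam n j"
  using S0 by (simp add: lattice_point_def up_factor_def down_factor_def)

text \<open>The real x with S0 u^x d^(n-x) = a. The fractional part in \<open>Delta_n\<close> is
  taken of -x.\<close>

definition index_of :: "nat \<Rightarrow> real \<Rightarrow> real" where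
  "index_of n a = - ((ln (S0 / a) + real n * ln (down_factor \<sigma> T lam n)) / ln (up_factor \<sigma> T lam n / down_factor \<sigma> T lam n))"

text \<open>Exact for every n \<ge> 1: the position of the tree, which depends on
  \<open>lam n\<close>, cancels against \<open>shift n\<close>.\<close>

lemma node_index_of:
  assumes "n \<ge> 1" "0 < a"
  shows "std_node n (shift n) (index_of n a) = z_of a"
proof -
  define \<epsilon> where "\<epsilon> = vol / sqrt n"
  have n: "sqrt (real n) > 0" using assms by simp
  have \<epsilon>: "\<epsilon> > 0" using vol_pos n by (simp add: \<epsilon>_def)
  have "ln (up_factor \<sigma> T lam n / down_factor \<sigma> T lam n) = 2 * \<epsilon>"
    unfolding steps[OF assms(1), folded \<epsilon>_def] exp_diff[symmetric] by simp
  moreover have "real n * ln (down_factor \<sigma> T lam n) = - real n * \<epsilon> + lam n * \<sigma>^2 * T"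
    unfolding steps[OF assms(1), folded \<epsilon>_def] using assms by (simp add: field_simps)
  moreover have "ln (S0 / a) = ln S0 - ln a" using S0 assms by (simp add: ln_div)
  ultimately have i: "index_of n a = (ln a - ln S0 + real n * \<epsilon> - lam n * \<sigma>^2 * T) / (2 * \<epsilon>)"
    by (simp add: index_of_def minus_divide_left algebra_simps)
  have "2 * index_of n a - real n = (ln a - ln S0 - lam n * \<sigma>^2 * T) / \<epsilon>"
    unfolding i using \<epsilon> by (simp add: field_simps)
  then have "(2 * index_of n a - real n) / sqrt n = (ln a - ln S0 - lam n * \<sigma>^2 * T) / vol"
    using n vol_pos by (simp add: \<epsilon>_def)
  moreover have "shift n = (r * T - lam n * \<sigma>^2 * T - \<sigma>^2 / 2 * T) / vol"
  proof -
    have "shift n * vol = vol^2 * (drift n - 1/2)" by (simp add: shift_def power2_eq_square)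
    also have "\<dots> = r * T - lam n * \<sigma>^2 * T - \<sigma>^2 / 2 * T"
      using \<sigma> unfolding vol_sq drift_def by (simp add: field_simps)
    finally show ?thesis using vol_pos by (simp add: field_simps)
  qed
  ultimately show ?thesis unfolding std_node_def z_of_eq[OF assms(2)]
    by (simp add: diff_divide_distrib[symmetric] algebra_simps)
qed

lemma index_of_lattice_point:
  assumes "n \<ge> 1" "j \<le> n"
  shows "index_of n (lattice_point S0 \<sigma> T lam n j) = real j"
proof -
  define u d where "u = up_factor \<sigma> T lam n" and "d = down_factor \<sigma> T lam n"
  have ud: "0 < u" "0 < d" by (simp_all add: u_def d_def up_factor_def down_factor_def)
  have "ln (u / d) = 2 * (vol / sqrt n)"
    unfolding u_def d_def steps[OF assms(1)] exp_diff[symmetric] by simp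
  then have l: "ln (u / d) \<noteq> 0" using vol_pos assms by simp
  have "ln (S0 / (S0 * u ^ j * d ^ (n - j))) = - (real j * ln u + (real n - real j) * ln d)"
    using S0 ud assms by (simp add: ln_div ln_mult ln_realpow of_nat_diff)
  then have "ln (S0 / (S0 * u ^ j * d ^ (n - j))) + real n * ln d = - real j * ln (u / d)"
    using ud by (simp add: ln_div algebra_simps)
  then show ?thesis unfolding index_of_def lattice_point_def u_def[symmetric] d_def[symmetric]
    using l by simp
qed

lemma std_node_less_iff: "n \<ge> 1 \<Longrightarrow> std_node n \<rho> x < std_node n \<rho> y \<longleftrightarrow> x < y"
  by (simp add: std_node_def divide_less_cancel)

lemma less_lattice_point_iff:
  assumes "n \<ge> 1" "j \<le> n" "0 < a"
  shows "a < lattice_point S0 \<sigma> T lam n j \<longleftrightarrow> index_of n a < real j"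
    and "lattice_point S0 \<sigma> T lam n j < a \<longleftrightarrow> real j < index_of n a"
proof -
  let ?x = "lattice_point S0 \<sigma> T lam n j"
  have z: "z_of a = std_node n (shift n) (index_of n a)" "z_of ?x = std_node n (shift n) (real j)"
    using node_index_of[OF assms(1,3)] node_index_of[OF assms(1) lattice_point_pos, of n j]
      index_of_lattice_point[OF assms(1,2)] by simp_all
  show "a < ?x \<longleftrightarrow> index_of n a < real j"
    unfolding z_of_less_iff[OF assms(3) lattice_point_pos, symmetric] z by (rule std_node_less_iff[OF assms(1)])
  show "?x < a \<longleftrightarrow> real j < index_of n a"
    unfolding z_of_less_iff[OF lattice_point_pos assms(3), symmetric] z by (rule std_node_less_iff[OF assms(1)])
qed

definition prob_ge :: "nat \<Rightarrow> real \<Rightarrow> real" where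
  "prob_ge n a = (\<Sum>j | j \<le> n \<and> a \<le> lattice_point S0 \<sigma> T lam n j. binom_mass n (prob_up n) j)"

definition prob_gt :: "nat \<Rightarrow> real \<Rightarrow> real" where
  "prob_gt n a = (\<Sum>j | j \<le> n \<and> a < lattice_point S0 \<sigma> T lam n j. binom_mass n (prob_up n) j)"

lemma prob_gt_eq_prob_ge: "a \<notin> lattice_points S0 \<sigma> T lam n \<Longrightarrow> prob_gt n a = prob_ge n a"
  unfolding prob_gt_def prob_ge_def lattice_points_def
  by (intro sum.cong Collect_cong) (auto simp: order_le_less)

text \<open>With d1 = d2 + vol both sides become polynomials in d2, \<open>vol\<close> and
  \<open>drift n\<close>.\<close>

lemma tail_poly_eq_B_n: "tail_poly (shift n) (coef n) (z_of a) = B_n S0 \<sigma> r T lam n a"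
proof -
  define y where "y = d2 S0 \<sigma> r T a"
  have d1: "d1 S0 \<sigma> r T a = y + vol" by (simp add: y_def d2_def vol_def)
  have d: "r - lam n * \<sigma>^2 = \<sigma>^2 * drift n" using \<sigma> by (simp add: drift_def)
  have "sqrt T / (6 * \<sigma>) * (r - lam n * \<sigma>^2) = vol * drift n / 6"
    unfolding d vol_def using \<sigma> by (simp add: power2_eq_square)
  then have 1: "(2 - (y + vol) * y - (y + vol)^2) * sqrt T / (6 * \<sigma>) * (r - lam n * \<sigma>^2) 
      = (2 - (y + vol) * y - (y + vol)^2) * (vol * drift n / 6)"
    by (metis times_divide_eq_right mult.assoc)
  have "T / (2 * \<sigma>^2) * (r - lam n * \<sigma>^2)^2 = vol^2 * (drift n)^2 / 2"
    unfolding d vol_sq using \<sigma> by (simp add: power2_eq_square)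
  then have 2: "T * (y + vol) / (2 * \<sigma>^2) * (r - lam n * \<sigma>^2)^2 = (y + vol) * (vol^2 * (drift n)^2 / 2)"
    by (metis times_divide_eq_left mult.assoc mult.commute)
  show ?thesis
    unfolding B_n_def Let_def d1 y_def[symmetric] z_of_def 1 2 
    unfolding tail_poly_def coef_def shift_def
    by (simp add: field_simps power_numeral_reduce)
qed

lemma weight_eq: "weight S0 \<sigma> r T a = exp (- r * T) * std_normal_density (z_of a)"
  by (simp add: weight_def std_normal_density_def z_of_def)

lemma expansion_eq:
  assumes tb: "tilted_binomial n (prob_up n) (tilt n) (shift n) (coef n) M (1 / sqrt n)" and a: "0 < a"
  shows "tilted_binomial.expansion (shift n) (coef n) (1 / sqrt n) (Delta_n S0 \<sigma> T lam n a) (z_of a)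
      = gauss_tail (z_of a) + exp (r * T) * J_n S0 \<sigma> r T lam n a"
    and "tilted_binomial.expansion (shift n) (coef n) (1 / sqrt n) (Delta_n S0 \<sigma> T lam n a - 2) (z_of a)
      = gauss_tail (z_of a) + exp (r * T) * J_hat_n S0 \<sigma> r T lam n a"
proof -
  interpret tilted_binomial n "prob_up n" "tilt n" "shift n" "coef n" M "1 / sqrt n" by (rule tb)
  have e: "exp (r * T) * (exp (- (r * T)) * x) = x" for x :: real
    by (simp add: exp_minus)
  have sq: "(1 / sqrt n)^2 = 1 / real n" by (simp add: power_divide)
  have d2: "d2 S0 \<sigma> r T a = - z_of a" by (simp add: z_of_def)
  show "expansion (Delta_n S0 \<sigma> T lam n a) (z_of a) = gauss_tail (z_of a) + exp (r * T) * J_n S0 \<sigma> r T lam n a"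
    "expansion (Delta_n S0 \<sigma> T lam n a - 2) (z_of a) = gauss_tail (z_of a) + exp (r * T) * J_hat_n S0 \<sigma> r T lam n a"
    using a unfolding expansion_def J_n_def J_hat_n_def weight_eq tail_poly_eq_B_n sq d2
    by (simp_all add: mult.assoc e)
qed

lemma digital_error:
  assumes "0 \<le> K"
  shows "\<exists>C>0. \<forall>\<^sub>F n in sequentially. \<forall>a>0. 
     \<bar>prob_ge n a - (gauss_tail (z_of a) + exp (r * T) * J_n S0 \<sigma> r T lam n a)\<bar> 
        \<le> C * real n powr (-5/4) * exp (- K * \<bar>z_of a\<bar>) \<and>
     (a \<in> lattice_points S0 \<sigma> T lam n \<longrightarrow> 
       \<bar>prob_gt n a - (gauss_tail (z_of a) + exp (r * T) * J_hat_n S0 \<sigma> r T lam n a)\<bar> 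
        \<le> C * real n powr (-5/4) * exp (- K * \<bar>z_of a\<bar>))"
proof -
  obtain M where M: "1 \<le> M" and tb: "\<forall>\<^sub>F n in sequentially. tilted_binomial n (prob_up n) (tilt n) (shift n) (coef n) M (1 / sqrt n)"
    using tilted_binomial_model by blast
  obtain C where "C > 0" and C: "\<forall>\<^sub>F n in sequentially. \<forall>p \<rho> \<rho>0 b i \<theta> z. tilted_binomial n p \<rho> \<rho>0 b M (1 / sqrt n) \<longrightarrow> 0 \<le> \<theta> \<longrightarrow> \<theta> \<le> 1 \<longrightarrow>
     z = std_node n \<rho>0 (real_of_int i) - 2 * \<theta> * (1 / sqrt n) \<longrightarrow>
     \<bar>tilted_binomial.upper_sum n p i - tilted_binomial.expansion \<rho>0 b (1 / sqrt n) (1 - 2 * \<theta>) z\<bar> 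
       \<le> C * real n powr (-5/4) * exp (- K * \<bar>z\<bar>)"
    using expansion_error_weighted[OF M assms] by blast
  have "\<forall>\<^sub>F n::nat in sequentially. 1 \<le> n" by (rule eventually_ge_at_top)
  with tb C have "\<forall>\<^sub>F n in sequentially. \<forall>a>0. 
     \<bar>prob_ge n a - (gauss_tail (z_of a) + exp (r * T) * J_n S0 \<sigma> r T lam n a)\<bar> 
        \<le> C * real n powr (-5/4) * exp (- K * \<bar>z_of a\<bar>) \<and>
     (a \<in> lattice_points S0 \<sigma> T lam n \<longrightarrow> 
       \<bar>prob_gt n a - (gauss_tail (z_of a) + exp (r * T) * J_hat_n S0 \<sigma> r T lam n a)\<bar> 
        \<le> C * real n powr (-5/4) * exp (- K * \<bar>z_of a\<bar>))"
  proof (eventually_elim, intro allI impI)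
    fix n :: nat and a :: real
    assume tb: "tilted_binomial n (prob_up n) (tilt n) (shift n) (coef n) M (1 / sqrt n)"
      and bd: "\<forall>p \<rho> \<rho>0 b i \<theta> z. tilted_binomial n p \<rho> \<rho>0 b M (1 / sqrt n) \<longrightarrow> 0 \<le> \<theta> \<longrightarrow> \<theta> \<le> 1 \<longrightarrow>
         z = std_node n \<rho>0 (real_of_int i) - 2 * \<theta> * (1 / sqrt n) \<longrightarrow>
         \<bar>tilted_binomial.upper_sum n p i - tilted_binomial.expansion \<rho>0 b (1 / sqrt n) (1 - 2 * \<theta>) z\<bar> 
           \<le> C * real n powr (-5/4) * exp (- K * \<bar>z\<bar>)"
      and n1: "1 \<le> n" and a: "0 < a"
    interpret tilted_binomial n "prob_up n" "tilt n" "shift n" "coef n" M "1 / sqrt n" by (rule tb)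
    note bd' = bd[rule_format, OF tb]
    define x where "x = index_of n a"
    \<comment> \<open>The distance from x up to the next integer: the first index whose price
      reaches a is x + \<theta>.\<close>
    define \<theta> where "\<theta> = frac (- x)"
    have \<theta>: "0 \<le> \<theta>" "\<theta> \<le> 1" by (auto simp: \<theta>_def frac_ge_0 frac_lt_1 less_imp_le)
    have \<Delta>: "Delta_n S0 \<sigma> T lam n a = 1 - 2 * \<theta>"
      by (simp add: Delta_n_def \<theta>_def x_def index_of_def)
    have cx: "x = real_of_int (- \<lfloor>- x\<rfloor>) - \<theta>" by (simp add: \<theta>_def frac_def)
    have "z_of a = node x" using node_index_of[OF n1 a] by (simp add: x_def)
    also have "\<dots> = node (real_of_int (- \<lfloor>- x\<rfloor>)) - 2 * \<theta> * (1 / sqrt n)"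
    proof -
      have "real_of_int (- \<lfloor>- x\<rfloor>) - x = \<theta>" using cx by simp
      then have "node (real_of_int (- \<lfloor>- x\<rfloor>)) - node x = 2 * (1 / sqrt n) * \<theta>" by (simp only: node_diff)
      then show ?thesis by (simp add: algebra_simps)
    qed
    finally have z: "z_of a = node (real_of_int (- \<lfloor>- x\<rfloor>)) - 2 * \<theta> * (1 / sqrt n)" .
    have "prob_ge n a = upper_sum (- \<lfloor>- x\<rfloor>)"
      unfolding prob_ge_def upper_sum_def
    proof (intro sum.cong Collect_cong refl)
      fix j
      have "a \<le> lattice_point S0 \<sigma> T lam n j \<longleftrightarrow> x \<le> real j" if "j \<le> n"
        using less_lattice_point_iff(2)[OF n1 that a] unfolding x_def by (meson linorder_not_less)
      moreover have "x \<le> real j \<longleftrightarrow> - \<lfloor>- x\<rfloor> \<le> int j"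
        by (metis ceiling_def ceiling_le_iff of_int_of_nat_eq)
      ultimately show "j \<le> n \<and> a \<le> lattice_point S0 \<sigma> T lam n j \<longleftrightarrow> j \<le> n \<and> - \<lfloor>- x\<rfloor> \<le> int j"
        by blast
    qed
    then have ge: "\<bar>prob_ge n a - (gauss_tail (z_of a) + exp (r * T) * J_n S0 \<sigma> r T lam n a)\<bar> 
        \<le> C * real n powr (-5/4) * exp (- K * \<bar>z_of a\<bar>)"
      using bd'[OF \<theta> z] unfolding expansion_eq(1)[OF tb a, symmetric] \<Delta> by simp
    have gt: "\<bar>prob_gt n a - (gauss_tail (z_of a) + exp (r * T) * J_hat_n S0 \<sigma> r T lam n a)\<bar> 
        \<le> C * real n powr (-5/4) * exp (- K * \<bar>z_of a\<bar>)" if lat: "a \<in> lattice_points S0 \<sigma> T lam n"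
    proof -
      obtain k where k: "k \<le> n" "a = lattice_point S0 \<sigma> T lam n k" using lat by (auto simp: lattice_points_def)
      have xk: "x = real k" using index_of_lattice_point[OF n1 k(1)] k(2) by (simp add: x_def)
      then have "\<theta> = 0" by (simp add: \<theta>_def)
      then have \<Delta>': "Delta_n S0 \<sigma> T lam n a - 2 = 1 - 2 * 1" using \<Delta> by simp
      have "node (real_of_int (int k + 1)) = node (real k) + 2 * (1 / sqrt n)" 
        using node_diff[of "real k + 1" "real k"] by (simp add: algebra_simps)
      then have z1: "z_of a = node (real_of_int (int k + 1)) - 2 * 1 * (1 / sqrt n)"
        using node_index_of[OF n1 a] xk by (simp add: x_def)
      have "prob_gt n a = upper_sum (int k + 1)"
        unfolding prob_gt_def upper_sum_def
      proof (intro sum.cong Collect_cong refl)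
        fix j
        have "a < lattice_point S0 \<sigma> T lam n j \<longleftrightarrow> real k < real j" if "j \<le> n"
          using less_lattice_point_iff(1)[OF n1 that a] xk unfolding x_def by simp
        then show "j \<le> n \<and> a < lattice_point S0 \<sigma> T lam n j \<longleftrightarrow> j \<le> n \<and> int k + 1 \<le> int j"
          by auto
      qed
      then show ?thesis
        using bd'[OF zero_le_one order_refl z1] unfolding expansion_eq(2)[OF tb a, symmetric] \<Delta>' by simp
    qed
    show "\<bar>prob_ge n a - (gauss_tail (z_of a) + exp (r * T) * J_n S0 \<sigma> r T lam n a)\<bar> 
        \<le> C * real n powr (-5/4) * exp (- K * \<bar>z_of a\<bar>) \<and>
     (a \<in> lattice_points S0 \<sigma> T lam n \<longrightarrow> 
       \<bar>prob_gt n a - (gauss_tail (z_of a) + exp (r * T) * J_hat_n S0 \<sigma> r T lam n a)\<bar> 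
        \<le> C * real n powr (-5/4) * exp (- K * \<bar>z_of a\<bar>))"
      using ge gt by blast
  qed
  then show ?thesis using \<open>C > 0\<close> by blast
qed

end

subsection \<open>Piecewise smooth payoffs\<close>

locale payoff =
  fixes f :: "real \<Rightarrow> real" and S :: "real set" and c1 c2 q :: real
  assumes fin: "finite S" and S_pos: "S \<subseteq> {0<..}"
    and C1: "f C1_differentiable_on ({0<..} - S)"
    and right_lim: "\<And>s. s \<in> insert 0 S \<Longrightarrow> \<exists>L. (f \<longlongrightarrow> L) (at_right s)"
    and left_lim: "\<And>s. s \<in> S \<Longrightarrow> \<exists>L. (f \<longlongrightarrow> L) (at_left s)"
    and c: "0 < c1" "0 < c2" "0 < q"
    and poly: "\<And>a D. 0 \<le> a \<Longrightarrow> (f has_real_derivative D) (at a within {0..}) \<Longrightarrow> \<bar>D\<bar> \<le> c1 + c2 * a powr q"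
begin

text \<open>Zero on S, where \<open>deriv f\<close> may be an unspecified number, and on the
  nonpositive axis, so that integrals can run over the whole line.\<close>

definition slope :: "real \<Rightarrow> real" where
  "slope a = indicator ({0<..} - S) a * deriv f a"

text \<open>The left jump counts from s on and the right jump only beyond s, so that in expectation
  they pair with the probabilities of \<ge> s and > s.\<close>

definition step :: "real \<Rightarrow> real \<Rightarrow> real" where
  "step s x = left_jump f s * indicator {s..} x + right_jump f s * indicator {s<..} x"

text \<open>Prices are positive, so f is anchored at its right limit at 0.\<close>

definition start :: real where "start = Lim (at_right 0) f"

lemma open_regular: "open ({0<..} - S)"
  using fin by (simp add: finite_imp_closed open_Diff)

lemma has_deriv:
  assumes "0 < x" "x \<notin> S" shows "(f has_real_derivative deriv f x) (at x)"
proof -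
  obtain D where "\<forall>x\<in>{0<..} - S. (f has_vector_derivative D x) (at x)"
    using C1 unfolding C1_differentiable_on_def by blast
  then have "(f has_real_derivative D x) (at x)"
    using assms by (simp add: has_real_derivative_iff_has_vector_derivative)
  then show ?thesis using DERIV_imp_deriv by metis
qed

lemma continuous_on_deriv: "continuous_on ({0<..} - S) (deriv f)"
proof -
  obtain D where D: "\<forall>x\<in>{0<..} - S. (f has_vector_derivative D x) (at x)" "continuous_on ({0<..} - S) D"
    using C1 unfolding C1_differentiable_on_def by blast
  have "deriv f x = D x" if "x \<in> {0<..} - S" for x
    using D(1) that by (intro DERIV_imp_deriv) (simp add: has_real_derivative_iff_has_vector_derivative)
  then show ?thesis using D(2) by (subst continuous_on_cong[OF refl]) auto
qed

lemma slope_measurable [measurable]: "slope \<in> borel_measurable borel"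
proof -
  have "(\<lambda>x. indicator ({0<..} - S) x *\<^sub>R deriv f x) \<in> borel_measurable borel"
    by (rule borel_measurable_continuous_on_indicator[OF _ continuous_on_deriv])
       (use open_regular in auto)
  then show ?thesis by (simp add: slope_def [abs_def])
qed

lemma slope_bound: "\<bar>slope a\<bar> \<le> indicator {0<..} a * (c1 + c2 * a powr q)"
proof (cases "a \<in> {0<..} - S")
  case True
  then have "(f has_real_derivative deriv f a) (at a within {0..})"
    by (intro has_field_derivative_at_within[OF has_deriv]) auto
  from poly[OF _ this] True show ?thesis by (simp add: slope_def)
next
  case False
  then have "slope a = 0" by (simp add: slope_def)
  then show ?thesis using c by simp
qed

lemma slope_nonpos: "a \<le> 0 \<Longrightarrow> slope a = 0"
  by (simp add: slope_def)

lemma integrable_slope_Icc: "integrable lborel (\<lambda>a. slope a * indicator {0..x} a)"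
proof (rule Bochner_Integration.integrable_bound)
  show "integrable lborel (\<lambda>a. (c1 + c2 * x powr q) * indicator {0..x} a)"
    by (intro integrable_mult_right integrable_real_indicator) (auto simp: emeasure_lborel_Icc_eq)
  show "AE a in lborel. norm (slope a * indicator {0..x} a) \<le> norm ((c1 + c2 * x powr q) * indicator {0..x} a)"
  proof (rule AE_I2)
    fix a
    have "\<bar>slope a\<bar> \<le> c1 + c2 * x powr q" if "0 \<le> a" "a \<le> x"
    proof -
      have "\<bar>slope a\<bar> \<le> c1 + c2 * a powr q" 
      proof (cases "0 < a")
        case True
        then show ?thesis using slope_bound[of a] by simp
      qed (use c slope_nonpos[of a] in auto)
      also have "\<dots> \<le> c1 + c2 * x powr q" using that c by (simp add: powr_mono2)
      finally show ?thesis .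
    qed
    then show "norm (slope a * indicator {0..x} a) \<le> norm ((c1 + c2 * x powr q) * indicator {0..x} a)"
      using c by (cases "a \<in> {0..x}") simp_all
  qed
qed measurable

lemma slope_indicator_atMost: "slope a * indicator {..x} a = slope a * indicator {0..x} a"
  using slope_nonpos[of a] by (cases "0 \<le> a") (simp_all add: indicator_def)

lemma step_has_deriv:
  assumes "x \<noteq> s" shows "(step s has_real_derivative 0) (at x)"
proof (cases "x < s")
  case True
  have "((\<lambda>x. 0) has_real_derivative 0) (at x)" by simp
  then show ?thesis
    by (rule has_field_derivative_transform_within_open[where S="{..<s}"]) (use True in \<open>auto simp: step_def\<close>)
next
  case False
  have "((\<lambda>x. left_jump f s + right_jump f s) has_real_derivative 0) (at x)" by simp
  then show ?thesis
    by (rule has_field_derivative_transform_within_open[where S="{s<..}"]) (use False assms in \<open>auto simp: step_def\<close>)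
qed

text \<open>The step removes the left jump at s and both jumps beyond s, so the value and both
  one-sided limits become the left limit of f.\<close>

lemma isCont_sub_step:
  assumes "s \<in> S" shows "isCont (\<lambda>x. f x - step s x) s"
proof -
  have s0: "s \<noteq> 0" using assms S_pos by auto
  obtain L where L: "(f \<longlongrightarrow> L) (at_left s)" using left_lim[OF assms] by blast
  obtain R where R: "(f \<longlongrightarrow> R) (at_right s)" using right_lim[of s] assms by blast
  have lj: "left_jump f s = f s - L" using tendsto_Lim[OF _ L] s0 by (simp add: left_jump_def)
  have rj: "right_jump f s = R - f s" using tendsto_Lim[OF _ R] by (simp add: right_jump_def)
  have val: "f s - step s s = L" by (simp add: step_def lj)
  have "((\<lambda>x. f x - step s x) \<longlongrightarrow> L) (at_left s)"
  proof (rule Lim_transform_eventually[OF L])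
    show "\<forall>\<^sub>F x in at_left s. f x = f x - step s x"
      by (auto simp: eventually_at_filter step_def)
  qed
  moreover have "((\<lambda>x. f x - step s x) \<longlongrightarrow> L) (at_right s)"
  proof (rule Lim_transform_eventually)
    show "((\<lambda>x. f x - (left_jump f s + right_jump f s)) \<longlongrightarrow> L) (at_right s)"
      by (rule tendsto_eq_intros R refl | simp add: lj rj)+
    show "\<forall>\<^sub>F x in at_right s. f x - (left_jump f s + right_jump f s) = f x - step s x"
      using eventually_at_right_less[of s] by eventually_elim (auto simp: step_def)
  qed
  ultimately show ?thesis unfolding isCont_def val by (rule filterlim_split_at)
qed

text \<open>The constant extension to the left makes the value at 0 the right limit, which gives
  continuity on closed intervals [0, x].\<close>

definition cont_part :: "real \<Rightarrow> real" where
  "cont_part x = (if x \<le> 0 then start else f x - (\<Sum>s\<in>S. step s x))"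

lemma cont_part_eventually:
  assumes "0 < x" shows "\<forall>\<^sub>F y in nhds x. cont_part y = f y - (\<Sum>s\<in>S. step s y)"
proof (rule eventually_mono)
  show "\<forall>\<^sub>F y in nhds x. y \<in> {0<..}" using assms by (intro eventually_nhds_in_open) auto
qed (simp add: cont_part_def)

lemma cont_part_has_deriv:
  assumes "0 < x" "x \<notin> S" shows "(cont_part has_real_derivative slope x) (at x)"
proof -
  have "((\<lambda>y. f y - (\<Sum>s\<in>S. step s y)) has_real_derivative deriv f x - (\<Sum>s\<in>S. 0)) (at x)"
    using assms by (intro DERIV_diff has_deriv DERIV_sum step_has_deriv) auto
  moreover have "slope x = deriv f x" using assms by (simp add: slope_def)
  ultimately have "((\<lambda>y. f y - (\<Sum>s\<in>S. step s y)) has_real_derivative slope x) (at x)" by simp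
  then show ?thesis
    by (rule has_field_derivative_transform_within_open[where S="{0<..}"]) (use assms in \<open>auto simp: cont_part_def\<close>)
qed

lemma isCont_cont_part:
  assumes "0 < x" shows "isCont cont_part x"
proof (cases "x \<in> S")
  case True
  have "isCont (\<lambda>y. (f y - step x y) - (\<Sum>s\<in>S - {x}. step s y)) x"
    by (intro continuous_diff isCont_sub_step[OF True] continuous_sum DERIV_isCont[OF step_has_deriv]) auto
  moreover have "(f y - step x y) - (\<Sum>s\<in>S - {x}. step s y) = f y - (\<Sum>s\<in>S. step s y)" for y
    using sum.remove[OF fin True, of "\<lambda>s. step s y"] by simp
  ultimately have "isCont (\<lambda>y. f y - (\<Sum>s\<in>S. step s y)) x" by simp
  then show ?thesis
    by (subst isCont_cong[OF cont_part_eventually[OF assms]])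
next
  case False
  then show ?thesis using cont_part_has_deriv[OF assms] DERIV_isCont by blast
qed

lemma cont_part_tendsto_start: "(cont_part \<longlongrightarrow> start) (at_right 0)"
proof -
  obtain L where L: "(f \<longlongrightarrow> L) (at_right 0)" using right_lim by blast
  have "start = L" unfolding start_def using tendsto_Lim[OF _ L] by simp
  moreover have "(cont_part \<longlongrightarrow> L) (at_right 0)"
  proof (rule Lim_transform_eventually[OF L])
    have "\<forall>\<^sub>F x in at_right 0. \<forall>s\<in>S. x < s"
      using fin S_pos by (intro eventually_ball_finite ballI order_tendstoD(2)[OF tendsto_ident_at]) auto
    then show "\<forall>\<^sub>F x in at_right 0. f x = cont_part x"
      using eventually_at_right_less[of 0]
    proof eventually_elim
      fix x assume "\<forall>s\<in>S. x < s" "0 < x"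
      then have "(\<Sum>s\<in>S. step s x) = 0" by (intro sum.neutral) (auto simp: step_def)
      then show "f x = cont_part x" using \<open>0 < x\<close> by (simp add: cont_part_def)
    qed
  qed
  ultimately show ?thesis by simp
qed

text \<open>The fundamental theorem of calculus for a continuous function differentiable off a
  finite set, applied to f with its jumps removed.\<close>

lemma representation:
  assumes "0 < x"
  shows "f x = start + (LINT a|lborel. slope a * indicator {..x} a) + (\<Sum>s\<in>S. step s x)"
proof -
  have "continuous_on {0..x} cont_part"
  proof (rule continuous_on_IccI)
    show "(cont_part \<longlongrightarrow> cont_part 0) (at_right 0)"
      using cont_part_tendsto_start by (simp add: cont_part_def)
    show "(cont_part \<longlongrightarrow> cont_part x) (at_left x)"
      using isCont_cont_part[OF assms] unfolding isCont_def filterlim_at_split by blast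
  qed (use assms isCont_cont_part in \<open>auto simp: isCont_def\<close>)
  then have "(slope has_integral cont_part x - cont_part 0) {0..x}"
  proof (rule fundamental_theorem_of_calculus_interior_strong[OF fin less_imp_le[OF assms], rotated])
    fix y assume "y \<in> {0<..<x} - S"
    then show "(cont_part has_vector_derivative slope y) (at y)"
      unfolding has_real_derivative_iff_has_vector_derivative[symmetric] by (intro cont_part_has_deriv) auto
  qed
  then have "integral {0..x} slope = cont_part x - start" by (simp add: integral_unique cont_part_def)
  moreover have "integral {0..x} slope = (LINT a:{0..x}|lborel. slope a)"
    using integrable_slope_Icc[of x]
    by (intro set_borel_integral_eq_integral(2)[symmetric]) (simp add: set_integrable_def mult.commute)
  moreover have "(LINT a:{0..x}|lborel. slope a) = (LINT a|lborel. slope a * indicator {..x} a)"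
    unfolding slope_indicator_atMost set_lebesgue_integral_def by (simp add: mult.commute)
  ultimately show ?thesis using assms by (simp add: cont_part_def)
qed

lemma jump_points_subset: "jump_points f \<subseteq> insert 0 S"
proof
  fix x assume "x \<in> jump_points f"
  then have x: "0 \<le> x" "\<not> continuous (at x within {0..}) f" by (auto simp: jump_points_def)
  show "x \<in> insert 0 S"
  proof (rule ccontr)
    assume "x \<notin> insert 0 S"
    then have "isCont f x" using x by (intro DERIV_isCont[OF has_deriv]) auto
    from continuous_at_imp_continuous_at_within[OF this] x(2) show False by contradiction
  qed
qed

text \<open>S may contain mere kinks. They contribute nothing, which reconciles sums over S with
  sums over \<open>jump_points f\<close>.\<close>

lemma jumps_zero:
  assumes "s \<in> S" "s \<notin> jump_points f"
  shows "left_jump f s = 0" "right_jump f s = 0"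
proof -
  have s: "0 < s" using assms S_pos by auto
  then have "continuous (at s within {0..}) f" using assms by (auto simp: jump_points_def)
  moreover have "at s within {0..} = at s" using s by (intro at_within_interior) (simp add: interior_real_atLeast)
  ultimately have "(f \<longlongrightarrow> f s) (at s)" by (simp add: continuous_at)
  then have "(f \<longlongrightarrow> f s) (at_left s)" "(f \<longlongrightarrow> f s) (at_right s)" by (auto simp: filterlim_at_split)
  then have "Lim (at_left s) f = f s" "Lim (at_right s) f = f s"
    by (intro tendsto_Lim trivial_limit_at_left_real trivial_limit_at_right_real; simp)+
  then show "left_jump f s = 0" "right_jump f s = 0"
    by (simp_all add: left_jump_def right_jump_def)
qed

end

lemma payoff_exists:
  assumes "f \<in> payoff_class" "deriv_poly_bounded f"
  obtains S c1 c2 q where "payoff f S c1 c2 q"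
proof -
  obtain S where S: "finite S" "S \<subseteq> {0<..}" "f C1_differentiable_on ({0<..} - S)"
     "\<forall>s\<in>insert 0 S. (\<exists>L. (f \<longlongrightarrow> L) (at_right s)) \<and> (\<exists>L. (deriv f \<longlongrightarrow> L) (at_right s))"
     "\<forall>s\<in>S. (\<exists>L. (f \<longlongrightarrow> L) (at_left s)) \<and> (\<exists>L. (deriv f \<longlongrightarrow> L) (at_left s))"
    using assms(1) unfolding payoff_class_def by blast
  obtain c1 c2 q where c: "c1 > 0" "c2 > 0" "q > 0"
     "\<forall>a\<ge>0. \<forall>D. (f has_real_derivative D) (at a within {0..}) \<longrightarrow> \<bar>D\<bar> \<le> c1 + c2 * a powr q"
    using assms(2) unfolding deriv_poly_bounded_def by blast
  have "payoff f S c1 c2 q"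
    by unfold_locales (use S c in auto)
  then show thesis using that by blast
qed

subsection \<open>Prices as integrals over the strike\<close>

lemma integrable_inverse_one_plus_square: "integrable lborel (\<lambda>x::real. 1 / (1 + x^2))"
  using integrable_inverse_1_plus_square
  by (simp add: set_integrable_def einterval_def inverse_eq_divide)

lemma measure_std_normal_greaterThan: "measure std_normal_distribution {z<..} = gauss_tail z"
  unfolding gauss_tail_def
  by (subst (1 2) measure_std_normal_eq_integral, simp, simp, intro integral_cong_AE)
     (auto simp: indicator_def intro!: AE_I[where N="{z}"])

context binomial_model
begin

text \<open>Beyond the strike A with z = 0, put a = A y. The rate K = vol (q + 2) turns the
  exponential into y^(-q-2), which beats both a^q and 1 + a^2. Below A everything is
  bounded.\<close>

lemma polynomial_weight:
  assumes "0 < c1" "0 < c2" "0 < q"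
  obtains K C where "0 \<le> K" "0 < C" 
    "\<And>a. 0 < a \<Longrightarrow> (c1 + c2 * a powr q) * exp (- K * max (z_of a) 0) \<le> C * (1 / (1 + a^2))"
proof -
  define m where "m = ln S0 + (r - \<sigma>^2/2) * T"
  define A where "A = exp m"
  define C where "C = (c1 + c2 * A powr q) * (1 + A^2)"
  have A: "0 < A" by (simp add: A_def)
  have C0: "0 < C" using assms A by (simp add: C_def add_pos_nonneg)
  have "(c1 + c2 * a powr q) * exp (- (vol * (q + 2)) * max (z_of a) 0) \<le> C * (1 / (1 + a^2))" if a: "0 < a" for a
  proof -
    have z: "vol * z_of a = ln (a / A)"
      using vol_pos a by (simp add: z_of_eq m_def[symmetric] A_def ln_div)
    have pos: "0 < 1 + a^2" by (simp add: add_pos_nonneg)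
    have "(c1 + c2 * a powr q) * exp (- (vol * (q + 2)) * max (z_of a) 0) * (1 + a^2) \<le> C"
    proof (cases "a \<le> A")
      case True
      have "exp (- (vol * (q + 2)) * max (z_of a) 0) \<le> 1" using vol_pos assms by simp
      then have "(c1 + c2 * a powr q) * exp (- (vol * (q + 2)) * max (z_of a) 0) * (1 + a^2) 
         \<le> (c1 + c2 * A powr q) * 1 * (1 + A^2)"
        using True a assms by (intro mult_mono add_mono powr_mono2 power_mono order_refl) (auto intro!: add_nonneg_nonneg)
      then show ?thesis by (simp add: C_def)
    next
      case False
      define y where "y = a / A"
      have y: "1 \<le> y" "a = A * y" using False A by (auto simp: y_def)
      have "0 \<le> vol * z_of a" using z y(1) by (simp add: y_def)
      then have "0 \<le> z_of a" using vol_pos by (simp add: zero_le_mult_iff)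
      then have "- (vol * (q + 2)) * max (z_of a) 0 = - (q + 2) * (vol * z_of a)"
        by (simp add: algebra_simps)
      then have "exp (- (vol * (q + 2)) * max (z_of a) 0) = exp (- (q + 2) * ln y)"
        unfolding z y_def by (simp only:)
      also have "\<dots> = y powr (- (q + 2))" using y by (simp add: powr_def)
      finally have e: "exp (- (vol * (q + 2)) * max (z_of a) 0) = y powr (- (q + 2))" .
      have "c1 + c2 * a powr q \<le> (c1 + c2 * A powr q) * y powr q"
      proof -
        have "1 \<le> y powr q" using y assms by (simp add: ge_one_powr_ge_zero)
        then have "c1 * 1 \<le> c1 * y powr q" using assms by (intro mult_left_mono) auto
        then show ?thesis using y A by (simp add: powr_mult algebra_simps)
      qed
      moreover have "1 + a^2 \<le> (1 + A^2) * y powr 2"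
      proof -
        have "1 \<le> y^2" using y by (simp add: one_le_power)
        then show ?thesis using y by (simp add: power_mult_distrib algebra_simps)
      qed
      ultimately have "(c1 + c2 * a powr q) * y powr (- (q + 2)) * (1 + a^2) 
         \<le> ((c1 + c2 * A powr q) * y powr q) * y powr (- (q + 2)) * ((1 + A^2) * y powr 2)"
        using assms A a by (intro mult_mono mult_right_mono) (auto intro!: add_nonneg_nonneg mult_nonneg_nonneg)
      also have "\<dots> = C * (y powr q * y powr (- (q + 2)) * y powr 2)" by (simp add: C_def mult_ac)
      also have "y powr q * y powr (- (q + 2)) * y powr 2 = y powr (q + (- (q + 2)) + 2)"
        by (simp only: powr_add)
      also have "\<dots> = 1" using y by simp
      finally show ?thesis unfolding e by simp
    qed
    then show ?thesis using pos by (simp add: pos_le_divide_eq)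
  qed
  then show ?thesis using that[of "vol * (q + 2)" C] C0 vol_pos assms by auto
qed

text \<open>Decay is available only for z \<ge> 0, since the tail tends to 1 on the other side;
  hence max z 0 instead of |z|.\<close>

lemma gauss_tail_le_weight: 
  assumes "0 \<le> K" shows "gauss_tail z \<le> exp (K^2/2) * exp (- K * max z 0)"
proof (cases "0 \<le> z")
  case True
  then show ?thesis using gauss_tail_le_exp[OF assms, of z] by (simp add: exp_add[symmetric])
next
  case False
  have "1 \<le> exp (K^2/2)" by simp
  then have "gauss_tail z \<le> exp (K^2/2)" using gauss_tail_le_1[of z] by linarith
  then show ?thesis using False by simp
qed

lemma z_of_measurable: "(\<lambda>a. z_of a) \<in> borel_measurable borel"
  unfolding z_of_def d2_def d1_def by measurable

lemma BS_stock_measurable [measurable]: "BS_stock S0 \<sigma> r T \<in> borel_measurable borel"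
  unfolding BS_stock_def [abs_def] by measurable

lemma le_BS_stock_iff: "0 < a \<Longrightarrow> a \<le> BS_stock S0 \<sigma> r T z \<longleftrightarrow> z_of a \<le> z"
  using z_of_le_iff[of a "BS_stock S0 \<sigma> r T z"] by (simp add: BS_stock_pos z_of_BS_stock)

lemma less_BS_stock_iff: "0 < a \<Longrightarrow> a < BS_stock S0 \<sigma> r T z \<longleftrightarrow> z_of a < z"
  using z_of_less_iff[of a "BS_stock S0 \<sigma> r T z"] by (simp add: BS_stock_pos z_of_BS_stock)

lemma abs_Delta_n_le: "\<bar>Delta_n S0 \<sigma> T lam n a\<bar> \<le> 1"
  using frac_ge_0 frac_lt_1 unfolding Delta_n_def by (smt (verit))

lemma Delta_n_measurable [measurable]: "Delta_n S0 \<sigma> T lam n \<in> borel_measurable borel"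
  unfolding Delta_n_def [abs_def] frac_def by measurable

lemma B_n_measurable [measurable]: "B_n S0 \<sigma> r T lam n \<in> borel_measurable borel"
  unfolding B_n_def [abs_def] Let_def d2_def d1_def by measurable

lemma d2_measurable [measurable]: "d2 S0 \<sigma> r T \<in> borel_measurable borel"
  unfolding d2_def [abs_def] d1_def by measurable

lemma weight_measurable [measurable]: "weight S0 \<sigma> r T \<in> borel_measurable borel"
  unfolding weight_def [abs_def] by measurable

end

locale option_model = binomial_model + payoff
begin

abbreviation stock :: "real \<Rightarrow> real" where "stock \<equiv> BS_stock S0 \<sigma> r T"

text \<open>Linear in the pair P, Q, so the jump contributions of the tree, of the Black-Scholes
  price and of the expansion can be subtracted from one another.\<close>

definition jumps_at :: "(real \<Rightarrow> real) \<Rightarrow> (real \<Rightarrow> real) \<Rightarrow> real" where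
  "jumps_at P Q = (\<Sum>s\<in>S. left_jump f s * P s + right_jump f s * Q s)"

lemma slope_weight:
  obtains K C where "0 \<le> K" "0 < C" "\<And>a. \<bar>slope a\<bar> * exp (- K * max (z_of a) 0) \<le> C * (1 / (1 + a^2))"
proof -
  obtain K C where K: "0 \<le> K" "0 < C" 
    "\<And>a. 0 < a \<Longrightarrow> (c1 + c2 * a powr q) * exp (- K * max (z_of a) 0) \<le> C * (1 / (1 + a^2))"
    using polynomial_weight[OF c] by blast
  have "\<bar>slope a\<bar> * exp (- K * max (z_of a) 0) \<le> C * (1 / (1 + a^2))" for a
  proof (cases "0 < a")
    case True
    have "\<bar>slope a\<bar> * exp (- K * max (z_of a) 0) \<le> (c1 + c2 * a powr q) * exp (- K * max (z_of a) 0)"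
      using slope_bound[of a] True by (intro mult_right_mono) auto
    with K(3)[OF True] show ?thesis by linarith
  next
    case False
    then show ?thesis using slope_nonpos[of a] K(2) by (simp add: add_nonneg_nonneg)
  qed
  then show ?thesis using that K by blast
qed

text \<open>The representation of f is inserted at every lattice point. After exchanging the finite
  sum with the integral, the indicators of a \<le> x_j add up to \<open>prob_ge n a\<close>.\<close>

lemma V_BT_eq:
  "V_BT S0 \<sigma> r T lam n f = exp (- r * T) *
     (start + (LINT a|lborel. slope a * prob_ge n a) + jumps_at (prob_ge n) (prob_gt n))"
  and integrable_slope_prob_ge: "integrable lborel (\<lambda>a. slope a * prob_ge n a)"
proof -
  let ?b = "binom_mass n (prob_up n)" and ?x = "lattice_point S0 \<sigma> T lam n"
  have ge: "prob_ge n a = (\<Sum>j=0..n. ?b j * indicator {..?x j} a)" 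
    "prob_ge n a = (\<Sum>j=0..n. ?b j * indicator {a..} (?x j))" for a
    unfolding prob_ge_def by (rule sum.mono_neutral_cong_left; auto simp: indicator_def)+
  have gt: "prob_gt n a = (\<Sum>j=0..n. ?b j * indicator {a<..} (?x j))" for a
    unfolding prob_gt_def by (rule sum.mono_neutral_cong_left) (auto simp: indicator_def)
  have int: "integrable lborel (\<lambda>a. slope a * indicator {..x} a)" for x
    unfolding slope_indicator_atMost by (rule integrable_slope_Icc)
  have sp: "slope a * prob_ge n a = (\<Sum>j=0..n. ?b j * (slope a * indicator {..?x j} a))" for a
    unfolding ge(1) sum_distrib_left by (simp add: mult_ac)
  show "integrable lborel (\<lambda>a. slope a * prob_ge n a)"
    unfolding sp by (intro Bochner_Integration.integrable_sum integrable_mult_right int)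
  have L: "(LINT a|lborel. slope a * prob_ge n a) = (\<Sum>j=0..n. ?b j * (LINT a|lborel. slope a * indicator {..?x j} a))"
    unfolding sp by (subst Bochner_Integration.integral_sum) (auto intro!: integrable_mult_right int)
  have J: "jumps_at (prob_ge n) (prob_gt n) = (\<Sum>j=0..n. ?b j * (\<Sum>s\<in>S. step s (?x j)))"
  proof -
    have "(\<Sum>j=0..n. ?b j * (\<Sum>s\<in>S. step s (?x j))) = (\<Sum>s\<in>S. \<Sum>j=0..n. ?b j * step s (?x j))"
      unfolding sum_distrib_left by (rule sum.swap)
    also have "\<dots> = (\<Sum>s\<in>S. left_jump f s * prob_ge n s + right_jump f s * prob_gt n s)"
      unfolding ge(2) gt sum_distrib_left sum.distrib[symmetric] step_def by (intro sum.cong refl) (simp add: algebra_simps)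
    finally show ?thesis by (simp add: jumps_at_def)
  qed
  have "(\<Sum>j=0..n. ?b j * f (?x j)) = (\<Sum>j=0..n. ?b j * start + ?b j * (LINT a|lborel. slope a * indicator {..?x j} a) + ?b j * (\<Sum>s\<in>S. step s (?x j)))"
    by (intro sum.cong refl) (simp only: representation[OF lattice_point_pos] distrib_left)
  also have "\<dots> = start + (LINT a|lborel. slope a * prob_ge n a) + jumps_at (prob_ge n) (prob_gt n)"
    unfolding sum.distrib L J sum_distrib_right[symmetric] sum_binom_mass by simp
  finally show "V_BT S0 \<sigma> r T lam n f = exp (- r * T) *
     (start + (LINT a|lborel. slope a * prob_ge n a) + jumps_at (prob_ge n) (prob_gt n))"
    unfolding V_BT_def binom_mass_def by simp
qed

lemma slope_indicator_stock: "slope a * indicator {..stock z} a = slope a * indicator {z_of a..} z"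
proof (cases "0 < a")
  case True
  then show ?thesis by (simp add: indicator_def le_BS_stock_iff)
qed (simp add: slope_nonpos)

lemma slope_stock_measurable [measurable]: 
  "(\<lambda>(a, z). slope a * indicator {..stock z} a) \<in> borel_measurable (lborel \<Otimes>\<^sub>M std_normal_distribution)"
proof -
  have "(\<lambda>(a, z). slope a * (if a \<le> stock z then 1 else 0)) \<in> borel_measurable (borel \<Otimes>\<^sub>M borel)"
    by measurable
  moreover have "borel_measurable (lborel \<Otimes>\<^sub>M std_normal_distribution) = borel_measurable (borel \<Otimes>\<^sub>M (borel :: real measure) :: (real \<times> real) measure)"
    by (intro measurable_cong_sets sets_pair_measure_cong) auto
  moreover have "indicator {..stock z} a = (if a \<le> stock z then 1 else 0 :: real)" for a z by (simp add: indicator_def)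
  ultimately show ?thesis by simp
qed

lemma gauss_tail_measurable [measurable]: "gauss_tail \<in> borel_measurable borel"
proof -
  have "continuous_on UNIV gauss_tail"
    using gauss_tail_has_derivative[OF DERIV_ident] by (intro continuous_at_imp_continuous_on ballI DERIV_isCont)
  then show ?thesis by (rule borel_measurable_continuous_onI)
qed

lemma integrable_indicator_std_normal:
  "A \<in> sets borel \<Longrightarrow> integrable std_normal_distribution (indicator A :: real \<Rightarrow> real)"
proof -
  interpret prob_space std_normal_distribution by (rule prob_space_std_normal)
  show "A \<in> sets borel \<Longrightarrow> integrable std_normal_distribution (indicator A :: real \<Rightarrow> real)"
    by (intro integrable_real_indicator) (auto simp: less_top[symmetric])
qed

lemma integrable_slope_gauss_tail: "integrable lborel (\<lambda>a. slope a * gauss_tail (z_of a))"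
proof -
  obtain K C where K: "0 \<le> K" "0 < C" "\<And>a. \<bar>slope a\<bar> * exp (- K * max (z_of a) 0) \<le> C * (1 / (1 + a^2))"
    using slope_weight by blast
  note [measurable] = z_of_measurable
  show ?thesis
  proof (rule Bochner_Integration.integrable_bound)
    show "integrable lborel (\<lambda>a. exp (K^2/2) * (C * (1 / (1 + a^2))))"
      by (intro integrable_mult_right integrable_inverse_one_plus_square)
    show "AE a in lborel. norm (slope a * gauss_tail (z_of a)) \<le> norm (exp (K^2/2) * (C * (1 / (1 + a^2))))"
    proof (rule AE_I2)
      fix a
      have "\<bar>slope a * gauss_tail (z_of a)\<bar> \<le> \<bar>slope a\<bar> * (exp (K^2/2) * exp (- K * max (z_of a) 0))"
        using gauss_tail_le_weight[OF K(1), of "z_of a"] gauss_tail_nonneg[of "z_of a"] 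
        by (intro abs_mult_le_mult) auto
      also have "\<dots> \<le> exp (K^2/2) * (C * (1 / (1 + a^2)))"
        using mult_left_mono[OF K(3)[of a], of "exp (K^2/2)"] by (simp only: mult_ac) simp
      finally show "norm (slope a * gauss_tail (z_of a)) \<le> norm (exp (K^2/2) * (C * (1 / (1 + a^2))))"
        using K(2) by (simp add: abs_mult)
    qed
  qed measurable
qed

text \<open>Integrating the absolute value over z first gives |slope a| times the Gaussian tail,
  whose integrability is known; this is the absolute integrability needed for the exchange.\<close>

lemma Fubini_slope:
  shows "integrable std_normal_distribution (\<lambda>z. LINT a|lborel. slope a * indicator {..stock z} a)"
    and "(LINT z|std_normal_distribution. LINT a|lborel. slope a * indicator {..stock z} a) = (LINT a|lborel. slope a * gauss_tail (z_of a))"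
proof -
  interpret N: prob_space std_normal_distribution by (rule prob_space_std_normal)
  interpret pair_sigma_finite lborel std_normal_distribution ..
  have row: "(LINT z|std_normal_distribution. slope a * indicator {..stock z} a) = slope a * gauss_tail (z_of a)" for a
    unfolding slope_indicator_stock by (simp add: gauss_tail_def)
  have nrow: "(LINT z|std_normal_distribution. norm (slope a * indicator {..stock z} a)) = \<bar>slope a * gauss_tail (z_of a)\<bar>" for a
    unfolding slope_indicator_stock by (simp add: gauss_tail_def abs_mult)
  have F: "integrable (lborel \<Otimes>\<^sub>M std_normal_distribution) (\<lambda>(a, z). slope a * indicator {..stock z} a)"
  proof (rule Fubini_integrable)
    show "integrable lborel (\<lambda>a. LINT z|std_normal_distribution. norm (case (a, z) of (a, z) \<Rightarrow> slope a * indicator {..stock z} a))"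
      using integrable_slope_gauss_tail by (simp only: prod.case nrow integrable_abs)
    show "AE a in lborel. integrable std_normal_distribution (\<lambda>z. case (a, z) of (a, z) \<Rightarrow> slope a * indicator {..stock z} a)"
      unfolding prod.case slope_indicator_stock
      by (intro AE_I2 integrable_mult_right integrable_indicator_std_normal) simp
  qed measurable
  show "integrable std_normal_distribution (\<lambda>z. LINT a|lborel. slope a * indicator {..stock z} a)"
    by (rule integrable_snd[OF F])
  show "(LINT z|std_normal_distribution. LINT a|lborel. slope a * indicator {..stock z} a) = (LINT a|lborel. slope a * gauss_tail (z_of a))"
    using integral_snd[OF F] integral_fst[OF F] unfolding row by simp
qed

lemma step_stock: "s \<in> S \<Longrightarrow> step s (stock z) = left_jump f s * indicator {z_of s..} z + right_jump f s * indicator {z_of s<..} z"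
proof -
  assume "s \<in> S"
  then have "0 < s" using S_pos by auto
  then have "indicator {s..} (stock z) = (indicator {z_of s..} z :: real)" 
    "indicator {s<..} (stock z) = (indicator {z_of s<..} z :: real)"
    by (simp_all add: indicator_def le_BS_stock_iff less_BS_stock_iff)
  then show ?thesis by (simp add: step_def)
qed

lemma integrable_step_stock: "s \<in> S \<Longrightarrow> integrable std_normal_distribution (\<lambda>z. step s (stock z))"
  by (simp only: step_stock)
     (intro Bochner_Integration.integrable_add integrable_mult_right integrable_indicator_std_normal; simp)

lemma payoff_stock: "f (stock z) = start + (LINT a|lborel. slope a * indicator {..stock z} a) + (\<Sum>s\<in>S. step s (stock z))"
  by (rule representation[OF BS_stock_pos])

lemma integrable_payoff: "integrable std_normal_distribution (\<lambda>z. f (stock z))"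
proof -
  interpret N: prob_space std_normal_distribution by (rule prob_space_std_normal)
  show ?thesis unfolding payoff_stock
    by (intro Bochner_Integration.integrable_add Fubini_slope Bochner_Integration.integrable_sum integrable_step_stock) auto
qed

text \<open>The normal law has no atoms, so left and right jumps receive the same weight.\<close>

lemma V_BS_eq:
  "V_BS S0 \<sigma> r T f = exp (- r * T) * 
     (start + (LINT a|lborel. slope a * gauss_tail (z_of a)) + jumps_at (\<lambda>s. gauss_tail (z_of s)) (\<lambda>s. gauss_tail (z_of s)))"
proof -
  interpret N: prob_space std_normal_distribution by (rule prob_space_std_normal)
  have "(LINT z|std_normal_distribution. step s (stock z)) 
      = left_jump f s * gauss_tail (z_of s) + right_jump f s * gauss_tail (z_of s)" if "s \<in> S" for s
    unfolding step_stock[OF that]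
    by (subst Bochner_Integration.integral_add)
       (auto simp: gauss_tail_def measure_std_normal_greaterThan[unfolded gauss_tail_def] intro!: integrable_mult_right integrable_indicator_std_normal)
  then have st: "(\<Sum>s\<in>S. LINT z|std_normal_distribution. step s (stock z)) = jumps_at (\<lambda>s. gauss_tail (z_of s)) (\<lambda>s. gauss_tail (z_of s))"
    by (simp add: jumps_at_def)
  have "(LINT z|std_normal_distribution. f (stock z)) = start + (LINT a|lborel. slope a * gauss_tail (z_of a)) 
     + (\<Sum>s\<in>S. LINT z|std_normal_distribution. step s (stock z))"
    unfolding payoff_stock
    by (subst Bochner_Integration.integral_add Bochner_Integration.integral_sum, 
        auto intro!: Bochner_Integration.integrable_add Fubini_slope(1) Bochner_Integration.integrable_sum integrable_step_stock)+
       (simp add: Fubini_slope(2) N.prob_space[simplified])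
  then show ?thesis unfolding V_BS_def st by simp
qed

end

section \<open>Bounded integrals, jump sums and the pricing error\<close>

context option_model
begin

text \<open>Serves measurability: Borel-Lebesgue measure is not complete, so agreement with
  \<open>slope\<close> almost everywhere would not suffice. A finite combination of singletons makes
  the equality hold everywhere.\<close>

lemma deriv_decompose: "indicator {0<..} a * deriv f a = slope a + (\<Sum>s\<in>S. deriv f s * indicator {s} a)"
proof (cases "a \<in> S")
  case True
  then have "(\<Sum>s\<in>S. deriv f s * indicator {s} a) = deriv f a"
    using fin by (subst sum.remove[of S a]) (auto intro!: sum.neutral simp: indicator_def)
  then show ?thesis using True S_pos by (auto simp: slope_def)
next
  case False
  then have "(\<Sum>s\<in>S. deriv f s * indicator {s} a) = 0" by (intro sum.neutral) (auto simp: indicator_def)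
  then show ?thesis using False by (simp add: slope_def indicator_def)
qed

text \<open>The bound depends on G only through B; for a family G with common B this gives
  boundedness in n.\<close>

lemma integrable_slope_mult:
  assumes [measurable]: "G \<in> borel_measurable borel"
    and K: "\<And>a. \<bar>slope a\<bar> * exp (- K * max (z_of a) 0) \<le> C * (1 / (1 + a^2))"
    and B: "0 \<le> B" "\<And>a. 0 < a \<Longrightarrow> \<bar>G a\<bar> \<le> B * exp (- K * max (z_of a) 0)"
  shows "integrable lborel (\<lambda>a. slope a * G a)"
    and "\<bar>LINT a|lborel. slope a * G a\<bar> \<le> B * C * (LINT a|lborel. 1 / (1 + a^2))"
proof -
  have bd: "\<bar>slope a * G a\<bar> \<le> B * C * (1 / (1 + a^2))" for a
  proof (cases "0 < a")
    case True
    have "\<bar>slope a * G a\<bar> \<le> \<bar>slope a\<bar> * (B * exp (- K * max (z_of a) 0))"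
      using B(2)[OF True] by (intro abs_mult_le_mult) auto
    also have "\<dots> = B * (\<bar>slope a\<bar> * exp (- K * max (z_of a) 0))" by (simp only: mult_ac)
    also have "\<dots> \<le> B * (C * (1 / (1 + a^2)))" using B(1) K by (rule mult_left_mono[rotated])
    finally show ?thesis by (simp only: mult.assoc)
  next
    case False
    have "0 \<le> \<bar>slope a\<bar> * exp (- K * max (z_of a) 0)" by simp
    then have "0 \<le> C * (1 / (1 + a^2))" using K[of a] by linarith
    then have "0 \<le> B * (C * (1 / (1 + a^2)))" using B(1) by (rule mult_nonneg_nonneg[rotated])
    then show ?thesis using slope_nonpos[of a] False by (simp add: mult.assoc)
  qed
  have int: "integrable lborel (\<lambda>a. B * C * (1 / (1 + a^2)))"
    by (intro integrable_mult_right integrable_inverse_one_plus_square)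
  show si: "integrable lborel (\<lambda>a. slope a * G a)"
  proof (rule Bochner_Integration.integrable_bound[OF int])
    show "AE a in lborel. norm (slope a * G a) \<le> norm (B * C * (1 / (1 + a^2)))"
      using bd by (intro AE_I2) (metis real_norm_def abs_ge_self order_trans)
  qed measurable
  have "\<bar>LINT a|lborel. slope a * G a\<bar> \<le> (LINT a|lborel. \<bar>slope a * G a\<bar>)"
    by (rule integral_abs_bound)
  also have "\<dots> \<le> (LINT a|lborel. B * C * (1 / (1 + a^2)))"
    using si int bd by (intro integral_mono integrable_abs) auto
  also have "\<dots> = B * C * (LINT a|lborel. 1 / (1 + a^2))" by (rule integral_mult_right_zero)
  finally show "\<bar>LINT a|lborel. slope a * G a\<bar> \<le> B * C * (LINT a|lborel. 1 / (1 + a^2))" .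
qed

lemma set_integral_deriv_mult:
  assumes [measurable]: "G \<in> borel_measurable borel" and int: "integrable lborel (\<lambda>a. slope a * G a)"
  shows "set_integrable lborel {0<..} (\<lambda>a. deriv f a * G a)"
    and "(LINT a:{0<..}|lborel. deriv f a * G a) = (LINT a|lborel. slope a * G a)"
proof -
  have eq: "indicator {0<..} a *\<^sub>R (deriv f a * G a) = slope a * G a + (\<Sum>s\<in>S. deriv f s * indicator {s} a) * G a" for a
    using deriv_decompose[of a] by (simp add: distrib_right[symmetric] mult.assoc[symmetric])
  have m: "(\<lambda>a. indicator {0<..} a *\<^sub>R (deriv f a * G a)) \<in> borel_measurable lborel"
    unfolding eq by measurable
  have ae: "AE a in lborel. indicator {0<..} a *\<^sub>R (deriv f a * G a) = slope a * G a"
  proof (rule AE_I[where N=S])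
    show "{a \<in> space lborel. indicator {0<..} a *\<^sub>R (deriv f a * G a) \<noteq> slope a * G a} \<subseteq> S"
      by (auto simp: slope_def indicator_def)
    show "emeasure lborel S = 0" using fin by (intro emeasure_lborel_countable countable_finite)
    show "S \<in> sets lborel" using fin by (simp add: borel_closed finite_imp_closed)
  qed
  show "set_integrable lborel {0<..} (\<lambda>a. deriv f a * G a)"
    unfolding set_integrable_def by (subst integrable_cong_AE[OF m _ ae]) (use int in auto)
  show "(LINT a:{0<..}|lborel. deriv f a * G a) = (LINT a|lborel. slope a * G a)"
    unfolding set_lebesgue_integral_def by (rule integral_cong_AE[OF m _ ae]) measurable
qed

definition G1 :: "nat \<Rightarrow> real \<Rightarrow> real" where
  "G1 n a = weight S0 \<sigma> r T a * Delta_n S0 \<sigma> T lam n a"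

definition G2 :: "nat \<Rightarrow> real \<Rightarrow> real" where
  "G2 n a = weight S0 \<sigma> r T a * (B_n S0 \<sigma> r T lam n a - d2 S0 \<sigma> r T a * (Delta_n S0 \<sigma> T lam n a)\<^sup>2 / 2)"

lemma G_measurable [measurable]: "G1 n \<in> borel_measurable borel" "G2 n \<in> borel_measurable borel"
  unfolding G1_def [abs_def] G2_def [abs_def] by measurable

lemma integrand_eq: "integrand1 S0 \<sigma> r T lam f n = (\<lambda>a. deriv f a * G1 n a)" 
  "integrand2 S0 \<sigma> r T lam f n = (\<lambda>a. deriv f a * G2 n a)"
  by (auto simp: integrand1_def integrand2_def G1_def G2_def mult_ac fun_eq_iff)

text \<open>B is common to all n because \<open>shift\<close>, \<open>coef\<close> and
  \<open>Delta_n\<close> are bounded uniformly. The cubic growth of \<open>B_n\<close> in z is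
  absorbed by the Gaussian weight.\<close>

lemma G_bound:
  assumes K: "0 \<le> K"
  obtains B where "0 \<le> B" "\<And>n a. \<bar>G1 n a\<bar> \<le> B * exp (- K * max (z_of a) 0)" "\<And>n a. \<bar>G2 n a\<bar> \<le> B * exp (- K * max (z_of a) 0)"
proof -
  obtain M where M: "1 \<le> M" "\<And>n. \<bar>shift n\<bar> \<le> M" "\<And>n. \<bar>coef n\<bar> \<le> M" using tilted_binomial_model by blast
  define B where "B = exp (- r * T) * ((3 * M^2 + 1) * exp ((K + 3)^2/2))"
  have fac: "\<bar>weight S0 \<sigma> r T a * h\<bar> \<le> B * exp (- K * max (z_of a) 0)" 
    if h: "\<bar>h\<bar> \<le> (3 * M^2 + 1) * (1 + \<bar>z_of a\<bar>)^3" for a h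
  proof -
    let ?z = "z_of a"
    have "\<bar>weight S0 \<sigma> r T a * h\<bar> \<le> (exp (- r * T) * std_normal_density ?z) * ((3 * M^2 + 1) * (1 + \<bar>?z\<bar>)^3)"
      using h unfolding weight_eq by (intro abs_mult_le_mult) auto
    also have "\<dots> = exp (- r * T) * (3 * M^2 + 1) * (std_normal_density ?z * (1 + \<bar>?z\<bar>)^3)" by (simp only: mult_ac)
    also have "\<dots> \<le> exp (- r * T) * (3 * M^2 + 1) * (exp ((K + real 3)^2/2) * exp (- K * \<bar>?z\<bar>))"
      by (intro mult_left_mono std_normal_density_times_power_le) auto
    also have "\<dots> \<le> exp (- r * T) * (3 * M^2 + 1) * (exp ((K + real 3)^2/2) * exp (- K * max ?z 0))"
      using K by (intro mult_left_mono) (auto intro!: mult_left_mono)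
    also have "\<dots> = B * exp (- K * max ?z 0)" by (simp add: B_def)
    finally show ?thesis .
  qed
  show thesis
  proof (rule that)
    show "0 \<le> B" by (simp add: B_def)
    fix n a
    let ?z = "z_of a" and ?D = "Delta_n S0 \<sigma> T lam n a"
    have X: "1 \<le> (1 + \<bar>?z\<bar>)^3" "\<bar>?z\<bar> \<le> (1 + \<bar>?z\<bar>)^3"
      using power_increasing[of 1 3 "1 + \<bar>?z\<bar>"] by auto
    have M3: "0 \<le> 3 * M^2 * (1 + \<bar>?z\<bar>)^3" by simp
    have "\<bar>?D\<bar> \<le> (3 * M^2 + 1) * (1 + \<bar>?z\<bar>)^3"
      using abs_Delta_n_le[of n a] X(1) M3 by (simp only: distrib_right mult_1_left)
    then show "\<bar>G1 n a\<bar> \<le> B * exp (- K * max ?z 0)" unfolding G1_def by (rule fac)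
    have d: "\<bar>d2 S0 \<sigma> r T a * ?D^2\<bar> \<le> \<bar>?z\<bar> * 1^2"
      using abs_Delta_n_le[of n a] by (intro abs_mult_le_mult abs_power_le_power) (auto simp: z_of_def)
    have b: "\<bar>B_n S0 \<sigma> r T lam n a\<bar> \<le> 3 * M^2 * (1 + \<bar>?z\<bar>)^3"
      unfolding tail_poly_eq_B_n[symmetric] using M by (intro abs_tail_poly_le) auto
    have "\<bar>b - d / 2\<bar> \<le> P + Q" if "\<bar>d\<bar> \<le> Z * 1^2" "\<bar>b\<bar> \<le> P" "Z \<le> Q" for b d P Q Z :: real
      using that by simp
    from this[OF d b X(2)] have "\<bar>B_n S0 \<sigma> r T lam n a - d2 S0 \<sigma> r T a * ?D^2 / 2\<bar> \<le> 3 * M^2 * (1 + \<bar>?z\<bar>)^3 + (1 + \<bar>?z\<bar>)^3" .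
    then show "\<bar>G2 n a\<bar> \<le> B * exp (- K * max ?z 0)"
      unfolding G2_def by (intro fac) (simp add: distrib_right)
  qed
qed

lemma integrals:
  shows "integrable lborel (\<lambda>a. slope a * G1 n a)" "integrable lborel (\<lambda>a. slope a * G2 n a)"
    and "\<exists>C. \<forall>n. \<bar>LINT a|lborel. slope a * G1 n a\<bar> \<le> C"
    and "\<exists>C. \<forall>n. \<bar>LINT a|lborel. slope a * G2 n a\<bar> \<le> C"
proof -
  obtain K C where K: "0 \<le> K" "0 < C" "\<And>a. \<bar>slope a\<bar> * exp (- K * max (z_of a) 0) \<le> C * (1 / (1 + a^2))"
    using slope_weight by blast
  obtain B where B: "0 \<le> B" "\<And>n a. \<bar>G1 n a\<bar> \<le> B * exp (- K * max (z_of a) 0)" "\<And>n a. \<bar>G2 n a\<bar> \<le> B * exp (- K * max (z_of a) 0)"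
    using G_bound[OF K(1)] by blast
  show "integrable lborel (\<lambda>a. slope a * G1 n a)" "integrable lborel (\<lambda>a. slope a * G2 n a)"
    by (rule integrable_slope_mult[OF G_measurable(1) K(3) B(1) B(2)] integrable_slope_mult[OF G_measurable(2) K(3) B(1) B(3)])+
  show "\<exists>C. \<forall>n. \<bar>LINT a|lborel. slope a * G1 n a\<bar> \<le> C" "\<exists>C. \<forall>n. \<bar>LINT a|lborel. slope a * G2 n a\<bar> \<le> C"
    using integrable_slope_mult(2)[OF G_measurable(1) K(3) B(1) B(2)] integrable_slope_mult(2)[OF G_measurable(2) K(3) B(1) B(3)]
    by blast+
qed

lemma integral_J_n:
  assumes "n \<ge> 1"
  shows "integrable lborel (\<lambda>a. slope a * J_n S0 \<sigma> r T lam n a)"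
    and "(LINT a|lborel. slope a * J_n S0 \<sigma> r T lam n a)
      = 1 / sqrt n * (LINT a|lborel. slope a * G1 n a) + 1 / n * (LINT a|lborel. slope a * G2 n a)"
proof -
  have eq: "slope a * J_n S0 \<sigma> r T lam n a = 1 / sqrt n * (slope a * G1 n a) + 1 / n * (slope a * G2 n a)" for a
  \<comment> \<open>At 0 \<open>J_n\<close> is 0 by convention while \<open>G1\<close> and
    \<open>G2\<close> need not be; equality holds there because \<open>slope\<close>
    vanishes.\<close>
  proof (cases "a = 0")
    case True
    then show ?thesis using slope_nonpos[of 0] by simp
  next
    case False
    have "J_n S0 \<sigma> r T lam n a = 1 / sqrt n * G1 n a + 1 / n * G2 n a"
      using False assms by (simp add: J_n_def G1_def G2_def field_simps)
    then show ?thesis by (simp add: algebra_simps)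
  qed
  show "integrable lborel (\<lambda>a. slope a * J_n S0 \<sigma> r T lam n a)"
    unfolding eq by (intro Bochner_Integration.integrable_add integrable_mult_right integrals)
  show "(LINT a|lborel. slope a * J_n S0 \<sigma> r T lam n a)
      = 1 / sqrt n * (LINT a|lborel. slope a * G1 n a) + 1 / n * (LINT a|lborel. slope a * G2 n a)"
    unfolding eq by (subst Bochner_Integration.integral_add) (auto intro!: integrable_mult_right integrals)
qed

text \<open>The coefficient of the right jump is \<open>J_hat_n\<close> on lattice points and \<open>J_n\<close> elsewhere, which
  merges the sums over \<open>N1\<close> and \<open>N2\<close>.\<close>

definition J_right :: "nat \<Rightarrow> real \<Rightarrow> real" where
  "J_right n s = (if s \<in> lattice_points S0 \<sigma> T lam n then J_hat_n S0 \<sigma> r T lam n s else J_n S0 \<sigma> r T lam n s)"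

lemma sum_jumps:
  "(\<Sum>s\<in>N1 S0 \<sigma> T lam f n. left_jump f s * J_n S0 \<sigma> r T lam n s)
    + (\<Sum>s\<in>N1 S0 \<sigma> T lam f n. right_jump f s * J_hat_n S0 \<sigma> r T lam n s)
    + (\<Sum>s\<in>N2 S0 \<sigma> T lam f n. (left_jump f s + right_jump f s) * J_n S0 \<sigma> r T lam n s)
   = jumps_at (J_n S0 \<sigma> r T lam n) (J_right n)"
proof -
  let ?c = "\<lambda>s. left_jump f s * J_n S0 \<sigma> r T lam n s + right_jump f s * J_right n s"
  have fin': "finite (jump_points f)" using jump_points_subset fin finite_subset by blast
  have "(\<Sum>s\<in>N1 S0 \<sigma> T lam f n. left_jump f s * J_n S0 \<sigma> r T lam n s)
    + (\<Sum>s\<in>N1 S0 \<sigma> T lam f n. right_jump f s * J_hat_n S0 \<sigma> r T lam n s) = (\<Sum>s\<in>N1 S0 \<sigma> T lam f n. ?c s)"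
    unfolding sum.distrib[symmetric] by (intro sum.cong) (auto simp: N1_def J_right_def)
  moreover have "(\<Sum>s\<in>N2 S0 \<sigma> T lam f n. (left_jump f s + right_jump f s) * J_n S0 \<sigma> r T lam n s) = (\<Sum>s\<in>N2 S0 \<sigma> T lam f n. ?c s)"
    by (intro sum.cong) (auto simp: N2_def J_right_def distrib_right)
  moreover have "(\<Sum>s\<in>N1 S0 \<sigma> T lam f n. ?c s) + (\<Sum>s\<in>N2 S0 \<sigma> T lam f n. ?c s) = (\<Sum>s\<in>jump_points f. ?c s)"
    using fin' by (subst sum.union_disjoint[symmetric]) (auto simp: N1_def N2_def intro!: sum.cong)
  moreover have "(\<Sum>s\<in>jump_points f. ?c s) = (\<Sum>s\<in>S. ?c s)"
  proof (rule sum.mono_neutral_cong)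
    show "?c s = 0" if "s \<in> S - jump_points f" for s using jumps_zero[of s] that by simp
    \<comment> \<open>Only 0 can be a jump point outside S. It is never a lattice point, so both
      coefficients are the value 0 of \<open>J_n\<close> there.\<close>
    show "?c s = 0" if "s \<in> jump_points f - S" for s
    proof -
      have "s = 0" using that jump_points_subset by auto
      moreover have "0 \<notin> lattice_points S0 \<sigma> T lam n"
      proof -
        have "lattice_point S0 \<sigma> T lam n j \<noteq> 0" for j using lattice_point_pos[of n j] by simp
        then show ?thesis unfolding lattice_points_def by (metis (no_types, lifting) imageE)
      qed
      ultimately show ?thesis by (simp add: J_right_def J_n_def)
    qed
  qed (use fin fin' in auto)
  ultimately show ?thesis by (simp add: jumps_at_def)
qed

lemma jumps_at_diff: "jumps_at P Q - jumps_at P' Q' = jumps_at (\<lambda>s. P s - P' s) (\<lambda>s. Q s - Q' s)"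
  by (simp add: jumps_at_def sum_subtractf[symmetric] algebra_simps)

lemma jumps_at_bound:
  assumes "\<And>s. s \<in> S \<Longrightarrow> \<bar>P s\<bar> \<le> B" "\<And>s. s \<in> S \<Longrightarrow> \<bar>Q s\<bar> \<le> B"
  shows "\<bar>jumps_at P Q\<bar> \<le> (\<Sum>s\<in>S. \<bar>left_jump f s\<bar> + \<bar>right_jump f s\<bar>) * B"
proof -
  have "\<bar>left_jump f s * P s + right_jump f s * Q s\<bar> \<le> (\<bar>left_jump f s\<bar> + \<bar>right_jump f s\<bar>) * B" if "s \<in> S" for s
    using abs_mult_le_mult[OF order_refl assms(1)[OF that], of "left_jump f s"] 
      abs_mult_le_mult[OF order_refl assms(2)[OF that], of "right_jump f s"]
    unfolding distrib_right by linarith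
  then show ?thesis unfolding jumps_at_def sum_distrib_right by (intro order_trans[OF sum_abs] sum_mono)
qed

lemma price_error:
  "\<exists>C. \<forall>\<^sub>F n in sequentially. \<bar>V_BT S0 \<sigma> r T lam n f - (V_BS S0 \<sigma> r T f 
      + (LINT a|lborel. slope a * J_n S0 \<sigma> r T lam n a) + jumps_at (J_n S0 \<sigma> r T lam n) (J_right n))\<bar> 
     \<le> C * real n powr (-5/4)"
proof -
  obtain K C where K: "0 \<le> K" "0 < C" "\<And>a. \<bar>slope a\<bar> * exp (- K * max (z_of a) 0) \<le> C * (1 / (1 + a^2))"
    using slope_weight by blast
  obtain C' where C': "0 < C'" and ev: "\<forall>\<^sub>F n in sequentially. \<forall>a>0. 
     \<bar>prob_ge n a - (gauss_tail (z_of a) + exp (r * T) * J_n S0 \<sigma> r T lam n a)\<bar> 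
        \<le> C' * real n powr (-5/4) * exp (- K * \<bar>z_of a\<bar>) \<and>
     (a \<in> lattice_points S0 \<sigma> T lam n \<longrightarrow> 
       \<bar>prob_gt n a - (gauss_tail (z_of a) + exp (r * T) * J_hat_n S0 \<sigma> r T lam n a)\<bar> 
        \<le> C' * real n powr (-5/4) * exp (- K * \<bar>z_of a\<bar>))"
    using digital_error[OF K(1)] by blast
  define W where "W = (\<Sum>s\<in>S. \<bar>left_jump f s\<bar> + \<bar>right_jump f s\<bar>)"
  define A where "A = (LINT a::real|lborel. 1 / (1 + a^2))"
  note [measurable] = z_of_measurable
  have "\<forall>\<^sub>F n::nat in sequentially. 1 \<le> n" by (rule eventually_ge_at_top)
  with ev have "\<forall>\<^sub>F n in sequentially. \<bar>V_BT S0 \<sigma> r T lam n f - (V_BS S0 \<sigma> r T f 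
      + (LINT a|lborel. slope a * J_n S0 \<sigma> r T lam n a) + jumps_at (J_n S0 \<sigma> r T lam n) (J_right n))\<bar> 
     \<le> (exp (- r * T) * (C' * C * A + W * C')) * real n powr (-5/4)"
  proof eventually_elim
    fix n :: nat
    let ?J = "J_n S0 \<sigma> r T lam n" and ?q = "real n powr (-5/4)"
    assume bd: "\<forall>a>0. 
       \<bar>prob_ge n a - (gauss_tail (z_of a) + exp (r * T) * ?J a)\<bar> \<le> C' * ?q * exp (- K * \<bar>z_of a\<bar>) \<and>
       (a \<in> lattice_points S0 \<sigma> T lam n \<longrightarrow> 
       \<bar>prob_gt n a - (gauss_tail (z_of a) + exp (r * T) * J_hat_n S0 \<sigma> r T lam n a)\<bar> \<le> C' * ?q * exp (- K * \<bar>z_of a\<bar>))"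
      and n: "1 \<le> n"
    \<comment> \<open>E and E' are the errors of the digital prices with \<ge> and >. By linearity
      the error for f is the integral of \<open>slope\<close> against E plus the jumps weighted by E
      and E'.\<close>
    define E where "E = (\<lambda>a. prob_ge n a - (gauss_tail (z_of a) + exp (r * T) * ?J a))"
    define E' where "E' = (\<lambda>a. prob_gt n a - (gauss_tail (z_of a) + exp (r * T) * J_right n a))"
    have q: "0 \<le> C' * ?q" using C' by simp
    have Eb: "\<bar>E a\<bar> \<le> C' * ?q * exp (- K * \<bar>z_of a\<bar>)" if "0 < a" for a
      using bd that by (simp add: E_def)
    \<comment> \<open>Off the lattice the strict and the weak tail probabilities coincide, so the
      bound for \<open>prob_ge\<close> with \<open>J_n\<close> applies.\<close>
    have E'b: "\<bar>E' a\<bar> \<le> C' * ?q * exp (- K * \<bar>z_of a\<bar>)" if "0 < a" for a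
      using bd that by (cases "a \<in> lattice_points S0 \<sigma> T lam n") (auto simp: E'_def J_right_def prob_gt_eq_prob_ge)
    have le1: "C' * ?q * exp (- K * \<bar>z_of a\<bar>) \<le> C' * ?q * 1" for a
      using q K(1) by (intro mult_left_mono) auto
    have split: "slope a * E a = slope a * prob_ge n a - slope a * gauss_tail (z_of a) - exp (r * T) * (slope a * ?J a)" for a
      by (simp add: E_def algebra_simps)
    have Eint: "integrable lborel (\<lambda>a. slope a * E a)"
      unfolding split by (intro Bochner_Integration.integrable_diff integrable_mult_right integrable_slope_prob_ge 
          integrable_slope_gauss_tail integral_J_n n)
    have LE: "(LINT a|lborel. slope a * E a) = (LINT a|lborel. slope a * prob_ge n a) 
        - (LINT a|lborel. slope a * gauss_tail (z_of a)) - exp (r * T) * (LINT a|lborel. slope a * ?J a)"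
      unfolding split by (simp add: integrable_slope_prob_ge integrable_slope_gauss_tail integral_J_n(1)[OF n])
    have bdE: "\<bar>LINT a|lborel. slope a * E a\<bar> \<le> C' * ?q * C * A"
    proof -
      have p: "\<bar>slope a * E a\<bar> \<le> C' * ?q * C * (1 / (1 + a^2))" for a
      proof (cases "0 < a")
        case True
        have "C' * ?q * exp (- K * \<bar>z_of a\<bar>) \<le> C' * ?q * exp (- K * max (z_of a) 0)"
          using q K(1) by (intro mult_left_mono) (auto intro!: mult_left_mono)
        then have "\<bar>slope a * E a\<bar> \<le> \<bar>slope a\<bar> * (C' * ?q * exp (- K * max (z_of a) 0))"
          using Eb[OF True] by (intro abs_mult_le_mult) auto
        also have "\<dots> = C' * ?q * (\<bar>slope a\<bar> * exp (- K * max (z_of a) 0))" by (simp only: mult_ac)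
        also have "\<dots> \<le> C' * ?q * (C * (1 / (1 + a^2)))" using q K(3) by (rule mult_left_mono[rotated])
        finally show ?thesis by (simp only: mult.assoc)
      next
        case False
        then show ?thesis using slope_nonpos[of a] q K(2) by simp
      qed
      have "\<bar>LINT a|lborel. slope a * E a\<bar> \<le> (LINT a|lborel. \<bar>slope a * E a\<bar>)" by (rule integral_abs_bound)
      also have "\<dots> \<le> (LINT a|lborel. C' * ?q * C * (1 / (1 + a^2)))"
        by (intro integral_mono integrable_abs Eint integrable_mult_right integrable_inverse_one_plus_square p)
      also have "\<dots> = C' * ?q * C * A" unfolding A_def by (rule integral_mult_right_zero)
      finally show ?thesis .
    qed
    have bdJ: "\<bar>jumps_at E E'\<bar> \<le> W * (C' * ?q)"
      unfolding W_def
    proof (rule jumps_at_bound)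
      fix s assume "s \<in> S"
      then have "0 < s" using S_pos by auto
      then show "\<bar>E s\<bar> \<le> C' * ?q" "\<bar>E' s\<bar> \<le> C' * ?q" using Eb[of s] E'b[of s] le1[of s] by simp_all
    qed
    have JE: "jumps_at E E' = jumps_at (prob_ge n) (prob_gt n) - jumps_at (\<lambda>s. gauss_tail (z_of s)) (\<lambda>s. gauss_tail (z_of s))
        - exp (r * T) * jumps_at ?J (J_right n)"
    proof -
      have "exp (r * T) * jumps_at ?J (J_right n) = jumps_at (\<lambda>s. exp (r * T) * ?J s) (\<lambda>s. exp (r * T) * J_right n s)"
        by (simp add: jumps_at_def sum_distrib_left algebra_simps)
      then show ?thesis unfolding jumps_at_diff E_def E'_def by (simp add: jumps_at_diff diff_diff_add)
    qed
    have ee: "exp (- r * T) * exp (r * T) = 1" by (simp add: exp_add[symmetric])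
    \<comment> \<open>Pure algebra with v the discount factor and w its inverse: the constant
      \<open>start\<close> cancels, and w undoes the discounting contained in the \<open>J_n\<close>
      terms.\<close>
    have alg: "v * (st + p + jp) - (v * (st + g + jg) + i + ji) = v * ((p - g - w * i) + (jp - jg - w * ji))"
      if "v * w = 1" for v w st p jp g jg i ji :: real
    proof -
      have "v * ((p - g - w * i) + (jp - jg - w * ji)) = v * (st + p + jp) - v * (st + g + jg) - (v * w) * i - (v * w) * ji"
        by (simp add: algebra_simps)
      then show ?thesis using that by simp
    qed
    have "V_BT S0 \<sigma> r T lam n f - (V_BS S0 \<sigma> r T f + (LINT a|lborel. slope a * ?J a) + jumps_at ?J (J_right n))
       = exp (- r * T) * ((LINT a|lborel. slope a * E a) + jumps_at E E')"
      unfolding V_BT_eq V_BS_eq LE JE by (rule alg[OF ee])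
    also have "\<bar>\<dots>\<bar> \<le> exp (- r * T) * (C' * ?q * C * A + W * (C' * ?q))"
      using bdE bdJ by (intro abs_mult_le_mult) auto
    also have "\<dots> = (exp (- r * T) * (C' * C * A + W * C')) * ?q" by (simp add: algebra_simps)
    finally show "\<bar>V_BT S0 \<sigma> r T lam n f - (V_BS S0 \<sigma> r T f + (LINT a|lborel. slope a * ?J a) + jumps_at ?J (J_right n))\<bar> 
       \<le> (exp (- r * T) * (C' * C * A + W * C')) * ?q" .
  qed
  then show ?thesis by blast
qed

end

theorem theorem3p3:
  fixes S0 \<sigma> r T :: real and lam :: "nat \<Rightarrow> real" and f :: "real \<Rightarrow> real"
  assumes "S0 > 0" and "\<sigma> > 0" and "T > 0"
    and "Bseq lam"
    and "f \<in> payoff_class"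
    and "deriv_poly_bounded f"
  shows "integrable std_normal_distribution (\<lambda>z. f (BS_stock S0 \<sigma> r T z))
    \<and> (\<forall>n\<ge>1. set_integrable lborel {0<..} (integrand1 S0 \<sigma> r T lam f n)
            \<and> set_integrable lborel {0<..} (integrand2 S0 \<sigma> r T lam f n))
    \<and> (\<lambda>n. V_BT S0 \<sigma> r T lam n f -
         (V_BS S0 \<sigma> r T f
          + 1 / sqrt (real n) * (LINT a:{0<..}|lborel. integrand1 S0 \<sigma> r T lam f n a)
          + 1 / real n * (LINT a:{0<..}|lborel. integrand2 S0 \<sigma> r T lam f n a)
          + (\<Sum>s\<in>N1 S0 \<sigma> T lam f n. left_jump f s * J_n S0 \<sigma> r T lam n s)
          + (\<Sum>s\<in>N1 S0 \<sigma> T lam f n. right_jump f s * J_hat_n S0 \<sigma> r T lam n s)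
          + (\<Sum>s\<in>N2 S0 \<sigma> T lam f n. (left_jump f s + right_jump f s) * J_n S0 \<sigma> r T lam n s)))
       \<in> o(\<lambda>n. 1 / real n)
    \<and> (\<exists>C. \<forall>n\<ge>1. \<bar>LINT a:{0<..}|lborel. integrand1 S0 \<sigma> r T lam f n a\<bar> \<le> C)
    \<and> (\<exists>C. \<forall>n\<ge>1. \<bar>LINT a:{0<..}|lborel. integrand2 S0 \<sigma> r T lam f n a\<bar> \<le> C)"
proof -
  obtain S c1 c2 q where "payoff f S c1 c2 q" using payoff_exists[OF assms(5,6)] by blast
  then interpret option_model S0 \<sigma> r T lam f S c1 c2 q
    using assms by (intro option_model.intro binomial_model.intro) auto
  have si: "set_integrable lborel {0<..} (integrand1 S0 \<sigma> r T lam f n)" "set_integrable lborel {0<..} (integrand2 S0 \<sigma> r T lam f n)" for n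
    unfolding integrand_eq by (intro set_integral_deriv_mult G_measurable integrals)+
  have I1: "(LINT a:{0<..}|lborel. integrand1 S0 \<sigma> r T lam f n a) = (LINT a|lborel. slope a * G1 n a)" for n
    unfolding integrand_eq by (intro set_integral_deriv_mult G_measurable integrals)
  have I2: "(LINT a:{0<..}|lborel. integrand2 S0 \<sigma> r T lam f n a) = (LINT a|lborel. slope a * G2 n a)" for n
    unfolding integrand_eq by (intro set_integral_deriv_mult G_measurable integrals)
  let ?err = "\<lambda>n. V_BT S0 \<sigma> r T lam n f -
         (V_BS S0 \<sigma> r T f
          + 1 / sqrt (real n) * (LINT a:{0<..}|lborel. integrand1 S0 \<sigma> r T lam f n a)
          + 1 / real n * (LINT a:{0<..}|lborel. integrand2 S0 \<sigma> r T lam f n a)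
          + (\<Sum>s\<in>N1 S0 \<sigma> T lam f n. left_jump f s * J_n S0 \<sigma> r T lam n s)
          + (\<Sum>s\<in>N1 S0 \<sigma> T lam f n. right_jump f s * J_hat_n S0 \<sigma> r T lam n s)
          + (\<Sum>s\<in>N2 S0 \<sigma> T lam f n. (left_jump f s + right_jump f s) * J_n S0 \<sigma> r T lam n s))"
  \<comment> \<open>Merges the two integrals into one against \<open>J_n\<close> and the three jump
    sums into \<open>jumps_at\<close>.\<close>
  have eq: "?err n = V_BT S0 \<sigma> r T lam n f - (V_BS S0 \<sigma> r T f 
      + (LINT a|lborel. slope a * J_n S0 \<sigma> r T lam n a) + jumps_at (J_n S0 \<sigma> r T lam n) (J_right n))" if "n \<ge> 1" for n
    unfolding sum_jumps[symmetric] integral_J_n(2)[OF that] I1 I2 by simp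
  obtain C where C: "\<forall>\<^sub>F n in sequentially. \<bar>V_BT S0 \<sigma> r T lam n f - (V_BS S0 \<sigma> r T f 
      + (LINT a|lborel. slope a * J_n S0 \<sigma> r T lam n a) + jumps_at (J_n S0 \<sigma> r T lam n) (J_right n))\<bar> 
     \<le> C * real n powr (-5/4)"
    using price_error by blast
  have "?err \<in> O(\<lambda>n. real n powr (-5/4))"
  proof (rule bigoI)
    show "\<forall>\<^sub>F n in sequentially. norm (?err n) \<le> C * norm (real n powr (-5/4))"
      using C eventually_ge_at_top[of 1]
    proof eventually_elim
      case (elim n)
      then show ?case by (subst eq) auto
    qed
  qed
  also have "(\<lambda>n. real n powr (-5/4)) \<in> o(\<lambda>n. 1 / real n)" by real_asymp
  finally have "?err \<in> o(\<lambda>n. 1 / real n)" .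
  then show ?thesis using integrable_payoff si integrals(3,4) unfolding I1 I2 by blast
qed

end
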